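(* Let $\mathfrak{A}$ be an essentially small abelian $\mathbb{Q}$-linear tensor category whose tensor product is biexact. Then $\lambda_\Sigma$ is well defined on $K_0(\mathfrak A)$, that is, $$\mathrm{cl}\bigl(S_\pi(Y)\bigr)=\mathrm{cl}\bigl(S_\pi(X\oplus Z)\bigr)$$ in $K_0(\mathfrak A)$ for any exact sequence $0\to X\to Y\to Z\to0$ in $\mathfrak A$ and any partition $\pi$.
   Context: A $\mathbb{Q}$-linear tensor category is a $\mathbb{Q}$-linear additive category with a $\mathbb{Q}$-bilinear associative, commutative, unital tensor product (a symmetric monoidal structure). Here $K_0(\mathfrak A)$ is the Grothendieck group of the abelian category $\mathfrak A$, i.e. the free abelian group on isomorphism classes of objects modulo $\mathrm{cl}(Z)-\mathrm{cl}(X)-\mathrm{cl}(Y)$ for all short exact sequences $0\to X\to Z\to Y\to0$; it is a commutative ring via $\otimes$. For a partition $\pi$ of $n=|\pi|$, $V_\pi$ is the corresponding irreducible $\mathbb Q\Sigma_n$-module; $\Sigma_n$ acts on $X^{\otimes n}$ through the commutativity constraint and $S_\pi(X)$ is the image of an idempotent $e_\pi\in\mathbb Q\Sigma_n$ with $V_\pi=e_\pi\mathbb Q\Sigma_n$ acting on $X^{\otimes n}$. $\lambda_\Sigma$ is the assignment $\lambda_\Sigma(X)=\sum_\mu\mathrm{cl}(S_\mu(X))\otimes\mathrm{cl}(V_\mu)\,t^{|\mu|}\in(K_0(\mathfrak A)\otimes_{\mathbb Z}R)[[t]]^\times$, the sum being over all partitions $\mu$ with $|\mu|\ge0$; here $R=\coprod_{n\ge0}R_n$,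 with $R_n$ the Grothendieck group of finitely generated $\mathbb Q\Sigma_n$-modules, is the ring with product $\mathrm{cl}(V)\mathrm{cl}(W)=\mathrm{cl}(\mathrm{Ind}^{\Sigma_{p+q}}_{\Sigma_p\times\Sigma_q}(V\otimes W))$. *)

theory Defs
  imports
    "HOL-Algebra.Free_Abelian_Groups"
    "HOL-Algebra.Generated_Groups"
    "HOL-Algebra.Ring"
    "HOL-Combinatorics.Permutations"
begin

section \<open>Categories with rational-linear structure\<close>

text \<open>
  A category is given by a set of objects and a set of arrows, both inside HOL types, and is
  therefore small; the types are arbitrary.  An essentially small category is one that is
  equivalent to a category of this kind.
\<close>

record ('o, 'm) lin_cat =
  Ob :: "'o set"
  Arr :: "'m set"
  Dom :: "'m \<Rightarrow> 'o"
  Cod :: "'m \<Rightarrow> 'o"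
  Ident :: "'o \<Rightarrow> 'm"
  Comp :: "'m \<Rightarrow> 'm \<Rightarrow> 'm" (infixr "\<cdot>\<index>" 75)
  Zero :: "'o \<Rightarrow> 'o \<Rightarrow> 'm"
  Add :: "'m \<Rightarrow> 'm \<Rightarrow> 'm" (infixl "\<boxplus>\<index>" 65)
  Scal :: "rat \<Rightarrow> 'm \<Rightarrow> 'm"

definition Hom :: "('o, 'm, 'z) lin_cat_scheme \<Rightarrow> 'o \<Rightarrow> 'o \<Rightarrow> 'm set" where
  "Hom C X Y = {f \<in> Arr C. Dom C f = X \<and> Cod C f = Y}"

definition hom_group :: "('o, 'm, 'z) lin_cat_scheme \<Rightarrow> 'o \<Rightarrow> 'o \<Rightarrow> 'm monoid" where
  "hom_group C X Y = \<lparr>carrier = Hom C X Y, monoid.mult = Add C, one = Zero C X Y\<rparr>"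

locale category =
  fixes C :: "('o, 'm, 'z) lin_cat_scheme" (structure)
  assumes Dom_in_Ob: "f \<in> Arr C \<Longrightarrow> Dom C f \<in> Ob C"
    and Cod_in_Ob: "f \<in> Arr C \<Longrightarrow> Cod C f \<in> Ob C"
    and Ident_in_Hom: "X \<in> Ob C \<Longrightarrow> Ident C X \<in> Hom C X X"
    and Comp_in_Hom: "\<lbrakk>f \<in> Hom C X Y; g \<in> Hom C Y Z\<rbrakk> \<Longrightarrow> g \<cdot> f \<in> Hom C X Z"
    and Comp_assoc: "\<lbrakk>f \<in> Hom C W X; g \<in> Hom C X Y; h \<in> Hom C Y Z\<rbrakk>
                       \<Longrightarrow> (h \<cdot> g) \<cdot> f = h \<cdot> (g \<cdot> f)"
    and Ident_left: "f \<in> Hom C X Y \<Longrightarrow> Ident C Y \<cdot> f = f"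
    and Ident_right: "f \<in> Hom C X Y \<Longrightarrow> f \<cdot> Ident C X = f"

locale linear_category = category +
  assumes hom_comm_group: "\<lbrakk>X \<in> Ob C; Y \<in> Ob C\<rbrakk> \<Longrightarrow> comm_group (hom_group C X Y)"
    and Scal_in_Hom: "f \<in> Hom C X Y \<Longrightarrow> Scal C a f \<in> Hom C X Y"
    and Scal_add: "\<lbrakk>f \<in> Hom C X Y; g \<in> Hom C X Y\<rbrakk>
                     \<Longrightarrow> Scal C a (f \<boxplus> g) = Scal C a f \<boxplus> Scal C a g"
    and add_Scal: "f \<in> Arr C \<Longrightarrow> Scal C (a + b) f = Scal C a f \<boxplus> Scal C b f"
    and Scal_Scal: "f \<in> Arr C \<Longrightarrow> Scal C a (Scal C b f) = Scal C (a * b) f"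
    and one_Scal: "f \<in> Arr C \<Longrightarrow> Scal C 1 f = f"
    and Comp_Add_right: "\<lbrakk>f \<in> Hom C X Y; f' \<in> Hom C X Y; g \<in> Hom C Y Z\<rbrakk>
                           \<Longrightarrow> g \<cdot> (f \<boxplus> f') = g \<cdot> f \<boxplus> g \<cdot> f'"
    and Comp_Add_left: "\<lbrakk>f \<in> Hom C X Y; g \<in> Hom C Y Z; g' \<in> Hom C Y Z\<rbrakk>
                           \<Longrightarrow> (g \<boxplus> g') \<cdot> f = g \<cdot> f \<boxplus> g' \<cdot> f"
    and Comp_Scal_right: "\<lbrakk>f \<in> Hom C X Y; g \<in> Hom C Y Z\<rbrakk> \<Longrightarrow> g \<cdot> Scal C a f = Scal C a (g \<cdot> f)"
    and Comp_Scal_left: "\<lbrakk>f \<in> Hom C X Y; g \<in> Hom C Y Z\<rbrakk> \<Longrightarrow> Scal C a g \<cdot> f = Scal C a (g \<cdot> f)"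

definition inverse_arrows :: "('o, 'm, 'z) lin_cat_scheme \<Rightarrow> 'm \<Rightarrow> 'm \<Rightarrow> bool" where
  "inverse_arrows C f g \<longleftrightarrow> f \<in> Arr C \<and> g \<in> Hom C (Cod C f) (Dom C f) \<and>
     Comp C g f = Ident C (Dom C f) \<and> Comp C f g = Ident C (Cod C f)"

definition iso_arrow :: "('o, 'm, 'z) lin_cat_scheme \<Rightarrow> 'm \<Rightarrow> bool" where
  "iso_arrow C f \<longleftrightarrow> (\<exists>g. inverse_arrows C f g)"

definition inverse_arrow :: "('o, 'm, 'z) lin_cat_scheme \<Rightarrow> 'm \<Rightarrow> 'm" where
  "inverse_arrow C f = (THE g. inverse_arrows C f g)"

definition isomorphic :: "('o, 'm, 'z) lin_cat_scheme \<Rightarrow> 'o \<Rightarrow> 'o \<Rightarrow> bool" where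
  "isomorphic C X Y \<longleftrightarrow> (\<exists>f \<in> Hom C X Y. iso_arrow C f)"

definition mono_arrow :: "('o, 'm, 'z) lin_cat_scheme \<Rightarrow> 'm \<Rightarrow> bool" where
  "mono_arrow C f \<longleftrightarrow> f \<in> Arr C \<and>
     (\<forall>W. \<forall>g \<in> Hom C W (Dom C f). \<forall>h \<in> Hom C W (Dom C f). Comp C f g = Comp C f h \<longrightarrow> g = h)"

definition epi_arrow :: "('o, 'm, 'z) lin_cat_scheme \<Rightarrow> 'm \<Rightarrow> bool" where
  "epi_arrow C f \<longleftrightarrow> f \<in> Arr C \<and>
     (\<forall>W. \<forall>g \<in> Hom C (Cod C f) W. \<forall>h \<in> Hom C (Cod C f) W. Comp C g f = Comp C h f \<longrightarrow> g = h)"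

definition zero_object :: "('o, 'm, 'z) lin_cat_scheme \<Rightarrow> 'o \<Rightarrow> bool" where
  "zero_object C N \<longleftrightarrow> N \<in> Ob C \<and>
     (\<forall>X \<in> Ob C. (\<exists>!f. f \<in> Hom C X N) \<and> (\<exists>!f. f \<in> Hom C N X))"

text \<open>\<open>W\<close>, with injections \<open>i1, i2\<close> and projections \<open>p1, p2\<close>, is a direct sum of \<open>X\<close> and \<open>Z\<close>.\<close>

definition direct_sum ::
    "('o, 'm, 'z) lin_cat_scheme \<Rightarrow> 'o \<Rightarrow> 'o \<Rightarrow> 'o \<Rightarrow> 'm \<Rightarrow> 'm \<Rightarrow> 'm \<Rightarrow> 'm \<Rightarrow> bool" where
  "direct_sum C X Z W i1 i2 p1 p2 \<longleftrightarrow>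
     i1 \<in> Hom C X W \<and> i2 \<in> Hom C Z W \<and> p1 \<in> Hom C W X \<and> p2 \<in> Hom C W Z \<and>
     Comp C p1 i1 = Ident C X \<and> Comp C p2 i2 = Ident C Z \<and>
     Comp C p1 i2 = Zero C Z X \<and> Comp C p2 i1 = Zero C X Z \<and>
     Add C (Comp C i1 p1) (Comp C i2 p2) = Ident C W"

locale additive_category = linear_category +
  assumes ex_zero_object: "\<exists>N. zero_object C N"
    and ex_direct_sum: "\<lbrakk>X \<in> Ob C; Z \<in> Ob C\<rbrakk> \<Longrightarrow> \<exists>W i1 i2 p1 p2. direct_sum C X Z W i1 i2 p1 p2"

definition is_kernel :: "('o, 'm, 'z) lin_cat_scheme \<Rightarrow> 'm \<Rightarrow> 'm \<Rightarrow> bool" where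
  "is_kernel C f k \<longleftrightarrow> f \<in> Arr C \<and> k \<in> Arr C \<and> Cod C k = Dom C f \<and>
     Comp C f k = Zero C (Dom C k) (Cod C f) \<and>
     (\<forall>W. \<forall>h \<in> Hom C W (Dom C f). Comp C f h = Zero C W (Cod C f) \<longrightarrow>
        (\<exists>!u. u \<in> Hom C W (Dom C k) \<and> Comp C k u = h))"

definition is_cokernel :: "('o, 'm, 'z) lin_cat_scheme \<Rightarrow> 'm \<Rightarrow> 'm \<Rightarrow> bool" where
  "is_cokernel C f c \<longleftrightarrow> f \<in> Arr C \<and> c \<in> Arr C \<and> Dom C c = Cod C f \<and>
     Comp C c f = Zero C (Dom C f) (Cod C c) \<and>
     (\<forall>W. \<forall>h \<in> Hom C (Cod C f) W. Comp C h f = Zero C (Dom C f) W \<longrightarrow>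
        (\<exists>!u. u \<in> Hom C (Cod C c) W \<and> Comp C u c = h))"

locale abelian_category = additive_category +
  assumes ex_kernel: "f \<in> Arr C \<Longrightarrow> \<exists>k. is_kernel C f k"
    and ex_cokernel: "f \<in> Arr C \<Longrightarrow> \<exists>c. is_cokernel C f c"
    and mono_is_kernel: "mono_arrow C f \<Longrightarrow> \<exists>g. is_kernel C g f"
    and epi_is_cokernel: "epi_arrow C f \<Longrightarrow> \<exists>g. is_cokernel C g f"

definition is_image :: "('o, 'm, 'z) lin_cat_scheme \<Rightarrow> 'm \<Rightarrow> 'm \<Rightarrow> bool" where
  "is_image C f i \<longleftrightarrow> (\<exists>c. is_cokernel C f c \<and> is_kernel C c i)"

text \<open>\<open>0 \<rightarrow> X \<rightarrow> Y \<rightarrow> Z \<rightarrow> 0\<close> with arrows \<open>f : X \<rightarrow> Y\<close> and \<open>g : Y \<rightarrow> Z\<close>.\<close>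

definition short_exact ::
    "('o, 'm, 'z) lin_cat_scheme \<Rightarrow> 'o \<Rightarrow> 'm \<Rightarrow> 'o \<Rightarrow> 'm \<Rightarrow> 'o \<Rightarrow> bool" where
  "short_exact C X f Y g Z \<longleftrightarrow>
     f \<in> Hom C X Y \<and> g \<in> Hom C Y Z \<and> is_kernel C g f \<and> is_cokernel C f g"


section \<open>The Grothendieck group of an abelian category\<close>

definition iso_class :: "('o, 'm, 'z) lin_cat_scheme \<Rightarrow> 'o \<Rightarrow> 'o set" where
  "iso_class C X = {Y \<in> Ob C. isomorphic C X Y}"

definition K0_free :: "('o, 'm, 'z) lin_cat_scheme \<Rightarrow> ('o set \<Rightarrow>\<^sub>0 int) monoid" where
  "K0_free C = free_Abelian_group (iso_class C ` Ob C)"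

definition K0_relations :: "('o, 'm, 'z) lin_cat_scheme \<Rightarrow> ('o set \<Rightarrow>\<^sub>0 int) set" where
  "K0_relations C = generate (K0_free C)
     {frag_of (iso_class C Z) - frag_of (iso_class C X) - frag_of (iso_class C Y) | X f Z g Y.
        short_exact C X f Z g Y}"

definition K0 :: "('o, 'm, 'z) lin_cat_scheme \<Rightarrow> ('o set \<Rightarrow>\<^sub>0 int) set monoid" where
  "K0 C = K0_free C Mod K0_relations C"

text \<open>The class \<open>cl(X)\<close> in \<^term>\<open>K0 C\<close>.\<close>

definition cl :: "('o, 'm, 'z) lin_cat_scheme \<Rightarrow> 'o \<Rightarrow> ('o set \<Rightarrow>\<^sub>0 int) set" where
  "cl C X = K0_relations C #>\<^bsub>K0_free C\<^esub> frag_of (iso_class C X)"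


section \<open>Tensor categories\<close>

record ('o, 'm) tensor_cat = "('o, 'm) lin_cat" +
  Unit :: "'o"
  TenO :: "'o \<Rightarrow> 'o \<Rightarrow> 'o" (infixl "\<otimes>\<^sub>o\<index>" 80)
  TenM :: "'m \<Rightarrow> 'm \<Rightarrow> 'm" (infixl "\<otimes>\<^sub>m\<index>" 80)
  Assoc :: "'o \<Rightarrow> 'o \<Rightarrow> 'o \<Rightarrow> 'm"
  LUnit :: "'o \<Rightarrow> 'm"
  RUnit :: "'o \<Rightarrow> 'm"
  Braid :: "'o \<Rightarrow> 'o \<Rightarrow> 'm"

text \<open>
  The constraints are natural isomorphisms \<open>(X \<otimes> Y) \<otimes> Z \<rightarrow> X \<otimes> (Y \<otimes> Z)\<close>, \<open>1 \<otimes> X \<rightarrow> X\<close>,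
  \<open>X \<otimes> 1 \<rightarrow> X\<close> and \<open>X \<otimes> Y \<rightarrow> Y \<otimes> X\<close>.
\<close>

locale linear_tensor_category = additive_category C
  for C :: "('o, 'm, 'z) tensor_cat_scheme" (structure) +
  assumes Unit_in_Ob: "Unit C \<in> Ob C"
    and TenO_in_Ob: "\<lbrakk>X \<in> Ob C; Y \<in> Ob C\<rbrakk> \<Longrightarrow> X \<otimes>\<^sub>o Y \<in> Ob C"
    and TenM_in_Hom: "\<lbrakk>f \<in> Hom C X X'; g \<in> Hom C Y Y'\<rbrakk> \<Longrightarrow> f \<otimes>\<^sub>m g \<in> Hom C (X \<otimes>\<^sub>o Y) (X' \<otimes>\<^sub>o Y')"
    and TenM_Ident: "\<lbrakk>X \<in> Ob C; Y \<in> Ob C\<rbrakk> \<Longrightarrow> Ident C X \<otimes>\<^sub>m Ident C Y = Ident C (X \<otimes>\<^sub>o Y)"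
    and TenM_Comp: "\<lbrakk>f \<in> Hom C X X'; f' \<in> Hom C X' X''; g \<in> Hom C Y Y'; g' \<in> Hom C Y' Y''\<rbrakk>
                      \<Longrightarrow> (f' \<cdot> f) \<otimes>\<^sub>m (g' \<cdot> g) = (f' \<otimes>\<^sub>m g') \<cdot> (f \<otimes>\<^sub>m g)"
    and TenM_Add_left: "\<lbrakk>f \<in> Hom C X X'; f' \<in> Hom C X X'; g \<in> Hom C Y Y'\<rbrakk>
                      \<Longrightarrow> (f \<boxplus> f') \<otimes>\<^sub>m g = (f \<otimes>\<^sub>m g) \<boxplus> (f' \<otimes>\<^sub>m g)"
    and TenM_Add_right: "\<lbrakk>f \<in> Hom C X X'; g \<in> Hom C Y Y'; g' \<in> Hom C Y Y'\<rbrakk>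
                      \<Longrightarrow> f \<otimes>\<^sub>m (g \<boxplus> g') = (f \<otimes>\<^sub>m g) \<boxplus> (f \<otimes>\<^sub>m g')"
    and TenM_Scal_left: "\<lbrakk>f \<in> Arr C; g \<in> Arr C\<rbrakk> \<Longrightarrow> Scal C a f \<otimes>\<^sub>m g = Scal C a (f \<otimes>\<^sub>m g)"
    and TenM_Scal_right: "\<lbrakk>f \<in> Arr C; g \<in> Arr C\<rbrakk> \<Longrightarrow> f \<otimes>\<^sub>m Scal C a g = Scal C a (f \<otimes>\<^sub>m g)"
    and Assoc_in_Hom: "\<lbrakk>X \<in> Ob C; Y \<in> Ob C; Z \<in> Ob C\<rbrakk>
                      \<Longrightarrow> Assoc C X Y Z \<in> Hom C (X \<otimes>\<^sub>o Y \<otimes>\<^sub>o Z) (X \<otimes>\<^sub>o (Y \<otimes>\<^sub>o Z))"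
    and Assoc_iso: "\<lbrakk>X \<in> Ob C; Y \<in> Ob C; Z \<in> Ob C\<rbrakk> \<Longrightarrow> iso_arrow C (Assoc C X Y Z)"
    and Assoc_natural: "\<lbrakk>f \<in> Hom C X X'; g \<in> Hom C Y Y'; h \<in> Hom C Z Z'\<rbrakk>
                      \<Longrightarrow> Assoc C X' Y' Z' \<cdot> (f \<otimes>\<^sub>m g \<otimes>\<^sub>m h) = (f \<otimes>\<^sub>m (g \<otimes>\<^sub>m h)) \<cdot> Assoc C X Y Z"
    and LUnit_in_Hom: "X \<in> Ob C \<Longrightarrow> LUnit C X \<in> Hom C (Unit C \<otimes>\<^sub>o X) X"
    and LUnit_iso: "X \<in> Ob C \<Longrightarrow> iso_arrow C (LUnit C X)"
    and LUnit_natural: "f \<in> Hom C X X' \<Longrightarrow> LUnit C X' \<cdot> (Ident C (Unit C) \<otimes>\<^sub>m f) = f \<cdot> LUnit C X"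
    and RUnit_in_Hom: "X \<in> Ob C \<Longrightarrow> RUnit C X \<in> Hom C (X \<otimes>\<^sub>o Unit C) X"
    and RUnit_iso: "X \<in> Ob C \<Longrightarrow> iso_arrow C (RUnit C X)"
    and RUnit_natural: "f \<in> Hom C X X' \<Longrightarrow> RUnit C X' \<cdot> (f \<otimes>\<^sub>m Ident C (Unit C)) = f \<cdot> RUnit C X"
    and Braid_in_Hom: "\<lbrakk>X \<in> Ob C; Y \<in> Ob C\<rbrakk> \<Longrightarrow> Braid C X Y \<in> Hom C (X \<otimes>\<^sub>o Y) (Y \<otimes>\<^sub>o X)"
    and Braid_natural: "\<lbrakk>f \<in> Hom C X X'; g \<in> Hom C Y Y'\<rbrakk>
                      \<Longrightarrow> Braid C X' Y' \<cdot> (f \<otimes>\<^sub>m g) = (g \<otimes>\<^sub>m f) \<cdot> Braid C X Y"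
    and Braid_symmetric: "\<lbrakk>X \<in> Ob C; Y \<in> Ob C\<rbrakk>
                      \<Longrightarrow> Braid C Y X \<cdot> Braid C X Y = Ident C (X \<otimes>\<^sub>o Y)"
    and pentagon: "\<lbrakk>W \<in> Ob C; X \<in> Ob C; Y \<in> Ob C; Z \<in> Ob C\<rbrakk>
                      \<Longrightarrow> Assoc C W X (Y \<otimes>\<^sub>o Z) \<cdot> Assoc C (W \<otimes>\<^sub>o X) Y Z
                        = (Ident C W \<otimes>\<^sub>m Assoc C X Y Z) \<cdot> Assoc C W (X \<otimes>\<^sub>o Y) Z
                            \<cdot> (Assoc C W X Y \<otimes>\<^sub>m Ident C Z)"
    and triangle: "\<lbrakk>X \<in> Ob C; Y \<in> Ob C\<rbrakk>
                      \<Longrightarrow> (Ident C X \<otimes>\<^sub>m LUnit C Y) \<cdot> Assoc C X (Unit C) Y = RUnit C X \<otimes>\<^sub>m Ident C Y"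
    and hexagon: "\<lbrakk>X \<in> Ob C; Y \<in> Ob C; Z \<in> Ob C\<rbrakk>
                      \<Longrightarrow> Assoc C Y Z X \<cdot> Braid C X (Y \<otimes>\<^sub>o Z) \<cdot> Assoc C X Y Z
                        = (Ident C Y \<otimes>\<^sub>m Braid C X Z) \<cdot> Assoc C Y X Z \<cdot> (Braid C X Y \<otimes>\<^sub>m Ident C Z)"

locale abelian_tensor_category = abelian_category C + linear_tensor_category C
  for C :: "('o, 'm, 'z) tensor_cat_scheme" (structure)

definition biexact :: "('o, 'm, 'z) tensor_cat_scheme \<Rightarrow> bool" where
  "biexact C \<longleftrightarrow> (\<forall>X f Y g Z W. short_exact C X f Y g Z \<and> W \<in> Ob C \<longrightarrow>
     short_exact C (TenO C X W) (TenM C f (Ident C W)) (TenO C Y W) (TenM C g (Ident C W)) (TenO C Z W) \<and>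
     short_exact C (TenO C W X) (TenM C (Ident C W) f) (TenO C W Y) (TenM C (Ident C W) g) (TenO C W Z))"


section \<open>The symmetric group acting on tensor powers\<close>

fun tensor_power :: "('o, 'm, 'z) tensor_cat_scheme \<Rightarrow> 'o \<Rightarrow> nat \<Rightarrow> 'o" where
  "tensor_power C X 0 = Unit C"
| "tensor_power C X (Suc n) = TenO C (tensor_power C X n) X"

text \<open>
  For \<open>1 \<le> i < n\<close>, \<open>adjacent_swap C X n i\<close> is the automorphism of the \<open>n\<close>th tensor power of \<open>X\<close>
  that applies the commutativity constraint to the factors in positions \<open>i\<close> and \<open>i + 1\<close>; other
  values of \<open>i\<close> are irrelevant.
\<close>

fun adjacent_swap :: "('o, 'm, 'z) tensor_cat_scheme \<Rightarrow> 'o \<Rightarrow> nat \<Rightarrow> nat \<Rightarrow> 'm" where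
  "adjacent_swap C X 0 i = Ident C (Unit C)"
| "adjacent_swap C X (Suc 0) i = Ident C (TenO C (Unit C) X)"
| "adjacent_swap C X (Suc (Suc n)) i =
     (if i = Suc n then
        Comp C (inverse_arrow C (Assoc C (tensor_power C X n) X X))
         (Comp C (TenM C (Ident C (tensor_power C X n)) (Braid C X X))
           (Assoc C (tensor_power C X n) X X))
      else TenM C (adjacent_swap C X (Suc n) i) (Ident C X))"

text \<open>
  The action of a permutation is the composite of adjacent swaps along any expression of it as a
  product of adjacent transpositions; by coherence the expression does not matter.  The factor in
  position \<open>k\<close> is moved to position \<open>p k\<close>, so this is a left action.
\<close>

inductive swap_composite ::
    "('o, 'm, 'z) tensor_cat_scheme \<Rightarrow> 'o \<Rightarrow> nat \<Rightarrow> (nat \<Rightarrow> nat) \<Rightarrow> 'm \<Rightarrow> bool"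
  for C X n where
  Id: "swap_composite C X n id (Ident C (tensor_power C X n))"
| Swap: "\<lbrakk>swap_composite C X n p f; 1 \<le> i; i < n\<rbrakk>
           \<Longrightarrow> swap_composite C X n (transpose i (Suc i) \<circ> p) (Comp C (adjacent_swap C X n i) f)"

definition perm_action ::
    "('o, 'm, 'z) tensor_cat_scheme \<Rightarrow> 'o \<Rightarrow> nat \<Rightarrow> (nat \<Rightarrow> nat) \<Rightarrow> 'm" where
  "perm_action C X n p = (THE f. swap_composite C X n p f)"

text \<open>
  Elements of the group algebra \<open>\<rat>\<Sigma>\<^sub>n\<close>, with \<open>\<Sigma>\<^sub>n\<close> the permutations of \<open>{1..n}\<close>, are rational
  functions on permutations.
\<close>

definition sym_algebra :: "nat \<Rightarrow> ((nat \<Rightarrow> nat) \<Rightarrow> rat) ring" where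
  "sym_algebra n = \<lparr>
     carrier = {a. \<forall>p. a p \<noteq> 0 \<longrightarrow> p permutes {1..n}},
     monoid.mult = (\<lambda>a b p. \<Sum>(q, r) \<in> {(q, r). q permutes {1..n} \<and> r permutes {1..n} \<and> q \<circ> r = p}. a q * b r),
     one = (\<lambda>p. if p = id then 1 else 0),
     zero = (\<lambda>p. 0),
     add = (\<lambda>a b p. a p + b p)\<rparr>"

definition algebra_action ::
    "('o, 'm, 'z) tensor_cat_scheme \<Rightarrow> 'o \<Rightarrow> nat \<Rightarrow> ((nat \<Rightarrow> nat) \<Rightarrow> rat) \<Rightarrow> 'm" where
  "algebra_action C X n a =
     finprod (hom_group C (tensor_power C X n) (tensor_power C X n))
       (\<lambda>p. Scal C (a p) (perm_action C X n p)) {p. p permutes {1..n}}"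


section \<open>Partitions, Specht modules and Schur functors\<close>

definition integer_partition :: "nat list \<Rightarrow> bool" where
  "integer_partition \<pi> \<longleftrightarrow> sorted_wrt (\<ge>) \<pi> \<and> 0 \<notin> set \<pi>"

definition diagram :: "nat list \<Rightarrow> (nat \<times> nat) set" where
  "diagram \<pi> = {(i, j). i < length \<pi> \<and> j < \<pi> ! i}"

text \<open>The tableau of shape \<open>\<pi>\<close> whose rows, read from top to bottom, are filled with \<open>1, 2, \<dots>, |\<pi>|\<close>.\<close>

definition tableau :: "nat list \<Rightarrow> nat \<times> nat \<Rightarrow> nat" where
  "tableau \<pi> = (\<lambda>(i, j). sum_list (take i \<pi>) + j + 1)"

definition row_group :: "nat list \<Rightarrow> (nat \<Rightarrow> nat) set" where
  "row_group \<pi> = {p. p permutes {1..sum_list \<pi>} \<and>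
     (\<forall>(i, j) \<in> diagram \<pi>. \<exists>j'. (i, j') \<in> diagram \<pi> \<and> p (tableau \<pi> (i, j)) = tableau \<pi> (i, j'))}"

definition column_group :: "nat list \<Rightarrow> (nat \<Rightarrow> nat) set" where
  "column_group \<pi> = {p. p permutes {1..sum_list \<pi>} \<and>
     (\<forall>(i, j) \<in> diagram \<pi>. \<exists>i'. (i', j) \<in> diagram \<pi> \<and> p (tableau \<pi> (i, j)) = tableau \<pi> (i', j))}"

definition young_symmetrizer :: "nat list \<Rightarrow> (nat \<Rightarrow> nat) \<Rightarrow> rat" where
  "young_symmetrizer \<pi> =
     (\<lambda>p. if p \<in> row_group \<pi> then 1 else 0)
       \<otimes>\<^bsub>sym_algebra (sum_list \<pi>)\<^esub>
     (\<lambda>p. if p \<in> column_group \<pi> then of_int (sign p) else 0)"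

definition principal_right_ideal :: "('a, 'b) ring_scheme \<Rightarrow> 'a \<Rightarrow> 'a set" where
  "principal_right_ideal R a = a <#\<^bsub>R\<^esub> carrier R"

text \<open>
  The irreducible right module \<open>V\<^sub>\<pi>\<close>; one-row partitions give the trivial representation and
  one-column partitions the sign representation.
\<close>

definition specht :: "nat list \<Rightarrow> ((nat \<Rightarrow> nat) \<Rightarrow> rat) set" where
  "specht \<pi> = principal_right_ideal (sym_algebra (sum_list \<pi>)) (young_symmetrizer \<pi>)"

definition isomorphic_right_modules :: "('a, 'b) ring_scheme \<Rightarrow> 'a set \<Rightarrow> 'a set \<Rightarrow> bool" where
  "isomorphic_right_modules R M N \<longleftrightarrow> (\<exists>\<phi>. bij_betw \<phi> M N \<and>
     (\<forall>x \<in> M. \<forall>y \<in> M. \<phi> (x \<oplus>\<^bsub>R\<^esub> y) = \<phi> x \<oplus>\<^bsub>R\<^esub> \<phi> y) \<and>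
     (\<forall>x \<in> M. \<forall>a \<in> carrier R. \<phi> (x \<otimes>\<^bsub>R\<^esub> a) = \<phi> x \<otimes>\<^bsub>R\<^esub> a))"

text \<open>\<open>e\<close> is an admissible choice of \<open>e\<^sub>\<pi>\<close>: an idempotent with \<open>V\<^sub>\<pi> \<cong> e \<rat>\<Sigma>\<^sub>n\<close>.\<close>

definition schur_idempotent :: "nat list \<Rightarrow> ((nat \<Rightarrow> nat) \<Rightarrow> rat) \<Rightarrow> bool" where
  "schur_idempotent \<pi> e \<longleftrightarrow>
     e \<in> carrier (sym_algebra (sum_list \<pi>)) \<and>
     e \<otimes>\<^bsub>sym_algebra (sum_list \<pi>)\<^esub> e = e \<and>
     isomorphic_right_modules (sym_algebra (sum_list \<pi>))
       (principal_right_ideal (sym_algebra (sum_list \<pi>)) e) (specht \<pi>)"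

text \<open>
  \<open>S\<close> is \<open>S\<^sub>\<pi>(X)\<close>, formed with the idempotent \<open>e\<close>.  Images are determined up to isomorphism only,
  so this is a relation.
\<close>

definition schur_object ::
    "('o, 'm, 'z) tensor_cat_scheme \<Rightarrow> nat list \<Rightarrow> ((nat \<Rightarrow> nat) \<Rightarrow> rat) \<Rightarrow> 'o \<Rightarrow> 'o \<Rightarrow> bool" where
  "schur_object C \<pi> e X S \<longleftrightarrow>
     (\<exists>i. is_image C (algebra_action C X (sum_list \<pi>) e) i \<and> Dom C i = S)"

end

theory Submission
  imports Defs
begin

text \<open>
  Filter \<open>Y\<^sup>\<otimes>\<^sup>n\<close> by the kernels of the \<open>\<Sigma>\<^sub>n\<close>-equivariant maps \<open>\<phi>\<^sub>k\<close> that send \<open>k\<close> of the \<open>n\<close> factors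
  to \<open>Z\<close>, in all possible ways.  Biexactness identifies the graded pieces, equivariantly, with the sum
  of all products of \<open>k\<close> factors \<open>Z\<close> and \<open>n - k\<close> factors \<open>X\<close>, which does not depend on the extension.
  Cutting with the idempotent \<open>e\<close> is exact, so \<open>cl (S\<^sub>\<pi> Y)\<close> is the sum of the classes of the
  \<open>e\<close>-parts of these graded pieces, and so is \<open>cl (S\<^sub>\<pi> (X \<oplus> Z))\<close>.

  To have a symmetric group action at hand on every object that occurs, \<open>\<phi>\<^sub>k\<close> takes its values in
  \<open>(Y \<oplus> Z)\<^sup>\<otimes>\<^sup>n\<close>, and the graded pieces are direct summands of \<open>(X \<oplus> Z)\<^sup>\<otimes>\<^sup>n\<close>; the latter
  embeds into the former, and it is a quotient of \<open>(X \<oplus> Y)\<^sup>\<otimes>\<^sup>n\<close>, which maps to \<open>Y\<^sup>\<otimes>\<^sup>n\<close>.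
\<close>

section \<open>Words in adjacent transpositions\<close>

text \<open>The class of \<open>S\<^sub>\<pi>\<close> is pinned down by the graded pieces alone
  because the filtration has known ends. The map for \<open>k = 0\<close> is the tensor power of a
  monomorphism, so the bottom step vanishes; for \<open>k = n + 1\<close> there are no positions to
  choose, the map is zero and the top step is everything. The pieces \<open>E k\<close> are cut out
  of the tensor power of the direct sum, so they can be fixed in advance and handed to the
  filtration theorem, which is then applied to the given sequence and to the split one. Two
  obstacles shape the rest. The action of a permutation is a definite description over composites of
  adjacent swaps, so nothing can be said about it before coherence is established: that the Coxeter
  relations suffice to compare words, and that swaps satisfy them, the braid relation coming from
  hexagon and pentagon. Secondly, biexactness speaks of one factor at a time, whereas a graded piece
  has \<open>X\<close> in all positions outside a set \<open>S\<close>; hence the positions have to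
  be cut down from \<open>Y\<close> to \<open>X\<close> one by one.\<close>

definition perm_monoid :: "('a \<Rightarrow> 'a) monoid" where
  "perm_monoid = \<lparr>carrier = UNIV, monoid.mult = (\<circ>), one = id\<rparr>"

text \<open>Evaluation in an arbitrary monoid, so that one word can be read both as a permutation
  and as a composite of swaps, and the two readings can be compared.\<close>

definition word_value :: "('a, 'b) monoid_scheme \<Rightarrow> (nat \<Rightarrow> 'a) \<Rightarrow> nat list \<Rightarrow> 'a" where
  "word_value G s w = foldr (\<lambda>i x. s i \<otimes>\<^bsub>G\<^esub> x) w \<one>\<^bsub>G\<^esub>"

abbreviation adjacent :: "nat \<Rightarrow> nat \<Rightarrow> nat" where
  "adjacent i \<equiv> transpose i (Suc i)"

abbreviation word_perm :: "nat list \<Rightarrow> nat \<Rightarrow> nat" where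
  "word_perm \<equiv> word_value perm_monoid adjacent"

lemma word_value_Nil [simp]: "word_value G s [] = \<one>\<^bsub>G\<^esub>"
  and word_value_Cons [simp]: "word_value G s (i # w) = s i \<otimes>\<^bsub>G\<^esub> word_value G s w"
  by (simp_all add: word_value_def)

lemma perm_monoid_simps [simp]:
  "carrier perm_monoid = UNIV" "f \<otimes>\<^bsub>perm_monoid\<^esub> g = f \<circ> g" "\<one>\<^bsub>perm_monoid\<^esub> = id"
  by (simp_all add: perm_monoid_def)

text \<open>The Coxeter presentation of \<open>\<Sigma>\<^sub>n\<close>, with \<open>s i\<close> in
  the role of the exchange of \<open>i\<close> and \<open>i + 1\<close>. A monoid is enough, since
  \<open>s_square\<close> makes each generator invertible; endomorphisms of an object can thus serve
  as \<open>G\<close>.\<close>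

locale coxeter_generators = monoid G for G (structure) +
  fixes s :: "nat \<Rightarrow> 'a" and n :: nat
  assumes s_closed: "i \<in> {1..<n} \<Longrightarrow> s i \<in> carrier G"
    and s_square: "i \<in> {1..<n} \<Longrightarrow> s i \<otimes> s i = \<one>"
    and s_far: "\<lbrakk>i \<in> {1..<n}; j \<in> {1..<n}; Suc i < j\<rbrakk> \<Longrightarrow> s i \<otimes> s j = s j \<otimes> s i"
    and s_braid: "\<lbrakk>i \<in> {1..<n}; Suc i \<in> {1..<n}\<rbrakk>
      \<Longrightarrow> s i \<otimes> (s (Suc i) \<otimes> s i) = s (Suc i) \<otimes> (s i \<otimes> s (Suc i))"

lemma coxeter_generators_perm: "coxeter_generators perm_monoid adjacent n"
proof -
  interpret monoid "perm_monoid :: (nat \<Rightarrow> nat) monoid"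
    by unfold_locales (auto simp: comp_assoc)
  show ?thesis
    by unfold_locales (auto simp: fun_eq_iff transpose_def)
qed

text \<open>Normalising a word in the product with \<open>perm_monoid\<close> yields one normal form
  that is valid for the value in \<open>G\<close> and for the permutation at the same time.\<close>

lemma coxeter_generators_DirProd:
  assumes "coxeter_generators G s n" "coxeter_generators H t n"
  shows "coxeter_generators (G \<times>\<times> H) (\<lambda>i. (s i, t i)) n"
proof -
  interpret G: coxeter_generators G s n by fact
  interpret H: coxeter_generators H t n by fact
  interpret monoid "G \<times>\<times> H" by (rule DirProd_monoid[OF G.monoid_axioms H.monoid_axioms])
  show ?thesis
  proof
    fix i j assume "i \<in> {1..<n}" "j \<in> {1..<n}" "Suc i < j"
    then show "(s i, t i) \<otimes>\<^bsub>G \<times>\<times> H\<^esub> (s j, t j) = (s j, t j) \<otimes>\<^bsub>G \<times>\<times> H\<^esub> (s i, t i)"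
      using G.s_far[of i j] H.s_far[of i j] by simp
  qed (auto simp: G.s_closed H.s_closed G.s_square H.s_square G.s_braid H.s_braid)
qed

lemma word_value_DirProd:
  "word_value (G \<times>\<times> H) (\<lambda>i. (s i, t i)) w = (word_value G s w, word_value H t w)"
  by (induction w) auto

context coxeter_generators
begin

abbreviation val :: "nat list \<Rightarrow> 'a" where
  "val \<equiv> word_value G s"

lemma val_closed: "w \<in> lists {1..<n} \<Longrightarrow> val w \<in> carrier G"
  by (induction w) (auto simp: s_closed)

lemma val_append:
  "\<lbrakk>u \<in> lists {1..<n}; w \<in> lists {1..<n}\<rbrakk> \<Longrightarrow> val (u @ w) = val u \<otimes> val w"
proof (induction u)
  case Nil
  then show ?case by (simp add: val_closed del: in_lists_conv_set)
next
  case (Cons a u)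
  then show ?case using val_closed[of u] val_closed[of w] s_closed[of a] by (auto simp: m_assoc)
qed

lemma val_commute_far:
  "\<lbrakk>i \<in> {1..<n}; w \<in> lists {1..<n}; \<forall>j\<in>set w. Suc i < j \<or> Suc j < i\<rbrakk> \<Longrightarrow> val (i # w) = val (w @ [i])"
proof (induction w)
  case Nil
  then show ?case by simp
next
  case (Cons j w)
  then have w: "w \<in> lists {1..<n}" and j: "j \<in> {1..<n}" by auto
  have "s i \<otimes> s j = s j \<otimes> s i"
    using s_far[of i j] s_far[of j i] Cons.prems by auto
  then have "val (i # j # w) = s j \<otimes> val (i # w)"
    using val_closed[OF w] s_closed[OF j] s_closed[OF Cons.prems(1)]
    by (simp add: m_assoc[symmetric])
  also have "\<dots> = s j \<otimes> val (w @ [i])"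
    using Cons w by auto
  finally show ?case by simp
qed

text \<open>The words \<open>[k..<Suc m]\<close> are coset representatives of \<open>\<Sigma>\<^sub>m\<close> in \<open>\<Sigma>\<^sub>m\<^sub>+\<^sub>1\<close>.\<close>

lemma val_Cons_coset:
  assumes "Suc m \<le> n" "i \<in> {1..<Suc m}" "k \<in> {1..Suc m}"
  shows "\<exists>k'\<in>{1..Suc m}. \<exists>w\<in>lists {1..<m}. val (i # [k..<Suc m]) = val ([k'..<Suc m] @ w)"
proof -
  \<comment> \<open>The place of \<open>i\<close> relative to the start of the run decides: well
    below \<open>k\<close> it commutes past the run, just below \<open>k\<close> it prolongs the
    run, equal to \<open>k\<close> it cancels, and further inside the run the braid relation is
    needed.\<close>
  consider "Suc i < k" | "k = Suc i" | "k = i" | "k < i" by linarith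
  then show ?thesis
  proof cases
    case 1
    have "val (i # [k..<Suc m]) = val ([k..<Suc m] @ [i])"
      by (rule val_commute_far) (use assms 1 in \<open>auto simp del: upt_Suc\<close>)
    moreover have "[i] \<in> lists {1..<m}" using assms 1 by auto
    ultimately show ?thesis using assms(3) by blast
  next
    case 2
    then have "i # [k..<Suc m] = [i..<Suc m] @ []" using assms by (simp add: upt_conv_Cons del: upt_Suc)
    then show ?thesis using assms by (metis atLeastAtMost_iff atLeastLessThan_iff le_eq_less_or_eq lists.Nil)
  next
    case 3
    then have *: "[k..<Suc m] = i # [Suc i..<Suc m]" using assms by (simp add: upt_conv_Cons del: upt_Suc)
    have "val [Suc i..<Suc m] \<in> carrier G"
      by (rule val_closed) (use assms in \<open>auto simp del: upt_Suc\<close>)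
    then have "val (i # [k..<Suc m]) = val ([Suc i..<Suc m] @ [])"
      unfolding * using s_square[of i] s_closed[of i] assms by (simp add: m_assoc[symmetric] del: upt_Suc)
    then show ?thesis using assms by (metis atLeastAtMost_iff atLeastLessThan_iff le_SucI lists.Nil less_eq_Suc_le Suc_le_eq zero_less_Suc One_nat_def)
  next
    case 4
    \<comment> \<open>The run reads \<open>a, j, i, b\<close>. Moving \<open>i\<close> past
      \<open>a\<close>, replacing \<open>i, j, i\<close> by \<open>j, i, j\<close> and moving the
      last \<open>j\<close> past \<open>b\<close> restores the run, with \<open>j\<close> on its
      right.\<close>
    then obtain j where j: "i = Suc j" by (cases i) auto
    define a b where "a = [k..<j]" and "b = [Suc i..<Suc m]"
    have split: "[k..<Suc m] = a @ [j, i] @ b"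
    proof -
      have "[k..<Suc m] = a @ [j..<Suc m]"
        unfolding a_def using assms 4 j upt_add_eq_append[of k j "Suc m - j"] by (simp del: upt_Suc)
      then show ?thesis
        unfolding b_def using assms j by (simp add: upt_conv_Cons del: upt_Suc)
    qed
    have a: "a \<in> lists {1..<n}" and b: "b \<in> lists {1..<n}" and ij: "i \<in> {1..<n}" "j \<in> {1..<n}"
      unfolding a_def b_def using assms 4 j by (auto simp del: upt_Suc)
    have "val (i # [k..<Suc m]) = val ((i # a) @ [j, i] @ b)" by (simp only: split append_Cons)
    also have "\<dots> = val (i # a) \<otimes> val ([j, i] @ b)"
      using a b ij by (intro val_append) auto
    also have "val (i # a) = val (a @ [i])"
      by (rule val_commute_far) (use a ij j in \<open>auto simp: a_def\<close>)
    also have "\<dots> = val a \<otimes> s i"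
      using a ij val_append[of a "[i]"] s_closed by auto
    also have "val a \<otimes> s i \<otimes> val ([j, i] @ b) = val a \<otimes> (s i \<otimes> (s j \<otimes> s i) \<otimes> val b)"
      using val_closed[OF a] val_closed[OF b] ij s_closed by (simp add: m_assoc)
    also have "s i \<otimes> (s j \<otimes> s i) = s j \<otimes> (s i \<otimes> s j)"
      using s_braid[of j] ij j by simp
    also have "val a \<otimes> (s j \<otimes> (s i \<otimes> s j) \<otimes> val b) = val a \<otimes> val ([j, i]) \<otimes> val (j # b)"
      using val_closed[OF a] val_closed[OF b] ij s_closed by (simp add: m_assoc)
    also have "val (j # b) = val (b @ [j])"
      by (rule val_commute_far) (use b ij j in \<open>auto simp: b_def simp del: upt_Suc\<close>)
    also have "val a \<otimes> val [j, i] \<otimes> val (b @ [j]) = val (a @ [j, i] @ (b @ [j]))"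
    proof -
      have "[j, i] \<in> lists {1..<n}" "b @ [j] \<in> lists {1..<n}" using ij b by auto
      moreover have "[j, i] @ (b @ [j]) \<in> lists {1..<n}" using ij b by auto
      ultimately show ?thesis
        using a val_append val_closed by (metis m_assoc)
    qed
    also have "a @ [j, i] @ (b @ [j]) = [k..<Suc m] @ [j]" using split by simp
    finally show ?thesis
      using assms j 4 by (intro bexI[of _ k] bexI[of _ "[j]"]) auto
  qed
qed

text \<open>A new first letter only meets the run at the head of the normalised tail, and what it
  pushes out to the right lies in the smaller alphabet. This is the coset decomposition of
  \<open>\<Sigma>\<^sub>m\<^sub>+\<^sub>1\<close> modulo \<open>\<Sigma>\<^sub>m\<close> at the
  level of words.\<close>

lemma val_normal_form:
  assumes "Suc m \<le> n" "w \<in> lists {1..<Suc m}"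
  shows "\<exists>k\<in>{1..Suc m}. \<exists>w'\<in>lists {1..<m}. val w = val ([k..<Suc m] @ w')"
  using assms(2)
proof (induction w)
  case Nil
  then show ?case by (intro bexI[of _ "Suc m"] bexI[of _ "[]"]) auto
next
  case (Cons i w)
  then obtain k w' where k: "k \<in> {1..Suc m}" and w': "w' \<in> lists {1..<m}"
    and eq: "val w = val ([k..<Suc m] @ w')"
    by blast
  obtain k' u where k': "k' \<in> {1..Suc m}" and u: "u \<in> lists {1..<m}"
    and eq': "val (i # [k..<Suc m]) = val ([k'..<Suc m] @ u)"
    using val_Cons_coset[OF assms(1) _ k, of i] Cons.hyps by blast
  have sub: "x \<in> lists {1..<n}" if "x \<in> lists {1..<m}" for x using that assms(1) by fastforce
  have up: "[l..<Suc m] \<in> lists {1..<n}" if "l \<in> {1..Suc m}" for l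
    using that assms(1) by (auto simp del: upt_Suc)
  have i: "[i] \<in> lists {1..<n}" using Cons.hyps assms(1) by auto
  have "val (i # w) = val (i # [k..<Suc m] @ w')" using eq by simp
  also have "\<dots> = val (i # [k..<Suc m]) \<otimes> val w'"
    using val_append[of "i # [k..<Suc m]" w'] up[OF k] sub[OF w'] i by auto
  also have "\<dots> = val (([k'..<Suc m] @ u) @ w')"
    unfolding eq' by (rule val_append[symmetric]) (use up[OF k'] sub[OF u] sub[OF w'] in auto)
  finally have "val (i # w) = val ([k'..<Suc m] @ u @ w')" by simp
  moreover have "u @ w' \<in> lists {1..<m}" using u w' by auto
  ultimately show ?case using k' by blast
qed

end

section \<open>Permutations given by words, and completeness of the Coxeter relations\<close>

lemma word_perm_append: "word_perm (u @ w) = word_perm u \<circ> word_perm w"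
  by (induction u) auto

lemma word_perm_permutes: "w \<in> lists {1..<n} \<Longrightarrow> word_perm w permutes {1..n}"
proof (induction w)
  case Nil
  then show ?case by (simp add: permutes_id id_def[symmetric])
next
  case (Cons i w)
  have "adjacent i permutes {1..n}" using Cons.prems by (intro permutes_swap_id) auto
  then show ?case using Cons by (auto intro: permutes_compose simp del: o_apply)
qed

text \<open>The rightmost letter acts first and takes \<open>m\<close> to \<open>m - 1\<close>, the
  next one goes on downwards, until \<open>k\<close> is reached. So the permutation determines the
  run in a normal form.\<close>

lemma word_perm_upt: "k \<le> m \<Longrightarrow> word_perm [k..<m] m = k"
proof (induction "m - k" arbitrary: k)
  case (Suc x)
  then have "[k..<m] = k # [Suc k..<m]" "word_perm [Suc k..<m] m = Suc k" by (auto simp: upt_conv_Cons)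
  then show ?case by simp
qed simp

text \<open>Equal permutations send the top point to the same \<open>k\<close>, so the normal forms
  start with the same run. Cancelling it leaves words in a smaller alphabet that again give equal
  permutations, and induction on the alphabet applies.\<close>

theorem word_value_eqI:
  assumes "coxeter_generators G s n" "w \<in> lists {1..<n}" "w' \<in> lists {1..<n}"
    and "word_perm w = word_perm w'"
  shows "word_value G s w = word_value G s w'"
proof -
  interpret coxeter_generators G s n by fact
  interpret P: coxeter_generators "G \<times>\<times> perm_monoid" "\<lambda>i. (s i, adjacent i)" n
    by (rule coxeter_generators_DirProd[OF assms(1) coxeter_generators_perm])
  have "val u = val u'"
    if "m \<le> n" "u \<in> lists {1..<m}" "u' \<in> lists {1..<m}" "word_perm u = word_perm u'" for m u u'
    using that
  proof (induction m arbitrary: u u')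
    case 0
    then show ?case by simp
  next
    case (Suc m)
    obtain k v where k: "k \<in> {1..Suc m}" and v: "v \<in> lists {1..<m}"
      and u: "val u = val ([k..<Suc m] @ v)" "word_perm u = word_perm ([k..<Suc m] @ v)"
      using P.val_normal_form[OF Suc.prems(1,2)] by (metis word_value_DirProd prod.inject)
    obtain k' v' where k': "k' \<in> {1..Suc m}" and v': "v' \<in> lists {1..<m}"
      and u': "val u' = val ([k'..<Suc m] @ v')" "word_perm u' = word_perm ([k'..<Suc m] @ v')"
      using P.val_normal_form[OF Suc.prems(1,3)] by (metis word_value_DirProd prod.inject)
    \<comment> \<open>Letters below \<open>m\<close> move only points up to \<open>m\<close>, so the
      image of \<open>Suc m\<close> is decided by the run alone.\<close>
    have "word_perm v (Suc m) = Suc m" "word_perm v' (Suc m) = Suc m"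
      using word_perm_permutes[OF v] word_perm_permutes[OF v'] by (auto intro: permutes_not_in)
    then have "word_perm u (Suc m) = k" "word_perm u' (Suc m) = k'"
      using u(2) u'(2) k k' word_perm_upt[of _ "Suc m"] by (auto simp: word_perm_append simp del: upt_Suc)
    then have kk: "k' = k" using Suc.prems(4) by simp
    have "[k..<Suc m] \<in> lists {1..<Suc m}" using k by (auto simp del: upt_Suc)
    then have "inj (word_perm [k..<Suc m])"
      by (rule permutes_inj[OF word_perm_permutes])
    then have "word_perm v = word_perm v'"
      using Suc.prems(4) u(2) u'(2) kk by (auto simp: word_perm_append fun_eq_iff inj_eq simp del: upt_Suc)
    then have vv: "val v = val v'" using Suc.IH[OF _ v v'] Suc.prems(1) by simp
    have sub: "x \<in> lists {1..<n}" if "x \<in> lists {1..<m}" for x using that Suc.prems(1) by fastforce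
    have up: "[k..<Suc m] \<in> lists {1..<n}"
      using k Suc.prems(1) by (auto simp del: upt_Suc)
    show ?case
      using u(1) u'(1) kk vv val_append[OF up] sub[OF v] sub[OF v'] by metis
  qed
  then show ?thesis using assms(2-4) by blast
qed

text \<open>Undoing the run that starts at \<open>p (Suc m)\<close> turns \<open>p\<close> into a
  permutation fixing the last point, which lowers the degree.\<close>

theorem ex_word_perm:
  "p permutes {1..n} \<Longrightarrow> \<exists>w\<in>lists {1..<n}. word_perm w = p"
proof (induction n arbitrary: p)
  case 0
  then show ?case by (intro bexI[of _ "[]"]) auto
next
  case (Suc m)
  define k where "k = p (Suc m)"
  have k: "k \<in> {1..Suc m}" using Suc.prems permutes_in_image[OF Suc.prems, of "Suc m"] by (simp add: k_def)
  define c where "c = word_perm [k..<Suc m]"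
  have up: "[k..<Suc m] \<in> lists {1..<Suc m}" using k by (auto simp del: upt_Suc)
  then have c: "c permutes {1..Suc m}" unfolding c_def by (rule word_perm_permutes)
  define q where "q = inv_into UNIV c \<circ> p"
  have "c (Suc m) = k" unfolding c_def using k by (intro word_perm_upt) simp
  then have q_Suc: "q (Suc m) = Suc m"
    unfolding q_def k_def by (metis c comp_apply permutes_inverses(2))
  have "q permutes {1..Suc m}"
    unfolding q_def by (rule permutes_compose[OF Suc.prems permutes_inv[OF c]])
  then have "q permutes {1..m}"
    by (rule permutes_superset) (use q_Suc in \<open>auto simp: le_Suc_eq\<close>)
  then obtain w where w: "w \<in> lists {1..<m}" "word_perm w = q" using Suc.IH by blast
  have "word_perm ([k..<Suc m] @ w) = p"
    unfolding word_perm_append w(2) c_def[symmetric] q_def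
    by (simp add: fun_eq_iff permutes_inverses(1)[OF c])
  moreover have "w \<in> lists {1..<Suc m}" using w(1) lists_mono[of "{1..<m}" "{1..<Suc m}"] by auto
  then have "[k..<Suc m] @ w \<in> lists {1..<Suc m}" using up by (simp del: upt_Suc)
  ultimately show ?case by blast
qed

section \<open>Linear and abelian categories\<close>

context category
begin

lemma in_Hom [simp]: "f \<in> Hom C X Y \<longleftrightarrow> f \<in> Arr C \<and> Dom C f = X \<and> Cod C f = Y"
  by (simp add: Hom_def)

lemma Dom_Cod_Ob [simp]: "f \<in> Arr C \<Longrightarrow> Dom C f \<in> Ob C" "f \<in> Arr C \<Longrightarrow> Cod C f \<in> Ob C"
  by (rule Dom_in_Ob Cod_in_Ob, assumption)+

lemma Hom_Ob: "f \<in> Hom C X Y \<Longrightarrow> X \<in> Ob C" "f \<in> Hom C X Y \<Longrightarrow> Y \<in> Ob C"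
  by auto

lemma Ident_simps [simp]:
  "X \<in> Ob C \<Longrightarrow> Ident C X \<in> Arr C" "X \<in> Ob C \<Longrightarrow> Dom C (Ident C X) = X"
  "X \<in> Ob C \<Longrightarrow> Cod C (Ident C X) = X"
  using Ident_in_Hom[of X] by auto

lemma Comp_simps [simp]:
  assumes "f \<in> Arr C" "g \<in> Arr C" "Cod C f = Dom C g"
  shows "g \<cdot> f \<in> Arr C" "Dom C (g \<cdot> f) = Dom C f" "Cod C (g \<cdot> f) = Cod C g"
  using Comp_in_Hom[of f "Dom C f" "Cod C f" g "Cod C g"] assms by auto

lemma Comp_Ident [simp]:
  "\<lbrakk>f \<in> Arr C; Cod C f = Y\<rbrakk> \<Longrightarrow> Ident C Y \<cdot> f = f"
  "\<lbrakk>f \<in> Arr C; Dom C f = X\<rbrakk> \<Longrightarrow> f \<cdot> Ident C X = f"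
  using Ident_left[of f "Dom C f" Y] Ident_right[of f X "Cod C f"] by auto

lemma Comp_assoc' [simp]:
  "\<lbrakk>f \<in> Arr C; g \<in> Arr C; h \<in> Arr C; Cod C f = Dom C g; Cod C g = Dom C h\<rbrakk>
    \<Longrightarrow> (h \<cdot> g) \<cdot> f = h \<cdot> g \<cdot> f"
  using Comp_assoc[of f "Dom C f" "Dom C g" g "Dom C h" h "Cod C h"] by simp

text \<open>Composites are kept nested to the right by \<open>Comp_assoc'\<close>, so an equation
  for \<open>h \<cdot> g\<close> does not match inside a longer composite. This is the form in which
  such equations are applied throughout.\<close>

lemma Comp_reassoc:
  "\<lbrakk>h \<cdot> g = k; f \<in> Arr C; g \<in> Arr C; h \<in> Arr C; Cod C f = Dom C g; Cod C g = Dom C h\<rbrakk>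
    \<Longrightarrow> h \<cdot> g \<cdot> f = k \<cdot> f"
  by (metis Comp_assoc')

lemma inverse_arrow:
  assumes "iso_arrow C f"
  shows "inverse_arrows C f (inverse_arrow C f)"
proof -
  have "g = h" if "inverse_arrows C f g" "inverse_arrows C f h" for g h
  proof -
    have "(g \<cdot> f) \<cdot> h = g \<cdot> f \<cdot> h" "(g \<cdot> f) \<cdot> h = h" "g \<cdot> (f \<cdot> h) = g"
      using that Comp_assoc'[of h f g] unfolding inverse_arrows_def
      by (simp_all del: Comp_assoc')
    then show ?thesis by simp
  qed
  then show ?thesis
    using assms unfolding iso_arrow_def inverse_arrow_def by (metis (mono_tags, lifting) theI)
qed

lemma iso_simps [simp]:
  assumes "iso_arrow C f"
  shows "f \<in> Arr C" "inverse_arrow C f \<in> Arr C"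
    "Dom C (inverse_arrow C f) = Cod C f" "Cod C (inverse_arrow C f) = Dom C f"
    "inverse_arrow C f \<cdot> f = Ident C (Dom C f)" "f \<cdot> inverse_arrow C f = Ident C (Cod C f)"
  using inverse_arrow[OF assms] unfolding inverse_arrows_def in_Hom by blast+

lemma iso_cancel [simp]:
  assumes "iso_arrow C f"
  shows "\<lbrakk>g \<in> Arr C; Cod C g = Dom C f\<rbrakk> \<Longrightarrow> inverse_arrow C f \<cdot> f \<cdot> g = g"
    and "\<lbrakk>g \<in> Arr C; Cod C g = Cod C f\<rbrakk> \<Longrightarrow> f \<cdot> inverse_arrow C f \<cdot> g = g"
  by (simp_all add: Comp_reassoc[OF iso_simps(5)[OF assms]] Comp_reassoc[OF iso_simps(6)[OF assms]] assms)

lemma iso_mono: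
  "\<lbrakk>iso_arrow C f; f \<cdot> g = f \<cdot> h; g \<in> Arr C; h \<in> Arr C; Cod C g = Dom C f; Cod C h = Dom C f\<rbrakk> \<Longrightarrow> g = h"
  by (metis iso_cancel(1))

lemma iso_arrow_Comp:
  assumes "iso_arrow C f" "iso_arrow C g" "Cod C f = Dom C g"
  shows "iso_arrow C (g \<cdot> f)"
  unfolding iso_arrow_def
proof
  show "inverse_arrows C (g \<cdot> f) (inverse_arrow C f \<cdot> inverse_arrow C g)"
    using assms by (auto simp: inverse_arrows_def)
qed

lemma mono_arrowD:
  "\<lbrakk>mono_arrow C f; f \<cdot> g = f \<cdot> h; g \<in> Arr C; h \<in> Arr C; Cod C g = Dom C f; Cod C h = Dom C f;
    Dom C g = Dom C h\<rbrakk> \<Longrightarrow> g = h"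
  by (auto simp: mono_arrow_def)

lemma epi_arrowD:
  "\<lbrakk>epi_arrow C f; g \<cdot> f = h \<cdot> f; g \<in> Arr C; h \<in> Arr C; Dom C g = Cod C f; Dom C h = Cod C f;
    Cod C g = Cod C h\<rbrakk> \<Longrightarrow> g = h"
  by (auto simp: epi_arrow_def)

lemma mono_arrow_Comp:
  assumes "mono_arrow C f" "mono_arrow C g" "Cod C f = Dom C g"
  shows "mono_arrow C (g \<cdot> f)"
proof -
  have fg: "f \<in> Arr C" "g \<in> Arr C" using assms by (auto simp: mono_arrow_def)
  show ?thesis
    unfolding mono_arrow_def
  proof (intro conjI allI ballI impI)
    fix W x y assume "x \<in> Hom C W (Dom C (g \<cdot> f))" "y \<in> Hom C W (Dom C (g \<cdot> f))" "(g \<cdot> f) \<cdot> x = (g \<cdot> f) \<cdot> y"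
    then show "x = y"
      using fg assms(3) mono_arrowD[OF assms(1), of x y] mono_arrowD[OF assms(2), of "f \<cdot> x" "f \<cdot> y"] by auto
  qed (use fg assms in simp)
qed

lemma epi_arrow_Comp:
  assumes "epi_arrow C f" "epi_arrow C g" "Cod C f = Dom C g"
  shows "epi_arrow C (g \<cdot> f)"
proof -
  have fg: "f \<in> Arr C" "g \<in> Arr C" using assms by (auto simp: epi_arrow_def)
  show ?thesis
    unfolding epi_arrow_def
  proof (intro conjI allI ballI impI)
    fix W x y assume xy: "x \<in> Hom C (Cod C (g \<cdot> f)) W" "y \<in> Hom C (Cod C (g \<cdot> f)) W"
      and eq: "x \<cdot> (g \<cdot> f) = y \<cdot> (g \<cdot> f)"
    have "(x \<cdot> g) \<cdot> f = (y \<cdot> g) \<cdot> f" using xy eq fg assms(3) by auto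
    then show "x = y"
      using xy fg assms(3) epi_arrowD[OF assms(1), of "x \<cdot> g" "y \<cdot> g"] epi_arrowD[OF assms(2), of x y]
      by auto
  qed (use fg assms in simp)
qed

lemma epi_arrow_of_Comp:
  assumes "epi_arrow C (g \<cdot> f)" "f \<in> Arr C" "g \<in> Arr C" "Cod C f = Dom C g"
  shows "epi_arrow C g"
  unfolding epi_arrow_def
proof (intro conjI allI ballI impI)
  fix W x y assume xy: "x \<in> Hom C (Cod C g) W" "y \<in> Hom C (Cod C g) W" and eq: "x \<cdot> g = y \<cdot> g"
  have "x \<cdot> (g \<cdot> f) = (x \<cdot> g) \<cdot> f" "y \<cdot> (g \<cdot> f) = (y \<cdot> g) \<cdot> f" using xy assms by auto
  then have "x \<cdot> (g \<cdot> f) = y \<cdot> (g \<cdot> f)" using eq by metis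
  then show "x = y" using xy assms epi_arrowD[OF assms(1), of x y] by auto
qed (use assms in simp)

lemma epi_arrow_Ident: "X \<in> Ob C \<Longrightarrow> epi_arrow C (Ident C X)"
  by (auto simp: epi_arrow_def)

lemma mono_arrow_Ident: "X \<in> Ob C \<Longrightarrow> mono_arrow C (Ident C X)"
  by (auto simp: mono_arrow_def)

lemma split_epi_arrow:
  "\<lbrakk>r \<cdot> j = Ident C (Cod C r); j \<in> Arr C; r \<in> Arr C; Cod C j = Dom C r\<rbrakk> \<Longrightarrow> epi_arrow C r"
  by (rule epi_arrow_of_Comp[of r j]) (auto simp: epi_arrow_Ident)

lemma split_mono_arrow:
  assumes "r \<cdot> j = Ident C (Dom C j)" "j \<in> Arr C" "r \<in> Arr C" "Cod C j = Dom C r"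
  shows "mono_arrow C j"
  unfolding mono_arrow_def
proof (intro conjI allI ballI impI)
  fix W x y assume xy: "x \<in> Hom C W (Dom C j)" "y \<in> Hom C W (Dom C j)" "j \<cdot> x = j \<cdot> y"
  have "r \<cdot> j \<cdot> x = x" "r \<cdot> j \<cdot> y = y"
    using Comp_reassoc[OF assms(1)] xy(1,2) assms(2-4) by auto
  then show "x = y" using xy(3) by metis
qed (rule assms)

end

context linear_category
begin

lemma hom_group_simps [simp]:
  "carrier (hom_group C X Y) = Hom C X Y" "f \<otimes>\<^bsub>hom_group C X Y\<^esub> g = f \<boxplus> g"
  "\<one>\<^bsub>hom_group C X Y\<^esub> = Zero C X Y"
  by (simp_all add: hom_group_def)

lemma Zero_simps [simp]:
  assumes "X \<in> Ob C" "Y \<in> Ob C"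
  shows "Zero C X Y \<in> Arr C" "Dom C (Zero C X Y) = X" "Cod C (Zero C X Y) = Y"
proof -
  interpret comm_group "hom_group C X Y" by (rule hom_comm_group[OF assms])
  show "Zero C X Y \<in> Arr C" "Dom C (Zero C X Y) = X" "Cod C (Zero C X Y) = Y"
    using one_closed by auto
qed

lemma Add_simps [simp]:
  assumes "f \<in> Arr C" "g \<in> Arr C" "Dom C f = Dom C g" "Cod C f = Cod C g"
  shows "f \<boxplus> g \<in> Arr C" "Dom C (f \<boxplus> g) = Dom C g" "Cod C (f \<boxplus> g) = Cod C g"
proof -
  interpret comm_group "hom_group C (Dom C f) (Cod C f)" by (rule hom_comm_group) (use assms in auto)
  show "f \<boxplus> g \<in> Arr C" "Dom C (f \<boxplus> g) = Dom C g" "Cod C (f \<boxplus> g) = Cod C g"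
    using m_closed[of f g] assms by auto
qed

lemma Scal_simps [simp]:
  "f \<in> Arr C \<Longrightarrow> Scal C a f \<in> Arr C" "f \<in> Arr C \<Longrightarrow> Dom C (Scal C a f) = Dom C f"
  "f \<in> Arr C \<Longrightarrow> Cod C (Scal C a f) = Cod C f"
  using Scal_in_Hom[of f "Dom C f" "Cod C f" a] by auto

lemma Add_Zero [simp]:
  assumes "f \<in> Arr C" "Dom C f = X" "Cod C f = Y"
  shows "f \<boxplus> Zero C X Y = f" "Zero C X Y \<boxplus> f = f"
proof -
  interpret comm_group "hom_group C X Y" by (rule hom_comm_group) (use assms in auto)
  show "f \<boxplus> Zero C X Y = f" "Zero C X Y \<boxplus> f = f"
    using r_one[of f] l_one[of f] assms by auto
qed

lemma Add_cancel:
  assumes "f \<boxplus> h = g \<boxplus> h" "f \<in> Hom C X Y" "g \<in> Hom C X Y" "h \<in> Hom C X Y"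
  shows "f = g"
proof -
  interpret comm_group "hom_group C X Y" by (rule hom_comm_group) (use assms in auto)
  show ?thesis
    using right_cancel[of h f g] assms by auto
qed

lemma Add_self_Zero:
  assumes "f \<boxplus> f = f" "f \<in> Hom C X Y"
  shows "f = Zero C X Y"
proof (rule Add_cancel)
  have "X \<in> Ob C" "Y \<in> Ob C" using assms by auto
  then show "f \<boxplus> f = Zero C X Y \<boxplus> f" "Zero C X Y \<in> Hom C X Y" using assms by simp_all
qed (use assms in auto)

lemma Comp_Zero [simp]:
  assumes "g \<in> Arr C" "Dom C g = Y" "X \<in> Ob C"
  shows "g \<cdot> Zero C X Y = Zero C X (Cod C g)"
proof (rule Add_self_Zero)
  have Y: "Y \<in> Ob C" using assms by auto
  have "g \<cdot> Zero C X Y = g \<cdot> (Zero C X Y \<boxplus> Zero C X Y)" using assms(3) Y by simp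
  also have "\<dots> = g \<cdot> Zero C X Y \<boxplus> g \<cdot> Zero C X Y"
    by (rule Comp_Add_right) (use assms Y in simp_all)
  finally show "g \<cdot> Zero C X Y \<boxplus> g \<cdot> Zero C X Y = g \<cdot> Zero C X Y" by (rule sym)
  show "g \<cdot> Zero C X Y \<in> Hom C X (Cod C g)" using assms Y by simp
qed

lemma Zero_Comp [simp]:
  assumes "f \<in> Arr C" "Cod C f = Y" "Z \<in> Ob C"
  shows "Zero C Y Z \<cdot> f = Zero C (Dom C f) Z"
proof (rule Add_self_Zero)
  have Y: "Y \<in> Ob C" using assms by auto
  have "Zero C Y Z \<cdot> f = (Zero C Y Z \<boxplus> Zero C Y Z) \<cdot> f" using assms(3) Y by simp
  also have "\<dots> = Zero C Y Z \<cdot> f \<boxplus> Zero C Y Z \<cdot> f"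
    by (rule Comp_Add_left) (use assms Y in simp_all)
  finally show "Zero C Y Z \<cdot> f \<boxplus> Zero C Y Z \<cdot> f = Zero C Y Z \<cdot> f" by (rule sym)
  show "Zero C Y Z \<cdot> f \<in> Hom C (Dom C f) Z" using assms Y by simp
qed

lemma Scal_0 [simp]: "f \<in> Arr C \<Longrightarrow> Scal C 0 f = Zero C (Dom C f) (Cod C f)"
  using add_Scal[symmetric, of f 0 0] by (intro Add_self_Zero) auto

lemma Scal_Zero [simp]: "\<lbrakk>X \<in> Ob C; Y \<in> Ob C\<rbrakk> \<Longrightarrow> Scal C a (Zero C X Y) = Zero C X Y"
  using Scal_add[symmetric, of "Zero C X Y" X Y "Zero C X Y" a] by (intro Add_self_Zero) auto

lemma Add_minus: "f \<in> Arr C \<Longrightarrow> f \<boxplus> Scal C (- 1) f = Zero C (Dom C f) (Cod C f)"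
  using add_Scal[of f 1 "- 1"] one_Scal[of f] by simp

lemma mono_Zero:
  assumes "mono_arrow C f" "f \<in> Hom C Y Z" "g \<in> Hom C X Y" "f \<cdot> g = Zero C X Z"
  shows "g = Zero C X Y"
proof -
  have Ob: "X \<in> Ob C" "Y \<in> Ob C" using assms by auto
  have "f \<cdot> g = f \<cdot> Zero C X Y" using assms(2,4) Ob by simp
  then show ?thesis
    by (rule mono_arrowD[OF assms(1)]) (use assms(2,3) Ob in simp_all)
qed

subsection \<open>Sums of arrows\<close>

text \<open>The endpoints are arguments because an empty sum must be the zero arrow between definite
  objects.\<close>

definition hsum :: "'a \<Rightarrow> 'a \<Rightarrow> ('i \<Rightarrow> 'b) \<Rightarrow> 'i set \<Rightarrow> 'b" where
  "hsum X Y u I = finprod (hom_group C X Y) u I"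

lemma hsum_closed:
  assumes "X \<in> Ob C" "Y \<in> Ob C" "\<And>i. i \<in> I \<Longrightarrow> u i \<in> Hom C X Y"
  shows "hsum X Y u I \<in> Hom C X Y"
proof -
  interpret comm_group "hom_group C X Y" by (rule hom_comm_group) fact+
  have "u \<in> I \<rightarrow> carrier (hom_group C X Y)"
    unfolding hom_group_simps by (intro Pi_I assms(3))
  from finprod_closed[OF this] show ?thesis
    unfolding hsum_def hom_group_simps .
qed

lemma hsum_simps [simp]:
  assumes "X \<in> Ob C" "Y \<in> Ob C" "\<And>i. i \<in> I \<Longrightarrow> u i \<in> Hom C X Y"
  shows "hsum X Y u I \<in> Arr C" "Dom C (hsum X Y u I) = X" "Cod C (hsum X Y u I) = Y"
  using hsum_closed[of X Y I u, OF assms] by (simp_all only: in_Hom)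

lemma hsum_empty [simp]:
  assumes "X \<in> Ob C" "Y \<in> Ob C"
  shows "hsum X Y u {} = Zero C X Y"
proof -
  interpret comm_group "hom_group C X Y" by (rule hom_comm_group) fact+
  show ?thesis unfolding hsum_def finprod_empty by simp
qed

lemma hsum_infinite:
  assumes "X \<in> Ob C" "Y \<in> Ob C" "infinite I"
  shows "hsum X Y u I = Zero C X Y"
proof -
  interpret comm_group "hom_group C X Y" by (rule hom_comm_group) fact+
  show ?thesis unfolding hsum_def finprod_infinite[OF assms(3)] by simp
qed

lemma hsum_insert:
  assumes "X \<in> Ob C" "Y \<in> Ob C" "finite I" "i \<notin> I" "u i \<in> Hom C X Y" "\<And>j. j \<in> I \<Longrightarrow> u j \<in> Hom C X Y"
  shows "hsum X Y u (insert i I) = u i \<boxplus> hsum X Y u I"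
proof -
  interpret comm_group "hom_group C X Y" by (rule hom_comm_group) fact+
  show ?thesis
    unfolding hsum_def using finprod_insert[of I i u] assms by (auto simp: Pi_def)
qed

lemma hsum_cong:
  assumes "\<And>i. i \<in> I \<Longrightarrow> u i = v i" "X \<in> Ob C" "Y \<in> Ob C" "\<And>i. i \<in> I \<Longrightarrow> v i \<in> Hom C X Y"
  shows "hsum X Y u I = hsum X Y v I"
proof -
  interpret comm_group "hom_group C X Y" by (rule hom_comm_group) fact+
  show ?thesis
    unfolding hsum_def using assms by (intro finprod_cong') (auto simp: Pi_def)
qed

lemma hsum_reindex:
  assumes "bij_betw \<sigma> I J" "X \<in> Ob C" "Y \<in> Ob C" "\<And>j. j \<in> J \<Longrightarrow> u j \<in> Hom C X Y"
  shows "hsum X Y (\<lambda>i. u (\<sigma> i)) I = hsum X Y u J"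
proof -
  interpret comm_group "hom_group C X Y" by (rule hom_comm_group) fact+
  show ?thesis
    unfolding hsum_def using finprod_reindex[of u \<sigma> I] assms by (auto simp: Pi_def bij_betw_def)
qed

lemma hsum_Add:
  assumes "X \<in> Ob C" "Y \<in> Ob C" "\<And>i. i \<in> I \<Longrightarrow> u i \<in> Hom C X Y" "\<And>i. i \<in> I \<Longrightarrow> v i \<in> Hom C X Y"
  shows "hsum X Y (\<lambda>i. u i \<boxplus> v i) I = hsum X Y u I \<boxplus> hsum X Y v I"
proof -
  interpret comm_group "hom_group C X Y" by (rule hom_comm_group) fact+
  show ?thesis
    unfolding hsum_def using finprod_multf[of u I v] assms by (auto simp: Pi_def)
qed

lemma hsum_all_Zero:
  assumes "X \<in> Ob C" "Y \<in> Ob C" "\<And>i. i \<in> I \<Longrightarrow> u i = Zero C X Y"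
  shows "hsum X Y u I = Zero C X Y"
proof -
  interpret comm_group "hom_group C X Y" by (rule hom_comm_group) fact+
  show ?thesis
    unfolding hsum_def using finprod_one_eqI[of I u] assms(3) by auto
qed

lemma hsum_single:
  assumes "X \<in> Ob C" "Y \<in> Ob C" "finite I" "i \<in> I" "u i \<in> Hom C X Y"
    and "\<And>j. \<lbrakk>j \<in> I; j \<noteq> i\<rbrakk> \<Longrightarrow> u j = Zero C X Y"
  shows "hsum X Y u I = u i"
proof -
  have "hsum X Y u I = hsum X Y u (insert i (I - {i}))" using assms(4) by (simp add: insert_absorb)
  also have "\<dots> = u i \<boxplus> hsum X Y u (I - {i})"
    by (rule hsum_insert) (use assms in auto)
  also have "hsum X Y u (I - {i}) = Zero C X Y"
    using assms by (intro hsum_all_Zero) auto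
  finally show ?thesis using assms by auto
qed

lemma hsum_swap:
  assumes "X \<in> Ob C" "Y \<in> Ob C" "finite I" "finite J"
    and "\<And>i j. \<lbrakk>i \<in> I; j \<in> J\<rbrakk> \<Longrightarrow> u i j \<in> Hom C X Y"
  shows "hsum X Y (\<lambda>i. hsum X Y (u i) J) I = hsum X Y (\<lambda>j. hsum X Y (\<lambda>i. u i j) I) J"
  using assms(3,5)
proof (induction I)
  case empty
  then show ?case using assms by (auto intro!: hsum_all_Zero[symmetric])
next
  case (insert i I)
  have "hsum X Y (\<lambda>i. hsum X Y (u i) J) (insert i I)
      = hsum X Y (u i) J \<boxplus> hsum X Y (\<lambda>i. hsum X Y (u i) J) I"
    using insert assms(1,2,4) by (intro hsum_insert) auto
  also have "\<dots> = hsum X Y (u i) J \<boxplus> hsum X Y (\<lambda>j. hsum X Y (\<lambda>i. u i j) I) J"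
    using insert by simp
  also have "\<dots> = hsum X Y (\<lambda>j. u i j \<boxplus> hsum X Y (\<lambda>i. u i j) I) J"
    using insert assms(1,2,4) by (intro hsum_Add[symmetric]) auto
  also have "\<dots> = hsum X Y (\<lambda>j. hsum X Y (\<lambda>i. u i j) (insert i I)) J"
  proof (rule hsum_cong)
    show "u i j \<boxplus> hsum X Y (\<lambda>i. u i j) I = hsum X Y (\<lambda>i. u i j) (insert i I)" if "j \<in> J" for j
      using insert assms(1,2) that by (subst hsum_insert) auto
    show "hsum X Y (\<lambda>i. u i j) (insert i I) \<in> Hom C X Y" if "j \<in> J" for j
      by (rule hsum_closed) (use insert.prems assms(1,2) that in auto)
  qed (use assms in auto)
  finally show ?case .
qed

lemma Comp_hsum:
  assumes "g \<in> Arr C" "Dom C g = Y" "X \<in> Ob C" "\<And>i. i \<in> I \<Longrightarrow> u i \<in> Hom C X Y"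
  shows "g \<cdot> hsum X Y u I = hsum X (Cod C g) (\<lambda>i. g \<cdot> u i) I"
proof (cases "finite I")
  case True
  have Ob: "Dom C g \<in> Ob C" "Cod C g \<in> Ob C" "Y \<in> Ob C" using assms by auto
  show ?thesis
    using True assms(4)
  proof (induction I)
    case empty
    then show ?case using assms Ob by auto
  next
    case (insert i I)
    have "g \<cdot> hsum X Y u (insert i I) = g \<cdot> u i \<boxplus> g \<cdot> hsum X Y u I"
      using assms(1-3) Ob insert Comp_Add_right[of "u i" X Y "hsum X Y u I" g "Cod C g"] by (simp add: hsum_insert)
    also have "\<dots> = hsum X (Cod C g) (\<lambda>i. g \<cdot> u i) (insert i I)"
      using insert assms(1-3) Ob by (subst hsum_insert) auto
    finally show ?case .
  qed
qed (use assms in \<open>auto simp: hsum_infinite\<close>)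

lemma hsum_Comp:
  assumes "f \<in> Arr C" "Cod C f = X" "Y \<in> Ob C" "\<And>i. i \<in> I \<Longrightarrow> u i \<in> Hom C X Y"
  shows "hsum X Y u I \<cdot> f = hsum (Dom C f) Y (\<lambda>i. u i \<cdot> f) I"
proof (cases "finite I")
  case True
  have Ob: "Dom C f \<in> Ob C" "Cod C f \<in> Ob C" "X \<in> Ob C" using assms by auto
  show ?thesis
    using True assms(4)
  proof (induction I)
    case empty
    then show ?case using assms Ob by auto
  next
    case (insert i I)
    have "hsum X Y u (insert i I) \<cdot> f = u i \<cdot> f \<boxplus> hsum X Y u I \<cdot> f"
      using assms(1-3) Ob insert Comp_Add_left[of f "Dom C f" X "u i" Y "hsum X Y u I"] by (simp add: hsum_insert)
    also have "\<dots> = hsum (Dom C f) Y (\<lambda>i. u i \<cdot> f) (insert i I)"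
      using insert assms(1-3) Ob by (subst hsum_insert) auto
    finally show ?case .
  qed
qed (use assms in \<open>auto simp: hsum_infinite\<close>)

lemma hsum_Scal:
  assumes "f \<in> Arr C" "finite I"
  shows "hsum (Dom C f) (Cod C f) (\<lambda>i. Scal C (a i) f) I = Scal C (\<Sum>i\<in>I. a i) f"
  using assms(2)
proof (induction I)
  case (insert i I)
  have "hsum (Dom C f) (Cod C f) (\<lambda>i. Scal C (a i) f) (insert i I)
      = Scal C (a i) f \<boxplus> hsum (Dom C f) (Cod C f) (\<lambda>i. Scal C (a i) f) I"
    by (rule hsum_insert) (use assms insert in auto)
  also have "\<dots> = Scal C (a i + (\<Sum>i\<in>I. a i)) f"
    unfolding insert.IH by (rule add_Scal[symmetric]) fact
  finally show ?case using insert.hyps by simp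
qed (use assms(1) in simp)

end

subsection \<open>Kernels, cokernels and images\<close>

context linear_category
begin

lemma is_kernelD:
  assumes "is_kernel C f k"
  shows "f \<in> Arr C" "k \<in> Arr C" "Cod C k = Dom C f" "f \<cdot> k = Zero C (Dom C k) (Cod C f)"
  using assms by (simp_all add: is_kernel_def)

lemma is_cokernelD:
  assumes "is_cokernel C f c"
  shows "f \<in> Arr C" "c \<in> Arr C" "Dom C c = Cod C f" "c \<cdot> f = Zero C (Dom C f) (Cod C c)"
  using assms by (simp_all add: is_cokernel_def)

lemma kernel_factor:
  assumes "is_kernel C f k" "h \<in> Hom C W (Dom C f)" "f \<cdot> h = Zero C W (Cod C f)"
  obtains u where "u \<in> Hom C W (Dom C k)" "k \<cdot> u = h"
  using assms unfolding is_kernel_def by blast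

lemma cokernel_factor:
  assumes "is_cokernel C f c" "h \<in> Hom C (Cod C f) W" "h \<cdot> f = Zero C (Dom C f) W"
  obtains u where "u \<in> Hom C (Cod C c) W" "u \<cdot> c = h"
  using assms unfolding is_cokernel_def by blast

lemma is_kernel_mono:
  assumes "is_kernel C f k"
  shows "mono_arrow C k"
  unfolding mono_arrow_def
proof (intro conjI allI ballI impI)
  note k = is_kernelD[OF assms]
  fix W g h assume g: "g \<in> Hom C W (Dom C k)" and h: "h \<in> Hom C W (Dom C k)" and eq: "k \<cdot> g = k \<cdot> h"
  have "W \<in> Ob C" using g by auto
  then have "f \<cdot> k \<cdot> g = Zero C W (Cod C f)"
    using Comp_reassoc[OF k(4), of g] g k by simp
  moreover have "k \<cdot> g \<in> Hom C W (Dom C f)" using g k by simp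
  ultimately have "\<exists>!u. u \<in> Hom C W (Dom C k) \<and> k \<cdot> u = k \<cdot> g"
    using assms unfolding is_kernel_def by blast
  then show "g = h" using g h eq by metis
qed (use is_kernelD[OF assms] in blast)

lemma is_cokernel_epi:
  assumes "is_cokernel C f c"
  shows "epi_arrow C c"
  unfolding epi_arrow_def
proof (intro conjI allI ballI impI)
  note c = is_cokernelD[OF assms]
  fix W g h assume g: "g \<in> Hom C (Cod C c) W" and h: "h \<in> Hom C (Cod C c) W" and eq: "g \<cdot> c = h \<cdot> c"
  have W: "W \<in> Ob C" using g by auto
  have "(g \<cdot> c) \<cdot> f = g \<cdot> c \<cdot> f" using g c by simp
  also have "\<dots> = Zero C (Dom C f) W"
    unfolding c(4) using g c by simp
  finally have "(g \<cdot> c) \<cdot> f = Zero C (Dom C f) W" .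
  moreover have "g \<cdot> c \<in> Hom C (Cod C f) W" using g c by simp
  ultimately have "\<exists>!u. u \<in> Hom C (Cod C c) W \<and> u \<cdot> c = g \<cdot> c"
    using assms unfolding is_cokernel_def by blast
  then show "g = h" using g h eq by metis
qed (use is_cokernelD[OF assms] in blast)

lemma is_kernelI:
  assumes "f \<in> Arr C" "mono_arrow C k" "Cod C k = Dom C f" "f \<cdot> k = Zero C (Dom C k) (Cod C f)"
    and "\<And>W h. \<lbrakk>h \<in> Hom C W (Dom C f); f \<cdot> h = Zero C W (Cod C f)\<rbrakk> \<Longrightarrow> \<exists>u. u \<in> Hom C W (Dom C k) \<and> k \<cdot> u = h"
  shows "is_kernel C f k"
  unfolding is_kernel_def
proof (intro conjI allI ballI impI)
  show "k \<in> Arr C" using assms(2) by (simp add: mono_arrow_def)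
  fix W h assume "h \<in> Hom C W (Dom C f)" "f \<cdot> h = Zero C W (Cod C f)"
  then obtain u where "u \<in> Hom C W (Dom C k)" "k \<cdot> u = h" using assms(5) by blast
  then show "\<exists>!u. u \<in> Hom C W (Dom C k) \<and> k \<cdot> u = h"
    using assms(2) unfolding mono_arrow_def by metis
qed (use assms in auto)

lemma is_cokernelI:
  assumes "f \<in> Arr C" "epi_arrow C c" "Dom C c = Cod C f" "c \<cdot> f = Zero C (Dom C f) (Cod C c)"
    and "\<And>W h. \<lbrakk>h \<in> Hom C (Cod C f) W; h \<cdot> f = Zero C (Dom C f) W\<rbrakk> \<Longrightarrow> \<exists>u. u \<in> Hom C (Cod C c) W \<and> u \<cdot> c = h"
  shows "is_cokernel C f c"
  unfolding is_cokernel_def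
proof (intro conjI allI ballI impI)
  show "c \<in> Arr C" using assms(2) by (simp add: epi_arrow_def)
  fix W h assume "h \<in> Hom C (Cod C f) W" "h \<cdot> f = Zero C (Dom C f) W"
  then obtain u where "u \<in> Hom C (Cod C c) W" "u \<cdot> c = h" using assms(5) by blast
  then show "\<exists>!u. u \<in> Hom C (Cod C c) W \<and> u \<cdot> c = h"
    using assms(2) unfolding epi_arrow_def by metis
qed (use assms in auto)

end

lemma (in additive_category) direct_sumD:
  assumes "direct_sum C X Z W i1 i2 p1 p2"
  shows "i1 \<in> Hom C X W" "i2 \<in> Hom C Z W" "p1 \<in> Hom C W X" "p2 \<in> Hom C W Z"
    and "p1 \<cdot> i1 = Ident C X" "p2 \<cdot> i2 = Ident C Z" "p1 \<cdot> i2 = Zero C Z X" "p2 \<cdot> i1 = Zero C X Z"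
    and "i1 \<cdot> p1 \<boxplus> i2 \<cdot> p2 = Ident C W"
    and "mono_arrow C i1" "mono_arrow C i2"
proof -
  show *: "i1 \<in> Hom C X W" "i2 \<in> Hom C Z W" "p1 \<in> Hom C W X" "p2 \<in> Hom C W Z"
    "p1 \<cdot> i1 = Ident C X" "p2 \<cdot> i2 = Ident C Z" "p1 \<cdot> i2 = Zero C Z X" "p2 \<cdot> i1 = Zero C X Z"
    "i1 \<cdot> p1 \<boxplus> i2 \<cdot> p2 = Ident C W"
    using assms unfolding direct_sum_def by blast+
  show "mono_arrow C i1" by (rule split_mono_arrow[of p1]) (use * in auto)
  show "mono_arrow C i2" by (rule split_mono_arrow[of p2]) (use * in auto)
qed

context abelian_category
begin

text \<open>The axioms make \<open>f\<close> a kernel of some \<open>g\<close> only. As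
  \<open>g\<close> kills \<open>f\<close>, it factors through the cokernel \<open>c\<close>; hence
  whatever \<open>c\<close> kills is killed by \<open>g\<close>, and \<open>f\<close> is a kernel of
  \<open>c\<close> as well.\<close>

lemma short_exact_of_mono:
  assumes "mono_arrow C f" "is_cokernel C f c"
  shows "short_exact C (Dom C f) f (Cod C f) c (Cod C c)"
proof -
  note c = is_cokernelD[OF assms(2)]
  obtain g where g: "is_kernel C g f" using mono_is_kernel[OF assms(1)] by blast
  note gD = is_kernelD[OF g]
  obtain u where u: "u \<in> Hom C (Cod C c) (Cod C g)" "u \<cdot> c = g"
    by (rule cokernel_factor[OF assms(2), of g]) (use gD in auto)
  have "is_kernel C c f"
  proof (rule is_kernelI)
    fix W h assume h: "h \<in> Hom C W (Dom C c)" "c \<cdot> h = Zero C W (Cod C c)"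
    have W: "W \<in> Ob C" using h by auto
    have "g \<cdot> h = u \<cdot> c \<cdot> h" using Comp_reassoc[OF u(2), of h] u(1) h(1) c by simp
    also have "\<dots> = Zero C W (Cod C g)" using h(2) u W by simp
    finally obtain v where "v \<in> Hom C W (Dom C f)" "f \<cdot> v = h"
      by (rule kernel_factor[OF g, rotated]) (use h c gD in auto)
    then show "\<exists>v. v \<in> Hom C W (Dom C f) \<and> f \<cdot> v = h" by blast
  qed (use assms c in auto)
  then show ?thesis using assms(2) c by (simp add: short_exact_def)
qed

lemma short_exact_of_epi:
  assumes "epi_arrow C g" "is_kernel C g k"
  shows "short_exact C (Dom C k) k (Dom C g) g (Cod C g)"
proof -
  note k = is_kernelD[OF assms(2)]
  obtain f where f: "is_cokernel C f g" using epi_is_cokernel[OF assms(1)] by blast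
  note fD = is_cokernelD[OF f]
  obtain u where u: "u \<in> Hom C (Dom C f) (Dom C k)" "k \<cdot> u = f"
    by (rule kernel_factor[OF assms(2), of f]) (use fD in auto)
  have "is_cokernel C k g"
  proof (rule is_cokernelI)
    fix W h assume h: "h \<in> Hom C (Cod C k) W" "h \<cdot> k = Zero C (Dom C k) W"
    have W: "W \<in> Ob C" using h by auto
    have "h \<cdot> f = h \<cdot> k \<cdot> u" using u(2) by simp
    also have "\<dots> = Zero C (Dom C f) W" using Comp_reassoc[OF h(2), of u] u h(1) k W by simp
    finally obtain v where "v \<in> Hom C (Cod C g) W" "v \<cdot> g = h"
      by (rule cokernel_factor[OF f, rotated]) (use h k fD in auto)
    then show "\<exists>v. v \<in> Hom C (Cod C g) W \<and> v \<cdot> g = h" by blast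
  qed (use assms k in auto)
  then show ?thesis using assms(2) k by (simp add: short_exact_def)
qed

lemma split_short_exact:
  assumes "direct_sum C X Z W i1 i2 p1 p2"
  shows "short_exact C X i1 W p2 Z"
proof -
  have i1: "i1 \<in> Hom C X W" and i2: "i2 \<in> Hom C Z W" and p1: "p1 \<in> Hom C W X" and p2: "p2 \<in> Hom C W Z"
    and e: "p1 \<cdot> i1 = Ident C X" "p2 \<cdot> i2 = Ident C Z" "p2 \<cdot> i1 = Zero C X Z"
      "i1 \<cdot> p1 \<boxplus> i2 \<cdot> p2 = Ident C W"
    using assms by (auto simp: direct_sum_def)
  have Ob: "X \<in> Ob C" "Z \<in> Ob C" "W \<in> Ob C" using i1 i2 by auto
  have "epi_arrow C p2" by (rule split_epi_arrow[of _ i2]) (use e i2 p2 in auto)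
  moreover have "is_kernel C p2 i1"
  proof (rule is_kernelI)
    show "mono_arrow C i1"
      unfolding mono_arrow_def
    proof (intro conjI allI ballI impI)
      fix V x y assume xy: "x \<in> Hom C V (Dom C i1)" "y \<in> Hom C V (Dom C i1)" "i1 \<cdot> x = i1 \<cdot> y"
      have "p1 \<cdot> i1 \<cdot> x = x" "p1 \<cdot> i1 \<cdot> y = y"
        using Comp_reassoc[OF e(1)] xy(1,2) i1 p1 by auto
      then show "x = y" using xy(3) by metis
    qed (use i1 in simp)
    fix V h assume h: "h \<in> Hom C V (Dom C p2)" "p2 \<cdot> h = Zero C V (Cod C p2)"
    have V: "V \<in> Ob C" using h by auto
    have "h = (i1 \<cdot> p1 \<boxplus> i2 \<cdot> p2) \<cdot> h" unfolding e using h p2 by simp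
    also have "\<dots> = (i1 \<cdot> p1) \<cdot> h \<boxplus> (i2 \<cdot> p2) \<cdot> h"
      by (rule Comp_Add_left) (use h i1 i2 p1 p2 in auto)
    also have "\<dots> = i1 \<cdot> p1 \<cdot> h" using h i1 i2 p1 p2 V Ob by simp
    finally have "i1 \<cdot> p1 \<cdot> h = h" by (rule sym)
    moreover have "p1 \<cdot> h \<in> Hom C V (Dom C i1)" using h i1 p1 p2 by simp
    ultimately show "\<exists>u. u \<in> Hom C V (Dom C i1) \<and> i1 \<cdot> u = h" by blast
  qed (use i1 p2 e in auto)
  ultimately show ?thesis using short_exact_of_epi[of p2 i1] i1 p2 by simp
qed

text \<open>The complementary idempotent \<open>d' = 1 - d\<close> kills \<open>d\<close>, so it
  factors through the cokernel of \<open>d\<close> and therefore kills the image \<open>i\<close>.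
  Thus \<open>d \<cdot> i = i\<close>, and cancelling the monomorphism \<open>i\<close> shows that
  the factorisation of \<open>d\<close> through its image is a splitting.\<close>

lemma image_of_idempotent:
  assumes "is_image C d i" "d \<in> Hom C T T" "d \<cdot> d = d"
  obtains r where "r \<in> Hom C T (Dom C i)" "i \<in> Hom C (Dom C i) T" "i \<cdot> r = d" "r \<cdot> i = Ident C (Dom C i)"
proof -
  obtain c where c: "is_cokernel C d c" and i: "is_kernel C c i"
    using assms(1) by (auto simp: is_image_def)
  note cD = is_cokernelD[OF c] and iD = is_kernelD[OF i]
  have Ob: "T \<in> Ob C" using assms(2) by auto
  obtain r where r: "r \<in> Hom C T (Dom C i)" "i \<cdot> r = d"
    by (rule kernel_factor[OF i, of d T]) (use assms cD in auto)
  define d' where "d' = Ident C T \<boxplus> Scal C (- 1) d"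
  have d': "d' \<in> Hom C T T" using assms(2) Ob by (simp add: d'_def)
  have "d' \<cdot> d = Ident C T \<cdot> d \<boxplus> Scal C (- 1) d \<cdot> d"
    unfolding d'_def by (rule Comp_Add_left) (use assms(2) Ob in auto)
  also have "\<dots> = d \<boxplus> Scal C (- 1) d"
    using Comp_Scal_left[of d T T d T "- 1"] assms by simp
  also have "\<dots> = Zero C T T" using Add_minus[of d] assms(2) by simp
  finally have d'd: "d' \<cdot> d = Zero C T T" .
  obtain u where u: "u \<in> Hom C (Cod C c) T" "u \<cdot> c = d'"
    by (rule cokernel_factor[OF c, of d' T]) (use assms(2) d' d'd in auto)
  have "d' \<cdot> i = u \<cdot> c \<cdot> i" using Comp_reassoc[OF u(2), of i] u(1) cD iD by simp
  also have "\<dots> = Zero C (Dom C i) T" using u cD iD by simp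
  finally have "d' \<cdot> i = Zero C (Dom C i) T" .
  moreover have "d' \<cdot> i = Ident C T \<cdot> i \<boxplus> Scal C (- 1) d \<cdot> i"
    unfolding d'_def by (rule Comp_Add_left) (use assms(2) Ob cD iD in auto)
  moreover have "Scal C (- 1) d \<cdot> i = Scal C (- 1) (d \<cdot> i)"
    by (rule Comp_Scal_left) (use assms(2) Ob cD iD in auto)
  moreover have "d \<cdot> i \<boxplus> Scal C (- 1) (d \<cdot> i) = Zero C (Dom C i) T"
    using Add_minus[of "d \<cdot> i"] assms(2) cD iD by simp
  ultimately have "i \<boxplus> Scal C (- 1) (d \<cdot> i) = d \<cdot> i \<boxplus> Scal C (- 1) (d \<cdot> i)"
    using assms(2) cD iD by simp
  then have di: "i = d \<cdot> i"
    by (rule Add_cancel[of _ _ _ "Dom C i" T]) (use assms(2) cD iD in auto)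
  have "i \<cdot> r \<cdot> i = d \<cdot> i" using Comp_reassoc[OF r(2), of i] r(1) cD iD assms(2) by simp
  also have "\<dots> = i \<cdot> Ident C (Dom C i)" using di iD by simp
  finally have "r \<cdot> i = Ident C (Dom C i)"
    by (rule mono_arrowD[OF is_kernel_mono[OF i]]) (use r iD cD assms(2) in auto)
  then show ?thesis using that r iD cD assms(2) by auto
qed

lemma ex_image: "f \<in> Arr C \<Longrightarrow> \<exists>i. is_image C f i"
  unfolding is_image_def using ex_cokernel ex_kernel is_cokernelD(2) by blast

text \<open>
  In the application \<open>\<phi>\<close> and \<open>\<phi>'\<close> are maps out of \<open>T\<close> whose kernels are consecutive steps of a
  filtration, \<open>m\<close> and \<open>w\<close> compare its graded pieces with those of the split case, and \<open>S\<close> and \<open>E\<close>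
  are the images of the idempotents \<open>j r\<close> on \<open>T\<close> and \<open>jE rE\<close> on \<open>W\<close>.
\<close>

lemma graded_piece_short_exact:
  assumes j: "j \<in> Hom C S T" and r: "r \<in> Hom C T S" and rj: "r \<cdot> j = Ident C S"
    and \<phi>: "\<phi> \<in> Hom C T V" and \<phi>': "\<phi>' \<in> Hom C T V'"
    and \<phi>'_comm: "\<phi>' \<cdot> j \<cdot> r = \<eta>' \<cdot> \<phi>'" "\<eta>' \<in> Hom C V' V'"
    and \<kappa>: "is_kernel C (\<phi> \<cdot> j) \<kappa>" and \<kappa>': "is_kernel C (\<phi>' \<cdot> j) \<kappa>'"
    and step: "\<And>A h. \<lbrakk>h \<in> Hom C A T; \<phi> \<cdot> h = Zero C A V\<rbrakk> \<Longrightarrow> \<phi>' \<cdot> h = Zero C A V'"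
    and m: "m \<in> Hom C W V" "mono_arrow C m"
    and lift: "\<And>A h. \<lbrakk>h \<in> Hom C A T; \<phi>' \<cdot> h = Zero C A V'\<rbrakk> \<Longrightarrow> \<exists>\<theta>\<in>Hom C A W. \<phi> \<cdot> h = m \<cdot> \<theta>"
    and jE: "jE \<in> Hom C E W" and rE: "rE \<in> Hom C W E" and rjE: "rE \<cdot> jE = Ident C E"
    and \<rho>: "\<rho> \<in> Hom C V V" "m \<cdot> jE \<cdot> rE = \<rho> \<cdot> m" "\<rho> \<cdot> \<phi> \<cdot> j = \<phi> \<cdot> j"
    and w: "w \<in> Hom C P W" "epi_arrow C w"
    and u: "u \<in> Hom C P T" "\<phi>' \<cdot> u = Zero C P V'" "\<phi> \<cdot> j \<cdot> r \<cdot> u = m \<cdot> jE \<cdot> rE \<cdot> w"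
  shows "\<exists>a b. short_exact C (Dom C \<kappa>) a (Dom C \<kappa>') b E"
proof -
  have Ob: "S \<in> Ob C" "T \<in> Ob C" "V \<in> Ob C" "V' \<in> Ob C" "W \<in> Ob C" "E \<in> Ob C" "P \<in> Ob C"
    using j \<phi> \<phi>' m jE w by auto
  have \<kappa>D: "\<kappa> \<in> Hom C (Dom C \<kappa>) S" "\<phi> \<cdot> j \<cdot> \<kappa> = Zero C (Dom C \<kappa>) V"
    using is_kernelD[OF \<kappa>] j \<phi> by auto
  have \<kappa>'D: "\<kappa>' \<in> Hom C (Dom C \<kappa>') S" "\<phi>' \<cdot> j \<cdot> \<kappa>' = Zero C (Dom C \<kappa>') V'"
    using is_kernelD[OF \<kappa>'] j \<phi>' by auto
  have \<phi>'\<kappa>: "\<phi>' \<cdot> j \<cdot> \<kappa> = Zero C (Dom C \<kappa>) V'"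
    by (rule step) (use \<kappa>D j in auto)
  obtain a where a: "a \<in> Hom C (Dom C \<kappa>) (Dom C \<kappa>')" "\<kappa>' \<cdot> a = \<kappa>"
    by (rule kernel_factor[OF \<kappa>', of \<kappa> "Dom C \<kappa>"]) (use \<kappa>D \<phi>'\<kappa> j \<phi>' in auto)
  obtain \<theta> where \<theta>: "\<theta> \<in> Hom C (Dom C \<kappa>') W" "\<phi> \<cdot> j \<cdot> \<kappa>' = m \<cdot> \<theta>"
    using lift[of "j \<cdot> \<kappa>'" "Dom C \<kappa>'"] \<kappa>'D j by auto
  \<comment> \<open>The lift \<open>\<theta>\<close> already lies in the summand \<open>E\<close>:
    on \<open>W\<close> its idempotent is the restriction of \<open>\<rho>\<close>, and
    \<open>\<rho>\<close> fixes \<open>\<phi> \<cdot> j\<close>.\<close>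
  have "m \<cdot> jE \<cdot> rE \<cdot> \<theta> = \<rho> \<cdot> m \<cdot> \<theta>"
    using Comp_reassoc[OF \<rho>(2), of \<theta>] \<theta> m jE rE \<rho>(1) by simp
  also have "\<dots> = \<rho> \<cdot> \<phi> \<cdot> j \<cdot> \<kappa>'" using \<theta> by simp
  also have "\<dots> = m \<cdot> \<theta>"
    using Comp_reassoc[OF \<rho>(3), of \<kappa>'] \<kappa>'D j \<phi> \<rho>(1) \<theta> by simp
  finally have absorb: "jE \<cdot> rE \<cdot> \<theta> = \<theta>"
    by (rule mono_arrowD[OF m(2)]) (use \<theta> jE rE m in auto)
  define b where "b = rE \<cdot> \<theta>"
  have b: "b \<in> Hom C (Dom C \<kappa>') E" using \<theta> rE by (simp add: b_def)
  have mb: "m \<cdot> jE \<cdot> b = \<phi> \<cdot> j \<cdot> \<kappa>'" using absorb \<theta> by (simp add: b_def)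
  \<comment> \<open>Towards surjectivity of \<open>b\<close>: since the idempotent on
    \<open>T\<close> passes through \<open>\<phi>'\<close>, the arrow \<open>r \<cdot> u\<close>
    still lands in the kernel step and lifts to some \<open>v\<close>. Then
    \<open>b \<cdot> v\<close> is \<open>rE \<cdot> w\<close>, a composite of epimorphisms.\<close>
  have "\<phi>' \<cdot> j \<cdot> r \<cdot> u = \<eta>' \<cdot> \<phi>' \<cdot> u"
    using Comp_reassoc[OF \<phi>'_comm(1), of u] j r u \<phi>' \<phi>'_comm(2) by simp
  also have "\<dots> = Zero C P V'" using u \<phi>'_comm Ob by simp
  finally have \<phi>'u: "\<phi>' \<cdot> j \<cdot> r \<cdot> u = Zero C P V'" .
  obtain v where v: "v \<in> Hom C P (Dom C \<kappa>')" "\<kappa>' \<cdot> v = r \<cdot> u"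
    by (rule kernel_factor[OF \<kappa>', of "r \<cdot> u" P]) (use r u(1) j \<phi>' \<phi>'u in auto)
  have "m \<cdot> jE \<cdot> b \<cdot> v = \<phi> \<cdot> j \<cdot> \<kappa>' \<cdot> v"
    using Comp_reassoc[OF mb, of v] m jE b v \<phi> j \<kappa>'D by simp
  also have "\<dots> = m \<cdot> jE \<cdot> rE \<cdot> w" using u v by simp
  finally have "jE \<cdot> b \<cdot> v = jE \<cdot> rE \<cdot> w"
    by (rule mono_arrowD[OF m(2)]) (use m jE b v rE w in auto)
  then have "rE \<cdot> jE \<cdot> b \<cdot> v = rE \<cdot> jE \<cdot> rE \<cdot> w" by simp
  then have "b \<cdot> v = rE \<cdot> w"
    using Comp_reassoc[OF rjE, of "b \<cdot> v"] Comp_reassoc[OF rjE, of "rE \<cdot> w"] b v w rE jE by simp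
  moreover have "epi_arrow C rE" by (rule split_epi_arrow[of _ jE]) (use rE jE rjE in auto)
  then have "epi_arrow C (rE \<cdot> w)" by (rule epi_arrow_Comp[OF w(2)]) (use w rE in auto)
  ultimately have "epi_arrow C (b \<cdot> v)" by simp
  then have b_epi: "epi_arrow C b" by (rule epi_arrow_of_Comp) (use b v in auto)
  \<comment> \<open>By \<open>mb\<close>, and because \<open>m\<close> and \<open>jE\<close> can be
    cancelled, \<open>b\<close> kills exactly what \<open>\<phi> \<cdot> j \<cdot> \<kappa>'\<close>
    kills. Its kernel is therefore that of \<open>\<phi> \<cdot> j\<close>, placed inside the larger
    step by \<open>a\<close>.\<close>
  have "is_kernel C b a"
  proof (rule is_kernelI)
    show "mono_arrow C a"
      unfolding mono_arrow_def
    proof (intro conjI allI ballI impI)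
      fix A x y assume xy: "x \<in> Hom C A (Dom C a)" "y \<in> Hom C A (Dom C a)" "a \<cdot> x = a \<cdot> y"
      have "\<kappa> \<cdot> x = \<kappa>' \<cdot> a \<cdot> x" "\<kappa> \<cdot> y = \<kappa>' \<cdot> a \<cdot> y"
        using Comp_reassoc[OF a(2)] xy(1,2) a(1) \<kappa>'D by auto
      then have "\<kappa> \<cdot> x = \<kappa> \<cdot> y" using xy(3) by simp
      then show "x = y" by (rule mono_arrowD[OF is_kernel_mono[OF \<kappa>]]) (use xy a in auto)
    qed (use a in simp)
    have "m \<cdot> jE \<cdot> b \<cdot> a = \<phi> \<cdot> j \<cdot> \<kappa>' \<cdot> a"
      using Comp_reassoc[OF mb, of a] m jE b a \<phi> j \<kappa>'D by simp
    also have "\<dots> = Zero C (Dom C \<kappa>) V" using a \<kappa>D by simp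
    finally have "jE \<cdot> b \<cdot> a = Zero C (Dom C \<kappa>) W"
      by (rule mono_Zero[OF m(2) m(1), rotated]) (use a b jE in auto)
    then have "rE \<cdot> jE \<cdot> b \<cdot> a = Zero C (Dom C \<kappa>) E"
      using rE Ob \<kappa>D by simp
    then show "b \<cdot> a = Zero C (Dom C a) (Cod C b)"
      using Comp_reassoc[OF rjE, of "b \<cdot> a"] a b rE jE by simp
    fix A h assume h: "h \<in> Hom C A (Dom C b)" "b \<cdot> h = Zero C A (Cod C b)"
    have A: "A \<in> Ob C" using h by auto
    have "\<phi> \<cdot> j \<cdot> \<kappa>' \<cdot> h = m \<cdot> jE \<cdot> b \<cdot> h"
      using Comp_reassoc[OF mb, of h] m jE b h \<phi> j \<kappa>'D by simp
    also have "\<dots> = Zero C A V" using h b m jE A by simp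
    finally have \<phi>h: "\<phi> \<cdot> j \<cdot> \<kappa>' \<cdot> h = Zero C A V" .
    obtain x where x: "x \<in> Hom C A (Dom C \<kappa>)" "\<kappa> \<cdot> x = \<kappa>' \<cdot> h"
      by (rule kernel_factor[OF \<kappa>, of "\<kappa>' \<cdot> h" A]) (use h(1) b j \<phi> \<phi>h \<kappa>'D(1) in auto)
    have "\<kappa>' \<cdot> a \<cdot> x = \<kappa>' \<cdot> h"
      using Comp_reassoc[OF a(2), of x] x a \<kappa>'D by simp
    then have "a \<cdot> x = h"
      by (rule mono_arrowD[OF is_kernel_mono[OF \<kappa>']]) (use x a b h in auto)
    then show "\<exists>x. x \<in> Hom C A (Dom C a) \<and> a \<cdot> x = h" using x a by auto
  qed (use a b in auto)
  from short_exact_of_epi[OF b_epi this] show ?thesis using a b by auto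
qed

end

subsection \<open>Classes in the Grothendieck group\<close>

context category
begin

lemma K0_relations_normal: "K0_relations C \<lhd> K0_free C"
proof -
  let ?F = "K0_free C"
  interpret comm_group ?F unfolding K0_free_def by (rule abelian_free_Abelian_group)
  have keys: "Poly_Mapping.keys (frag_of (iso_class C X)) \<subseteq> iso_class C ` Ob C" if "X \<in> Ob C" for X
    using that by auto
  have "subgroup (K0_relations C) ?F"
    unfolding K0_relations_def
  proof (rule generate_is_subgroup, clarify)
    fix X f Z g Y assume "short_exact C X f Z g Y"
    then have "X \<in> Ob C" "Y \<in> Ob C" "Z \<in> Ob C" by (auto simp: short_exact_def)
    then show "frag_of (iso_class C Z) - frag_of (iso_class C X) - frag_of (iso_class C Y) \<in> carrier ?F"
      unfolding K0_free_def carrier_free_Abelian_group_iff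
      by (intro order_trans[OF keys_diff] Un_least keys)
  qed
  then show ?thesis by (rule subgroup_imp_normal)
qed

lemma comm_group_K0: "comm_group (K0 C)"
  unfolding K0_def K0_free_def
  by (rule comm_group.abelian_FactGroup[OF abelian_free_Abelian_group])
    (rule normal_imp_subgroup[OF K0_relations_normal, unfolded K0_free_def])

lemma cl_closed: "X \<in> Ob C \<Longrightarrow> cl C X \<in> carrier (K0 C)"
  unfolding cl_def K0_def carrier_FactGroup by (auto simp: K0_free_def)

lemma cl_short_exact:
  assumes "short_exact C X f Z g Y"
  shows "cl C Z = cl C X \<otimes>\<^bsub>K0 C\<^esub> cl C Y"
proof -
  let ?F = "K0_free C" and ?N = "K0_relations C"
  let ?x = "frag_of (iso_class C X)" and ?y = "frag_of (iso_class C Y)" and ?z = "frag_of (iso_class C Z)"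
  interpret N: normal ?N ?F by (rule K0_relations_normal)
  have Ob: "X \<in> Ob C" "Y \<in> Ob C" "Z \<in> Ob C" using assms by (auto simp: short_exact_def)
  then have F: "?x \<in> carrier ?F" "?y \<in> carrier ?F" "?z \<in> carrier ?F" by (auto simp: K0_free_def)
  have "?z - ?x - ?y \<in> ?N"
    unfolding K0_relations_def by (rule generate.incl) (use assms in blast)
  moreover have "?z = (?z - ?x - ?y) \<otimes>\<^bsub>?F\<^esub> (?x \<otimes>\<^bsub>?F\<^esub> ?y)" by (simp add: K0_free_def)
  ultimately have "?z \<in> ?N #>\<^bsub>?F\<^esub> (?x \<otimes>\<^bsub>?F\<^esub> ?y)"
    unfolding r_coset_def by auto
  then have "?N #>\<^bsub>?F\<^esub> (?x \<otimes>\<^bsub>?F\<^esub> ?y) = ?N #>\<^bsub>?F\<^esub> ?z"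
    by (rule N.repr_independence) (use F N.subgroup_axioms in auto)
  then show ?thesis
    using F by (simp add: cl_def K0_def N.rcos_sum)
qed

end

text \<open>With all arrows zero, \<open>N\<close>, \<open>N\<close>, \<open>N\<close> form a short
  exact sequence, so \<open>cl C N\<close> is idempotent in a group. Vanishing is tested on the
  identity because this is what cancelling a zero monomorphism out of \<open>N\<close>
  produces.\<close>

lemma (in additive_category) cl_eq_if_Ident_Zero:
  assumes "N \<in> Ob C" "Ident C N = Zero C N N"
  shows "cl C N = \<one>\<^bsub>K0 C\<^esub>"
proof -
  interpret K: comm_group "K0 C" by (rule comm_group_K0)
  have to_N: "f = Zero C X N" if "f \<in> Hom C X N" for f X
  proof -
    have "f = Ident C N \<cdot> f" using that by simp
    also have "\<dots> = Zero C X N" unfolding assms(2) using that assms(1) by simp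
    finally show ?thesis .
  qed
  have from_N: "f = Zero C N X" if "f \<in> Hom C N X" for f X
  proof -
    have "f = f \<cdot> Ident C N" using that by simp
    also have "\<dots> = Zero C N X" unfolding assms(2) using that assms(1) by simp
    finally show ?thesis .
  qed
  have zero: "Zero C N N \<in> Arr C" "Dom C (Zero C N N) = N" "Cod C (Zero C N N) = N"
    using assms(1) by simp_all
  have "is_kernel C (Zero C N N) (Zero C N N)"
    unfolding is_kernel_def zero
  proof (intro conjI allI ballI impI)
    fix W h assume h: "h \<in> Hom C W N"
    then have W: "W \<in> Ob C" by auto
    show "\<exists>!u. u \<in> Hom C W N \<and> Zero C N N \<cdot> u = h"
    proof (rule ex1I)
      show "Zero C W N \<in> Hom C W N \<and> Zero C N N \<cdot> Zero C W N = h"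
        using to_N[OF h] W assms(1) by simp
    qed (use to_N in blast)
  qed (use assms(1) in simp_all)
  moreover have "is_cokernel C (Zero C N N) (Zero C N N)"
    unfolding is_cokernel_def zero
  proof (intro conjI allI ballI impI)
    fix W h assume h: "h \<in> Hom C N W"
    then have W: "W \<in> Ob C" by auto
    show "\<exists>!u. u \<in> Hom C N W \<and> u \<cdot> Zero C N N = h"
    proof (rule ex1I)
      show "Zero C N W \<in> Hom C N W \<and> Zero C N W \<cdot> Zero C N N = h"
        using from_N[OF h] W assms(1) by simp
    qed (use from_N in blast)
  qed (use assms(1) in simp_all)
  ultimately have "short_exact C N (Zero C N N) N (Zero C N N) N"
    using zero by (simp add: short_exact_def)
  from cl_short_exact[OF this] show ?thesis
    using cl_closed[OF assms(1)] by (metis K.l_cancel_one')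
qed

section \<open>The symmetric group action on tensor powers\<close>

context linear_tensor_category
begin

declare Unit_in_Ob [simp] TenO_in_Ob [simp]

lemma TenM_simps [simp]:
  assumes "f \<in> Arr C" "g \<in> Arr C"
  shows "f \<otimes>\<^sub>m g \<in> Arr C" "Dom C (f \<otimes>\<^sub>m g) = Dom C f \<otimes>\<^sub>o Dom C g" "Cod C (f \<otimes>\<^sub>m g) = Cod C f \<otimes>\<^sub>o Cod C g"
  using TenM_in_Hom[of f "Dom C f" "Cod C f" g "Dom C g" "Cod C g"] assms by simp_all

lemma TenM_Ident' [simp]:
  "\<lbrakk>X \<in> Ob C; Y \<in> Ob C\<rbrakk> \<Longrightarrow> Ident C X \<otimes>\<^sub>m Ident C Y = Ident C (X \<otimes>\<^sub>o Y)"
  by (rule TenM_Ident)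

lemma TenM_merge:
  "\<lbrakk>f \<in> Arr C; f' \<in> Arr C; g \<in> Arr C; g' \<in> Arr C; Cod C f = Dom C f'; Cod C g = Dom C g'\<rbrakk>
    \<Longrightarrow> (f' \<otimes>\<^sub>m g') \<cdot> (f \<otimes>\<^sub>m g) = (f' \<cdot> f) \<otimes>\<^sub>m (g' \<cdot> g)"
  using TenM_Comp[of f "Dom C f" "Dom C f'" f' "Cod C f'" g "Dom C g" "Dom C g'" g' "Cod C g'"] by simp

lemma TenM_merge_left:
  "\<lbrakk>f \<in> Arr C; f' \<in> Arr C; g \<in> Arr C; g' \<in> Arr C; h \<in> Arr C; Cod C f = Dom C f'; Cod C g = Dom C g';
    Cod C h = Dom C f \<otimes>\<^sub>o Dom C g\<rbrakk>
    \<Longrightarrow> (f' \<otimes>\<^sub>m g') \<cdot> (f \<otimes>\<^sub>m g) \<cdot> h = ((f' \<cdot> f) \<otimes>\<^sub>m (g' \<cdot> g)) \<cdot> h"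
  by (rule Comp_reassoc[OF TenM_merge]) simp_all

lemma Assoc_simps [simp]:
  assumes "X \<in> Ob C" "Y \<in> Ob C" "Z \<in> Ob C"
  shows "Assoc C X Y Z \<in> Arr C" "Dom C (Assoc C X Y Z) = X \<otimes>\<^sub>o Y \<otimes>\<^sub>o Z"
    "Cod C (Assoc C X Y Z) = X \<otimes>\<^sub>o (Y \<otimes>\<^sub>o Z)" "iso_arrow C (Assoc C X Y Z)"
  using Assoc_in_Hom[OF assms] Assoc_iso[OF assms] by simp_all

lemma Braid_simps [simp]:
  assumes "X \<in> Ob C" "Y \<in> Ob C"
  shows "Braid C X Y \<in> Arr C" "Dom C (Braid C X Y) = X \<otimes>\<^sub>o Y" "Cod C (Braid C X Y) = Y \<otimes>\<^sub>o X"
  using Braid_in_Hom[OF assms] by simp_all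

lemma iso_TenM:
  assumes "iso_arrow C f" "iso_arrow C g"
  shows "iso_arrow C (f \<otimes>\<^sub>m g)"
  unfolding iso_arrow_def inverse_arrows_def
  using assms by (intro exI[of _ "inverse_arrow C f \<otimes>\<^sub>m inverse_arrow C g"]) (simp add: TenM_merge)

lemma iso_Ident: "X \<in> Ob C \<Longrightarrow> iso_arrow C (Ident C X)"
  unfolding iso_arrow_def inverse_arrows_def by (intro exI[of _ "Ident C X"]) simp

lemma tensor_power_Ob [simp]: "X \<in> Ob C \<Longrightarrow> tensor_power C X n \<in> Ob C"
  by (induction n) auto

text \<open>The last adjacent swap with an arbitrary prefix \<open>T\<close> in place of a tensor
  power, so that naturality in the prefix can be expressed.\<close>

definition last_swap :: "'o \<Rightarrow> 'o \<Rightarrow> 'm" where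
  "last_swap T X = inverse_arrow C (Assoc C T X X) \<cdot> (Ident C T \<otimes>\<^sub>m Braid C X X) \<cdot> Assoc C T X X"

lemma last_swap_simps [simp]:
  assumes "T \<in> Ob C" "X \<in> Ob C"
  shows "last_swap T X \<in> Arr C" "Dom C (last_swap T X) = T \<otimes>\<^sub>o X \<otimes>\<^sub>o X"
    "Cod C (last_swap T X) = T \<otimes>\<^sub>o X \<otimes>\<^sub>o X"
  using assms by (simp_all add: last_swap_def)

lemma Assoc_last_swap:
  assumes "T \<in> Ob C" "X \<in> Ob C"
  shows "Assoc C T X X \<cdot> last_swap T X = (Ident C T \<otimes>\<^sub>m Braid C X X) \<cdot> Assoc C T X X"
  using assms by (simp add: last_swap_def)

lemma last_swap_square:
  assumes "T \<in> Ob C" "X \<in> Ob C"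
  shows "last_swap T X \<cdot> last_swap T X = Ident C (T \<otimes>\<^sub>o X \<otimes>\<^sub>o X)"
  using assms by (simp add: last_swap_def TenM_merge_left Braid_symmetric)

text \<open>After the associativity isomorphism this is naturality of the braiding. Varying
  \<open>u\<close> makes distant swaps commute; allowing \<open>f\<close> and \<open>g\<close> to
  differ is what lets swaps permute mixed tensor products of arrows.\<close>

lemma last_swap_natural:
  assumes u: "u \<in> Hom C T T'" and f: "f \<in> Hom C X X'" and g: "g \<in> Hom C X X'"
  shows "last_swap T' X' \<cdot> (u \<otimes>\<^sub>m f \<otimes>\<^sub>m g) = (u \<otimes>\<^sub>m g \<otimes>\<^sub>m f) \<cdot> last_swap T X"
proof (rule iso_mono[of "Assoc C T' X' X'"])
  have Ob: "T \<in> Ob C" "T' \<in> Ob C" "X \<in> Ob C" "X' \<in> Ob C" using assms by auto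
  have "Assoc C T' X' X' \<cdot> last_swap T' X' \<cdot> (u \<otimes>\<^sub>m f \<otimes>\<^sub>m g)
      = (Ident C T' \<otimes>\<^sub>m Braid C X' X') \<cdot> Assoc C T' X' X' \<cdot> (u \<otimes>\<^sub>m f \<otimes>\<^sub>m g)"
    using Comp_reassoc[OF Assoc_last_swap[of T' X'], of "u \<otimes>\<^sub>m f \<otimes>\<^sub>m g"] Ob assms by simp
  also have "\<dots> = (Ident C T' \<otimes>\<^sub>m Braid C X' X') \<cdot> (u \<otimes>\<^sub>m (f \<otimes>\<^sub>m g)) \<cdot> Assoc C T X X"
    by (simp only: Assoc_natural[OF assms])
  also have "\<dots> = (u \<otimes>\<^sub>m (Braid C X' X' \<cdot> (f \<otimes>\<^sub>m g))) \<cdot> Assoc C T X X"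
    using Ob assms by (simp add: TenM_merge_left)
  also have "Braid C X' X' \<cdot> (f \<otimes>\<^sub>m g) = (g \<otimes>\<^sub>m f) \<cdot> Braid C X X"
    by (rule Braid_natural[OF f g])
  also have "(u \<otimes>\<^sub>m ((g \<otimes>\<^sub>m f) \<cdot> Braid C X X)) \<cdot> Assoc C T X X
      = (u \<otimes>\<^sub>m (g \<otimes>\<^sub>m f)) \<cdot> (Ident C T \<otimes>\<^sub>m Braid C X X) \<cdot> Assoc C T X X"
    using Ob assms by (simp add: TenM_merge_left)
  also have "\<dots> = (u \<otimes>\<^sub>m (g \<otimes>\<^sub>m f)) \<cdot> Assoc C T X X \<cdot> last_swap T X"
    using Ob by (simp only: Assoc_last_swap)
  also have "\<dots> = Assoc C T' X' X' \<cdot> (u \<otimes>\<^sub>m g \<otimes>\<^sub>m f) \<cdot> last_swap T X"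
    using Comp_reassoc[OF Assoc_natural[OF u g f], of "last_swap T X"] Ob assms by simp
  finally show "Assoc C T' X' X' \<cdot> last_swap T' X' \<cdot> (u \<otimes>\<^sub>m f \<otimes>\<^sub>m g)
      = Assoc C T' X' X' \<cdot> (u \<otimes>\<^sub>m g \<otimes>\<^sub>m f) \<cdot> last_swap T X" .
qed (use assms in auto)

text \<open>The hexagon says that braiding one factor past two, \<open>\<eta>\<close>, is
  \<open>b2 \<cdot> b1\<close> up to associativity. Naturality of \<open>\<eta>\<close> with respect
  to the braiding of those two factors moves a third swap from one side of it to the other.\<close>

lemma last_swap_braid_base:
  assumes X: "X \<in> Ob C"
  defines "b1 \<equiv> Braid C X X \<otimes>\<^sub>m Ident C X" and "b2 \<equiv> last_swap X X"
  shows "b1 \<cdot> b2 \<cdot> b1 = b2 \<cdot> b1 \<cdot> b2"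
proof -
  define \<alpha> where "\<alpha> = Assoc C X X X"
  define \<beta> where "\<beta> = Ident C X \<otimes>\<^sub>m Braid C X X"
  define \<eta> where "\<eta> = Braid C X (X \<otimes>\<^sub>o X)"
  have arr [simp]: "b1 \<in> Hom C (X \<otimes>\<^sub>o X \<otimes>\<^sub>o X) (X \<otimes>\<^sub>o X \<otimes>\<^sub>o X)" "b2 \<in> Hom C (X \<otimes>\<^sub>o X \<otimes>\<^sub>o X) (X \<otimes>\<^sub>o X \<otimes>\<^sub>o X)"
    "\<alpha> \<in> Hom C (X \<otimes>\<^sub>o X \<otimes>\<^sub>o X) (X \<otimes>\<^sub>o (X \<otimes>\<^sub>o X))" "iso_arrow C \<alpha>"
    "\<beta> \<in> Hom C (X \<otimes>\<^sub>o (X \<otimes>\<^sub>o X)) (X \<otimes>\<^sub>o (X \<otimes>\<^sub>o X))" "\<eta> \<in> Hom C (X \<otimes>\<^sub>o (X \<otimes>\<^sub>o X)) (X \<otimes>\<^sub>o X \<otimes>\<^sub>o X)"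
    using X unfolding b1_def b2_def \<alpha>_def \<beta>_def \<eta>_def by simp_all
  note arr' [simp] = arr[unfolded in_Hom]
  have \<alpha>b2: "\<alpha> \<cdot> b2 = \<beta> \<cdot> \<alpha>"
    unfolding \<alpha>_def b2_def \<beta>_def by (rule Assoc_last_swap[OF X X])
  have "\<alpha> \<cdot> \<eta> \<cdot> \<alpha> = \<beta> \<cdot> \<alpha> \<cdot> b1"
    unfolding \<alpha>_def \<eta>_def \<beta>_def b1_def by (rule hexagon[OF X X X])
  also have "\<dots> = \<alpha> \<cdot> b2 \<cdot> b1"
    using Comp_reassoc[OF \<alpha>b2, of b1] by simp
  finally have hex: "\<eta> \<cdot> \<alpha> = b2 \<cdot> b1"
    by (rule iso_mono[rotated]) simp_all
  have nat: "\<eta> \<cdot> \<beta> = b1 \<cdot> \<eta>"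
    unfolding \<eta>_def \<beta>_def b1_def by (rule Braid_natural) (use X in auto)
  have "b1 \<cdot> b2 \<cdot> b1 = b1 \<cdot> \<eta> \<cdot> \<alpha>" by (simp add: hex)
  also have "\<dots> = \<eta> \<cdot> \<beta> \<cdot> \<alpha>" using Comp_reassoc[OF nat, of \<alpha>] by simp
  also have "\<dots> = \<eta> \<cdot> \<alpha> \<cdot> b2" by (simp add: \<alpha>b2)
  also have "\<dots> = b2 \<cdot> b1 \<cdot> b2" using Comp_reassoc[OF hex, of b2] by simp
  finally show ?thesis .
qed

text \<open>
  The Yang--Baxter relation on \<open>((T \<otimes> X) \<otimes> X) \<otimes> X\<close> is transported from \<open>T \<otimes> ((X \<otimes> X) \<otimes> X)\<close>
  along the associativity isomorphism \<open>\<zeta>\<close>.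
\<close>

lemma last_swap_braid:
  assumes T: "T \<in> Ob C" and X: "X \<in> Ob C"
  defines "s \<equiv> last_swap T X \<otimes>\<^sub>m Ident C X" and "t \<equiv> last_swap (T \<otimes>\<^sub>o X) X"
  shows "s \<cdot> t \<cdot> s = t \<cdot> s \<cdot> t"
proof -
  define b1 where "b1 = Braid C X X \<otimes>\<^sub>m Ident C X"
  define b2 where "b2 = last_swap X X"
  define B where "B f = Ident C T \<otimes>\<^sub>m f" for f
  define \<zeta> where "\<zeta> = Assoc C T (X \<otimes>\<^sub>o X) X \<cdot> (Assoc C T X X \<otimes>\<^sub>m Ident C X)"
  let ?S = "T \<otimes>\<^sub>o X \<otimes>\<^sub>o X \<otimes>\<^sub>o X" and ?X3 = "X \<otimes>\<^sub>o X \<otimes>\<^sub>o X"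
  have b: "b1 \<in> Hom C ?X3 ?X3" "b2 \<in> Hom C ?X3 ?X3"
    using X unfolding b1_def b2_def by simp_all
  have st: "s \<in> Hom C ?S ?S" "t \<in> Hom C ?S ?S" using T X unfolding s_def t_def by simp_all
  have Bb: "B b1 \<in> Hom C (T \<otimes>\<^sub>o ?X3) (T \<otimes>\<^sub>o ?X3)" "B b2 \<in> Hom C (T \<otimes>\<^sub>o ?X3) (T \<otimes>\<^sub>o ?X3)"
    using b T unfolding B_def by simp_all
  have \<zeta>: "\<zeta> \<in> Hom C ?S (T \<otimes>\<^sub>o ?X3)" using T X unfolding \<zeta>_def by simp
  have \<zeta>_iso: "iso_arrow C \<zeta>"
    unfolding \<zeta>_def using T X by (intro iso_arrow_Comp iso_TenM iso_Ident) simp_all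
  \<comment> \<open>The inner associativity of \<open>\<zeta>\<close> turns the swap into a plain
    braiding tensored with identities; naturality of the outer one carries this past.\<close>
  have "\<zeta> \<cdot> s = Assoc C T (X \<otimes>\<^sub>o X) X \<cdot> ((Assoc C T X X \<cdot> last_swap T X) \<otimes>\<^sub>m Ident C X)"
    unfolding \<zeta>_def s_def using T X by (simp add: TenM_merge)
  also have "\<dots> = Assoc C T (X \<otimes>\<^sub>o X) X \<cdot> (Ident C T \<otimes>\<^sub>m Braid C X X \<otimes>\<^sub>m Ident C X) \<cdot> (Assoc C T X X \<otimes>\<^sub>m Ident C X)"
    unfolding Assoc_last_swap[OF T X] using T X by (simp add: TenM_merge)
  also have "\<dots> = B b1 \<cdot> \<zeta>"
    using Comp_reassoc[OF Assoc_natural[of "Ident C T" T T "Braid C X X" "X \<otimes>\<^sub>o X" "X \<otimes>\<^sub>o X" "Ident C X" X X],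
        of "Assoc C T X X \<otimes>\<^sub>m Ident C X"] T X
    unfolding \<zeta>_def B_def b1_def by simp
  finally have \<zeta>s: "\<zeta> \<cdot> s = B b1 \<cdot> \<zeta>" .
  \<comment> \<open>The pentagon re-expresses \<open>\<zeta>\<close> by the bracketing on which
    \<open>t\<close> is a plain braiding of the last two factors. The extra isomorphism
    \<open>B (Assoc C X X X)\<close> is cancelled at the end.\<close>
  have pent: "B (Assoc C X X X) \<cdot> \<zeta> = Assoc C T X (X \<otimes>\<^sub>o X) \<cdot> Assoc C (T \<otimes>\<^sub>o X) X X"
    unfolding B_def \<zeta>_def by (rule pentagon[OF T X X X, symmetric])
  have "B (Assoc C X X X) \<cdot> \<zeta> \<cdot> t = Assoc C T X (X \<otimes>\<^sub>o X) \<cdot> Assoc C (T \<otimes>\<^sub>o X) X X \<cdot> t"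
    using Comp_reassoc[OF pent, of t] st(2) T X \<zeta> unfolding B_def by simp
  also have "\<dots> = Assoc C T X (X \<otimes>\<^sub>o X) \<cdot> (Ident C T \<otimes>\<^sub>m Ident C X \<otimes>\<^sub>m Braid C X X) \<cdot> Assoc C (T \<otimes>\<^sub>o X) X X"
    using T X unfolding t_def by (simp add: Assoc_last_swap)
  also have "\<dots> = B (Ident C X \<otimes>\<^sub>m Braid C X X) \<cdot> Assoc C T X (X \<otimes>\<^sub>o X) \<cdot> Assoc C (T \<otimes>\<^sub>o X) X X"
    using Comp_reassoc[OF Assoc_natural[of "Ident C T" T T "Ident C X" X X "Braid C X X" "X \<otimes>\<^sub>o X" "X \<otimes>\<^sub>o X"],
        of "Assoc C (T \<otimes>\<^sub>o X) X X"] T X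
    unfolding B_def by (simp del: TenM_Ident')
  also have "\<dots> = B (Ident C X \<otimes>\<^sub>m Braid C X X) \<cdot> B (Assoc C X X X) \<cdot> \<zeta>"
    unfolding pent ..
  also have "\<dots> = B ((Ident C X \<otimes>\<^sub>m Braid C X X) \<cdot> Assoc C X X X) \<cdot> \<zeta>"
    unfolding B_def using T X \<zeta> by (simp add: TenM_merge_left)
  also have "(Ident C X \<otimes>\<^sub>m Braid C X X) \<cdot> Assoc C X X X = Assoc C X X X \<cdot> b2"
    unfolding b2_def using X by (simp add: Assoc_last_swap)
  also have "B (Assoc C X X X \<cdot> b2) \<cdot> \<zeta> = B (Assoc C X X X) \<cdot> B b2 \<cdot> \<zeta>"
    unfolding B_def using T X b \<zeta> by (simp add: TenM_merge_left)
  finally have \<zeta>t: "\<zeta> \<cdot> t = B b2 \<cdot> \<zeta>"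
    by (rule iso_mono[rotated])
      (use T X \<zeta> st Bb in \<open>auto simp: B_def intro: iso_TenM iso_Ident\<close>)
  have three: "\<zeta> \<cdot> x \<cdot> y \<cdot> z = (B x' \<cdot> B y' \<cdot> B z') \<cdot> \<zeta>"
    if "\<zeta> \<cdot> x = B x' \<cdot> \<zeta>" "\<zeta> \<cdot> y = B y' \<cdot> \<zeta>" "\<zeta> \<cdot> z = B z' \<cdot> \<zeta>"
      "x \<in> Hom C ?S ?S" "y \<in> Hom C ?S ?S" "z \<in> Hom C ?S ?S"
      "B x' \<in> Hom C (T \<otimes>\<^sub>o ?X3) (T \<otimes>\<^sub>o ?X3)" "B y' \<in> Hom C (T \<otimes>\<^sub>o ?X3) (T \<otimes>\<^sub>o ?X3)"
      "B z' \<in> Hom C (T \<otimes>\<^sub>o ?X3) (T \<otimes>\<^sub>o ?X3)" for x y z x' y' z'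
  proof -
    have "\<zeta> \<cdot> x \<cdot> y \<cdot> z = B x' \<cdot> \<zeta> \<cdot> y \<cdot> z" using Comp_reassoc[OF that(1), of "y \<cdot> z"] that(4-7) \<zeta> by simp
    also have "\<zeta> \<cdot> y \<cdot> z = B y' \<cdot> \<zeta> \<cdot> z" using Comp_reassoc[OF that(2), of z] that(4-8) \<zeta> by simp
    also have "\<zeta> \<cdot> z = B z' \<cdot> \<zeta>" by fact
    finally show ?thesis using that(7-9) \<zeta> by simp
  qed
  have B_mult: "B x \<cdot> B y \<cdot> B z = B (x \<cdot> y \<cdot> z)"
    if "x \<in> Hom C ?X3 ?X3" "y \<in> Hom C ?X3 ?X3" "z \<in> Hom C ?X3 ?X3" for x y z
    using that T unfolding B_def by (simp add: TenM_merge)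
  have "\<zeta> \<cdot> s \<cdot> t \<cdot> s = B (b1 \<cdot> b2 \<cdot> b1) \<cdot> \<zeta>"
    using three[OF \<zeta>s \<zeta>t \<zeta>s st(1,2,1) Bb(1,2,1)] B_mult[OF b(1,2,1)] by simp
  also have "b1 \<cdot> b2 \<cdot> b1 = b2 \<cdot> b1 \<cdot> b2"
    unfolding b1_def b2_def by (rule last_swap_braid_base[OF X])
  also have "B (b2 \<cdot> b1 \<cdot> b2) \<cdot> \<zeta> = \<zeta> \<cdot> t \<cdot> s \<cdot> t"
    using three[OF \<zeta>t \<zeta>s \<zeta>t st(2,1,2) Bb(2,1,2)] B_mult[OF b(2,1,2)] by simp
  finally show ?thesis
    by (rule iso_mono[OF \<zeta>_iso]) (use st \<zeta> in auto)
qed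

section \<open>Coxeter relations for the adjacent swaps\<close>

lemma adjacent_swap_last: "adjacent_swap C X (Suc (Suc n)) (Suc n) = last_swap (tensor_power C X n) X"
  by (simp add: last_swap_def)

lemma adjacent_swap_Suc:
  "\<lbrakk>1 \<le> i; i < n\<rbrakk> \<Longrightarrow> adjacent_swap C X (Suc n) i = adjacent_swap C X n i \<otimes>\<^sub>m Ident C X"
  by (cases n) auto

declare adjacent_swap.simps(3) [simp del]

lemma adjacent_swap_Hom:
  assumes "X \<in> Ob C" "1 \<le> i" "i < n"
  shows "adjacent_swap C X n i \<in> Hom C (tensor_power C X n) (tensor_power C X n)"
  using assms(2,3)
proof (induction n)
  case (Suc n)
  then consider "i < n" | m where "n = Suc m" "i = n" by (cases n) force+
  then show ?case
  proof cases
    case 1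
    then show ?thesis using Suc assms(1) by (simp add: adjacent_swap_Suc)
  next
    case 2
    then show ?thesis using assms(1) by (simp add: adjacent_swap_last)
  qed
qed simp

lemma adjacent_swap_simps [simp]:
  assumes "X \<in> Ob C" "1 \<le> i" "i < n"
  shows "adjacent_swap C X n i \<in> Arr C" "Dom C (adjacent_swap C X n i) = tensor_power C X n"
    "Cod C (adjacent_swap C X n i) = tensor_power C X n"
  using adjacent_swap_Hom[OF assms] by simp_all

lemma adjacent_swap_square:
  assumes "X \<in> Ob C" "1 \<le> i" "i < n"
  shows "adjacent_swap C X n i \<cdot> adjacent_swap C X n i = Ident C (tensor_power C X n)"
  using assms(2,3)
proof (induction n)
  case (Suc n)
  then consider "i < n" | m where "n = Suc m" "i = n" by (cases n) force+
  then show ?case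
  proof cases
    case 1
    then show ?thesis using Suc assms(1) by (simp add: adjacent_swap_Suc TenM_merge)
  next
    case 2
    then show ?thesis using assms(1) by (simp add: adjacent_swap_last last_swap_square)
  qed
qed simp

text \<open>When \<open>j\<close> is the last swap, swap \<open>i\<close> acts on the prefix only,
  and \<open>last_swap\<close> is natural in the prefix. All other cases come from a smaller tensor
  power.\<close>

lemma adjacent_swap_far:
  assumes "X \<in> Ob C" "1 \<le> i" "Suc i < j" "j < n"
  shows "adjacent_swap C X n i \<cdot> adjacent_swap C X n j = adjacent_swap C X n j \<cdot> adjacent_swap C X n i"
  using assms(4)
proof (induction n)
  case (Suc n)
  then consider "j < n" | m where "n = Suc m" "j = n"
    using assms(2,3) by (cases n) (auto simp: less_Suc_eq)
  then show ?case
  proof cases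
    case 1
    then show ?thesis using Suc assms(1-3) by (simp add: adjacent_swap_Suc TenM_merge)
  next
    case 2
    let ?T = "tensor_power C X m" and ?s = "adjacent_swap C X m i"
    have "?s \<in> Hom C ?T ?T" using assms 2 by (intro adjacent_swap_Hom) auto
    moreover have "adjacent_swap C X (Suc n) i = ?s \<otimes>\<^sub>m Ident C X \<otimes>\<^sub>m Ident C X"
      using assms 2 by (simp add: adjacent_swap_Suc)
    ultimately show ?thesis
      using last_swap_natural[of ?s ?T ?T "Ident C X" X X "Ident C X"] assms 2
      by (simp add: adjacent_swap_last)
  qed
qed simp

lemma adjacent_swap_braid:
  assumes "X \<in> Ob C" "1 \<le> i" "Suc i < n"
  defines "s \<equiv> adjacent_swap C X n i" and "t \<equiv> adjacent_swap C X n (Suc i)"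
  shows "s \<cdot> t \<cdot> s = t \<cdot> s \<cdot> t"
  unfolding s_def t_def using assms(3)
proof (induction n)
  case (Suc n)
  then consider "Suc i < n" | m where "n = Suc (Suc m)" "Suc i = n"
    using assms(2) by (cases n rule: nat.exhaust; cases "n - 1" rule: nat.exhaust) (auto simp: less_Suc_eq)
  then show ?case
  proof cases
    case 1
    then show ?thesis using Suc assms(1-2) by (simp add: adjacent_swap_Suc TenM_merge)
  next
    case 2
    then show ?thesis
      using last_swap_braid[of "tensor_power C X m" X] assms(1,2)
      by (simp add: adjacent_swap_Suc adjacent_swap_last)
  qed
qed simp

section \<open>From swaps to the action of permutations and of the group algebra\<close>

definition End_monoid :: "'o \<Rightarrow> 'm monoid" where
  "End_monoid X = \<lparr>carrier = Hom C X X, monoid.mult = Comp C, one = Ident C X\<rparr>"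

lemma End_monoid_simps [simp]:
  "carrier (End_monoid X) = Hom C X X" "f \<otimes>\<^bsub>End_monoid X\<^esub> g = f \<cdot> g" "\<one>\<^bsub>End_monoid X\<^esub> = Ident C X"
  by (simp_all add: End_monoid_def)

lemma coxeter_generators_adjacent_swap:
  assumes "X \<in> Ob C"
  shows "coxeter_generators (End_monoid (tensor_power C X n)) (adjacent_swap C X n) n"
proof -
  interpret monoid "End_monoid (tensor_power C X n)"
    by unfold_locales (use assms in auto)
  show ?thesis
    by unfold_locales
      (use assms adjacent_swap_square adjacent_swap_far adjacent_swap_braid in auto)
qed

abbreviation swap_word :: "'o \<Rightarrow> nat \<Rightarrow> nat list \<Rightarrow> 'm" where
  "swap_word X n \<equiv> word_value (End_monoid (tensor_power C X n)) (adjacent_swap C X n)"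

lemma swap_composite_iff:
  "swap_composite C X n p f \<longleftrightarrow> (\<exists>w\<in>lists {1..<n}. p = word_perm w \<and> f = swap_word X n w)"
proof
  assume "swap_composite C X n p f"
  then show "\<exists>w\<in>lists {1..<n}. p = word_perm w \<and> f = swap_word X n w"
  proof induction
    case Id
    then show ?case by (intro bexI[of _ "[]"]) auto
  next
    case (Swap p f i)
    then obtain w where "w \<in> lists {1..<n}" "p = word_perm w" "f = swap_word X n w" by blast
    then show ?case using Swap.hyps by (intro bexI[of _ "i # w"]) auto
  qed
next
  have "swap_composite C X n (word_perm w) (swap_word X n w)" if "w \<in> lists {1..<n}" for w
    using that
  proof (induction w)
    case Nil
    show ?case unfolding word_value_Nil perm_monoid_simps End_monoid_simps by (rule swap_composite.Id)
  next
    case (Cons i w)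
    then show ?case
      unfolding word_value_Cons perm_monoid_simps End_monoid_simps by (intro swap_composite.Swap) auto
  qed
  then show "swap_composite C X n p f" if "\<exists>w\<in>lists {1..<n}. p = word_perm w \<and> f = swap_word X n w"
    using that by blast
qed

text \<open>Coherence enters here: two words for the same permutation have the same composite of
  swaps by \<open>word_value_eqI\<close>, so the definite description in \<open>perm_action\<close>
  has a unique solution.\<close>

lemma perm_action_word:
  assumes "X \<in> Ob C" "w \<in> lists {1..<n}"
  shows "perm_action C X n (word_perm w) = swap_word X n w"
  unfolding perm_action_def
proof (rule the_equality)
  show "swap_composite C X n (word_perm w) (swap_word X n w)"
    using assms(2) by (auto simp only: swap_composite_iff)
  fix f assume "swap_composite C X n (word_perm w) f"
  then show "f = swap_word X n w"
    using word_value_eqI[OF coxeter_generators_adjacent_swap[OF assms(1)], of _ n] assms(2)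
    unfolding swap_composite_iff by metis
qed

lemma perm_action_Hom:
  assumes "X \<in> Ob C" "p permutes {1..n}"
  shows "perm_action C X n p \<in> Hom C (tensor_power C X n) (tensor_power C X n)"
proof -
  interpret coxeter_generators "End_monoid (tensor_power C X n)" "adjacent_swap C X n" n
    by (rule coxeter_generators_adjacent_swap[OF assms(1)])
  obtain w where "w \<in> lists {1..<n}" "word_perm w = p" using ex_word_perm[OF assms(2)] by blast
  then show ?thesis using val_closed[of w] perm_action_word[OF assms(1), of w n] unfolding End_monoid_simps by metis
qed

lemma perm_action_Comp:
  assumes "X \<in> Ob C" "p permutes {1..n}" "q permutes {1..n}"
  shows "perm_action C X n p \<cdot> perm_action C X n q = perm_action C X n (p \<circ> q)"
proof -
  interpret coxeter_generators "End_monoid (tensor_power C X n)" "adjacent_swap C X n" n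
    by (rule coxeter_generators_adjacent_swap[OF assms(1)])
  obtain u where u: "u \<in> lists {1..<n}" "word_perm u = p" using ex_word_perm[OF assms(2)] by blast
  obtain w where w: "w \<in> lists {1..<n}" "word_perm w = q" using ex_word_perm[OF assms(3)] by blast
  have uw: "u @ w \<in> lists {1..<n}" using u w by auto
  have "perm_action C X n p \<cdot> perm_action C X n q = swap_word X n u \<cdot> swap_word X n w"
    using perm_action_word[OF assms(1)] u w by metis
  also have "\<dots> = swap_word X n (u @ w)"
    using val_append[OF u(1) w(1)] by simp
  also have "\<dots> = perm_action C X n (word_perm (u @ w))"
    by (rule perm_action_word[OF assms(1) uw, symmetric])
  finally show ?thesis by (simp add: word_perm_append u w)
qed

text \<open>Equivariance is tested on adjacent swaps, where it can be checked by naturality; along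
  words it extends to all permutations and then to the group algebra.\<close>

definition swap_equivariant :: "nat \<Rightarrow> 'o \<Rightarrow> 'o \<Rightarrow> 'm \<Rightarrow> bool" where
  "swap_equivariant n X X' u \<longleftrightarrow> u \<in> Hom C (tensor_power C X n) (tensor_power C X' n) \<and>
     (\<forall>i. 1 \<le> i \<and> i < n \<longrightarrow> adjacent_swap C X' n i \<cdot> u = u \<cdot> adjacent_swap C X n i)"

lemma perm_action_equivariant:
  assumes X: "X \<in> Ob C" "X' \<in> Ob C" and u: "swap_equivariant n X X' u" and p: "p permutes {1..n}"
  shows "perm_action C X' n p \<cdot> u = u \<cdot> perm_action C X n p"
proof -
  interpret X: coxeter_generators "End_monoid (tensor_power C X n)" "adjacent_swap C X n" n
    by (rule coxeter_generators_adjacent_swap) fact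
  interpret X': coxeter_generators "End_monoid (tensor_power C X' n)" "adjacent_swap C X' n" n
    by (rule coxeter_generators_adjacent_swap) fact
  have uH: "u \<in> Hom C (tensor_power C X n) (tensor_power C X' n)"
    using u by (simp only: swap_equivariant_def)
  have "swap_word X' n w \<cdot> u = u \<cdot> swap_word X n w" if "w \<in> lists {1..<n}" for w
    using that
  proof (induction w)
    case Nil
    then show ?case using uH by simp
  next
    case (Cons i w)
    have i: "1 \<le> i" "i < n" and w: "w \<in> lists {1..<n}" using Cons.hyps by auto
    let ?s = "adjacent_swap C X n i" and ?s' = "adjacent_swap C X' n i"
    have swap: "?s' \<cdot> u = u \<cdot> ?s" using u i by (auto simp only: swap_equivariant_def)
    have vX: "swap_word X n w \<in> Hom C (tensor_power C X n) (tensor_power C X n)"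
      and vX': "swap_word X' n w \<in> Hom C (tensor_power C X' n) (tensor_power C X' n)"
      using X.val_closed[OF w] X'.val_closed[OF w] by simp_all
    have "swap_word X' n (i # w) \<cdot> u = ?s' \<cdot> swap_word X' n w \<cdot> u" using i X uH vX' by simp
    also have "swap_word X' n w \<cdot> u = u \<cdot> swap_word X n w" by (rule Cons.IH)
    also have "?s' \<cdot> u \<cdot> swap_word X n w = u \<cdot> ?s \<cdot> swap_word X n w"
      using Comp_reassoc[OF swap, of "swap_word X n w"] X i uH vX by simp
    finally show ?case by simp
  qed
  then show ?thesis
    using ex_word_perm[OF p] perm_action_word[OF X(1)] perm_action_word[OF X(2)] by metis
qed

lemma algebra_action_hsum:
  "algebra_action C X n a = hsum (tensor_power C X n) (tensor_power C X n)
     (\<lambda>p. Scal C (a p) (perm_action C X n p)) {p. p permutes {1..n}}"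
  by (simp add: algebra_action_def hsum_def)

lemma algebra_action_Hom:
  assumes "X \<in> Ob C"
  shows "algebra_action C X n a \<in> Hom C (tensor_power C X n) (tensor_power C X n)"
  unfolding algebra_action_hsum
proof (rule hsum_closed)
  fix p assume "p \<in> {p. p permutes {1..n}}"
  then show "Scal C (a p) (perm_action C X n p) \<in> Hom C (tensor_power C X n) (tensor_power C X n)"
    using perm_action_Hom[OF assms] Scal_in_Hom by blast
qed (use assms in simp_all)

lemma algebra_action_equivariant:
  assumes X: "X \<in> Ob C" "X' \<in> Ob C" and u: "swap_equivariant n X X' u"
  shows "algebra_action C X' n a \<cdot> u = u \<cdot> algebra_action C X n a"
proof -
  let ?T = "tensor_power C X n" and ?T' = "tensor_power C X' n" and ?P = "{p. p permutes {1..n}}"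
  have uH: "u \<in> Hom C ?T ?T'" using u by (simp only: swap_equivariant_def)
  have H: "Scal C (a p) (perm_action C X n p) \<in> Hom C ?T ?T"
    and H': "Scal C (a p) (perm_action C X' n p) \<in> Hom C ?T' ?T'" if "p \<in> ?P" for p
    using that perm_action_Hom[OF X(1), of p n] perm_action_Hom[OF X(2), of p n] by (auto intro: Scal_in_Hom)
  have "algebra_action C X' n a \<cdot> u = hsum ?T ?T' (\<lambda>p. Scal C (a p) (perm_action C X' n p) \<cdot> u) ?P"
    unfolding algebra_action_hsum using hsum_Comp[of u ?T' ?T' ?P] uH H' X by simp
  also have "\<dots> = hsum ?T ?T' (\<lambda>p. u \<cdot> Scal C (a p) (perm_action C X n p)) ?P"
  proof (rule hsum_cong)
    fix p assume "p \<in> ?P"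
    then have p: "p permutes {1..n}" by simp
    have "Scal C (a p) (perm_action C X' n p) \<cdot> u = Scal C (a p) (perm_action C X' n p \<cdot> u)"
      by (rule Comp_Scal_left[OF uH perm_action_Hom[OF X(2) p]])
    also have "\<dots> = Scal C (a p) (u \<cdot> perm_action C X n p)"
      by (simp only: perm_action_equivariant[OF X u p])
    also have "\<dots> = u \<cdot> Scal C (a p) (perm_action C X n p)"
      by (rule Comp_Scal_right[OF perm_action_Hom[OF X(1) p] uH, symmetric])
    finally show "Scal C (a p) (perm_action C X' n p) \<cdot> u = u \<cdot> Scal C (a p) (perm_action C X n p)" .
    show "u \<cdot> Scal C (a p) (perm_action C X n p) \<in> Hom C ?T ?T'"
      by (rule Comp_in_Hom[OF H uH]) fact
  qed (use X in simp_all)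
  also have "\<dots> = u \<cdot> algebra_action C X n a"
    unfolding algebra_action_hsum using Comp_hsum[of u ?T ?T ?P] uH H X by simp
  finally show ?thesis .
qed

lemma algebra_action_mult:
  assumes X: "X \<in> Ob C"
  shows "algebra_action C X n a \<cdot> algebra_action C X n b
    = algebra_action C X n (a \<otimes>\<^bsub>sym_algebra n\<^esub> b)"
proof -
  let ?T = "tensor_power C X n" and ?P = "{p. p permutes {1..n}}" and ?A = "perm_action C X n"
  have T: "?T \<in> Ob C" using X by simp
  have fin: "finite ?P" by (rule finite_permutations) simp
  have A: "?A p \<in> Arr C" "Dom C (?A p) = ?T" "Cod C (?A p) = ?T" if "p permutes {1..n}" for p
    using perm_action_Hom[OF X that] by simp_all
  \<comment> \<open>The product in \<open>sym_algebra\<close> runs over pairs with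
    \<open>q \<circ> r = p\<close>; solving for \<open>r\<close> leaves a sum over
    \<open>q\<close>.\<close>
  have coeff: "(a \<otimes>\<^bsub>sym_algebra n\<^esub> b) p = (\<Sum>q\<in>?P. a q * b (inv_into UNIV q \<circ> p))" if p: "p permutes {1..n}" for p
  proof -
    have "(a \<otimes>\<^bsub>sym_algebra n\<^esub> b) p
        = (\<Sum>(q, r)\<in>{(q, r). q permutes {1..n} \<and> r permutes {1..n} \<and> q \<circ> r = p}. a q * b r)"
      by (simp add: sym_algebra_def)
    also have "\<dots> = (\<Sum>q\<in>?P. a q * b (inv_into UNIV q \<circ> p))"
      by (rule sum.reindex_bij_witness[of _ "\<lambda>q. (q, inv_into UNIV q \<circ> p)" fst])
        (use p in \<open>auto simp: comp_assoc[symmetric] permutes_inv_o intro: permutes_compose permutes_inv\<close>)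
    finally show ?thesis .
  qed
  have "algebra_action C X n a \<cdot> algebra_action C X n b
      = hsum ?T ?T (\<lambda>q. Scal C (a q) (?A q) \<cdot> algebra_action C X n b) ?P"
    unfolding algebra_action_hsum[of _ _ a]
    using hsum_Comp[of "algebra_action C X n b" ?T ?T ?P "\<lambda>q. Scal C (a q) (?A q)"]
      algebra_action_Hom[OF X, of n b] T A by simp
  also have "\<dots> = hsum ?T ?T (\<lambda>q. hsum ?T ?T (\<lambda>p. Scal C (a q * b (inv_into UNIV q \<circ> p)) (?A p)) ?P) ?P"
  proof (rule hsum_cong)
    fix q assume "q \<in> ?P"
    then have q: "q permutes {1..n}" by simp
    have "Scal C (a q) (?A q) \<cdot> algebra_action C X n b
        = hsum ?T ?T (\<lambda>r. Scal C (a q) (?A q) \<cdot> Scal C (b r) (?A r)) ?P"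
      unfolding algebra_action_hsum
      using Comp_hsum[of "Scal C (a q) (?A q)" ?T ?T ?P "\<lambda>r. Scal C (b r) (?A r)"] T A q by simp
    \<comment> \<open>The inverse that cancels is inserted on purpose: the summand becomes a
      function of \<open>q \<circ> r\<close>, ready to be reindexed by left multiplication with
      \<open>q\<close>.\<close>
    also have "\<dots> = hsum ?T ?T (\<lambda>r. Scal C (a q * b (inv_into UNIV q \<circ> (q \<circ> r))) (?A (q \<circ> r))) ?P"
    proof (rule hsum_cong)
      fix r assume "r \<in> ?P"
      then have r: "r permutes {1..n}" by simp
      have "Scal C (a q) (?A q) \<cdot> Scal C (b r) (?A r) = Scal C (a q) (?A q \<cdot> Scal C (b r) (?A r))"
        by (rule Comp_Scal_left) (use A[OF q] A[OF r] in auto)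
      also have "?A q \<cdot> Scal C (b r) (?A r) = Scal C (b r) (?A q \<cdot> ?A r)"
        by (rule Comp_Scal_right) (use A[OF q] A[OF r] in auto)
      also have "Scal C (a q) \<dots> = Scal C (a q * b r) (?A q \<cdot> ?A r)"
        by (rule Scal_Scal) (use A[OF q] A[OF r] in auto)
      also have "inv_into UNIV q \<circ> (q \<circ> r) = r"
        using permutes_inv_o(2)[OF q] by (simp add: comp_assoc[symmetric])
      ultimately show "Scal C (a q) (?A q) \<cdot> Scal C (b r) (?A r)
          = Scal C (a q * b (inv_into UNIV q \<circ> (q \<circ> r))) (?A (q \<circ> r))"
        by (simp only: perm_action_Comp[OF X q r])
      show "Scal C (a q * b (inv_into UNIV q \<circ> (q \<circ> r))) (?A (q \<circ> r)) \<in> Hom C ?T ?T"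
        using A[OF permutes_compose[OF r q]] by simp
    qed (use T in simp_all)
    also have "\<dots> = hsum ?T ?T (\<lambda>p. Scal C (a q * b (inv_into UNIV q \<circ> p)) (?A p)) ?P"
    proof (rule hsum_reindex[where \<sigma> = "(\<circ>) q"])
      show "bij_betw ((\<circ>) q) ?P ?P"
        by (rule bij_betw_byWitness[of _ "(\<circ>) (inv_into UNIV q)"])
          (use q in \<open>auto simp: comp_assoc[symmetric] permutes_inv_o intro: permutes_compose permutes_inv\<close>)
    qed (use T A in auto)
    finally show "Scal C (a q) (?A q) \<cdot> algebra_action C X n b
        = hsum ?T ?T (\<lambda>p. Scal C (a q * b (inv_into UNIV q \<circ> p)) (?A p)) ?P" .
    show "hsum ?T ?T (\<lambda>p. Scal C (a q * b (inv_into UNIV q \<circ> p)) (?A p)) ?P \<in> Hom C ?T ?T"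
      by (rule hsum_closed) (use T A in auto)
  qed (use T in simp_all)
  also have "\<dots> = hsum ?T ?T (\<lambda>p. hsum ?T ?T (\<lambda>q. Scal C (a q * b (inv_into UNIV q \<circ> p)) (?A p)) ?P) ?P"
    by (rule hsum_swap) (use T fin A in auto)
  also have "\<dots> = hsum ?T ?T (\<lambda>p. Scal C ((a \<otimes>\<^bsub>sym_algebra n\<^esub> b) p) (?A p)) ?P"
  proof (rule hsum_cong)
    fix p assume "p \<in> ?P"
    then have p: "p permutes {1..n}" by simp
    show "hsum ?T ?T (\<lambda>q. Scal C (a q * b (inv_into UNIV q \<circ> p)) (?A p)) ?P
        = Scal C ((a \<otimes>\<^bsub>sym_algebra n\<^esub> b) p) (?A p)"
      using hsum_Scal[of "?A p" ?P "\<lambda>q. a q * b (inv_into UNIV q \<circ> p)"] A[OF p] fin coeff[OF p] by simp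
  qed (use T A in auto)
  finally show ?thesis unfolding algebra_action_hsum .
qed

end

section \<open>Mixed tensor products\<close>

context linear_tensor_category
begin

text \<open>Bracketed to the left from the unit like \<open>tensor_power\<close>, to which it
  specialises for constant families, and numbered from 1 to match permutations of
  \<open>{1..n}\<close>.\<close>

primrec tensor_obj :: "(nat \<Rightarrow> 'o) \<Rightarrow> nat \<Rightarrow> 'o" where
  "tensor_obj c 0 = Unit C"
| "tensor_obj c (Suc n) = tensor_obj c n \<otimes>\<^sub>o c (Suc n)"

primrec tensor_arr :: "(nat \<Rightarrow> 'm) \<Rightarrow> nat \<Rightarrow> 'm" where
  "tensor_arr a 0 = Ident C (Unit C)"
| "tensor_arr a (Suc n) = tensor_arr a n \<otimes>\<^sub>m a (Suc n)"

lemma tensor_obj_const [simp]: "tensor_obj (\<lambda>_. X) n = tensor_power C X n"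
  by (induction n) auto

lemma tensor_obj_cong: "(\<And>i. i \<in> {1..n} \<Longrightarrow> c i = d i) \<Longrightarrow> tensor_obj c n = tensor_obj d n"
  by (induction n) auto

lemma tensor_arr_cong: "(\<And>i. i \<in> {1..n} \<Longrightarrow> a i = b i) \<Longrightarrow> tensor_arr a n = tensor_arr b n"
  by (induction n) auto

lemma tensor_obj_Ob [simp]: "(\<And>i. i \<in> {1..n} \<Longrightarrow> c i \<in> Ob C) \<Longrightarrow> tensor_obj c n \<in> Ob C"
  by (induction n) auto

lemma tensor_arr_Hom:
  "(\<And>i. i \<in> {1..n} \<Longrightarrow> a i \<in> Hom C (c i) (d i)) \<Longrightarrow> tensor_arr a n \<in> Hom C (tensor_obj c n) (tensor_obj d n)"
proof (induction n)
  case (Suc n)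
  have "a (Suc n) \<in> Hom C (c (Suc n)) (d (Suc n))" by (rule Suc.prems) simp
  moreover have "tensor_arr a n \<in> Hom C (tensor_obj c n) (tensor_obj d n)"
    by (rule Suc.IH, rule Suc.prems) simp
  ultimately show ?case by simp
qed simp

lemma tensor_arr_Comp:
  assumes "\<And>i. i \<in> {1..n} \<Longrightarrow> a i \<in> Hom C (c i) (d i)" "\<And>i. i \<in> {1..n} \<Longrightarrow> b i \<in> Hom C (d i) (e i)"
  shows "tensor_arr b n \<cdot> tensor_arr a n = tensor_arr (\<lambda>i. b i \<cdot> a i) n"
  using assms
proof (induction n)
  case (Suc n)
  have "a (Suc n) \<in> Hom C (c (Suc n)) (d (Suc n))" "b (Suc n) \<in> Hom C (d (Suc n)) (e (Suc n))"
    by (rule Suc.prems, simp)+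
  moreover have "tensor_arr a n \<in> Hom C (tensor_obj c n) (tensor_obj d n)"
    "tensor_arr b n \<in> Hom C (tensor_obj d n) (tensor_obj e n)"
    by (rule tensor_arr_Hom, rule Suc.prems, simp)+
  moreover have "tensor_arr b n \<cdot> tensor_arr a n = tensor_arr (\<lambda>i. b i \<cdot> a i) n"
    by (rule Suc.IH; rule Suc.prems; simp)
  ultimately show ?case by (simp add: TenM_merge)
qed simp

lemma tensor_arr_Ident:
  assumes "\<And>i. i \<in> {1..n} \<Longrightarrow> a i = Ident C (c i)" "\<And>i. i \<in> {1..n} \<Longrightarrow> c i \<in> Ob C"
  shows "tensor_arr a n = Ident C (tensor_obj c n)"
  using assms
proof (induction n)
  case (Suc n)
  have "tensor_obj c n \<in> Ob C" by (rule tensor_obj_Ob, rule Suc.prems) simp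
  then show ?case using Suc by simp
qed simp

text \<open>A zero arrow is 0 times itself, and scalars can be pulled out of a tensor
  product.\<close>

lemma Zero_TenM:
  assumes "X \<in> Ob C" "Y \<in> Ob C" "g \<in> Hom C X' Y'"
  shows "Zero C X Y \<otimes>\<^sub>m g = Zero C (X \<otimes>\<^sub>o X') (Y \<otimes>\<^sub>o Y')" "g \<otimes>\<^sub>m Zero C X Y = Zero C (X' \<otimes>\<^sub>o X) (Y' \<otimes>\<^sub>o Y)"
proof -
  have z: "Scal C 0 (Zero C X Y) = Zero C X Y" using assms by simp
  have Ob: "X' \<in> Ob C" "Y' \<in> Ob C" using assms(3) by auto
  have "Zero C X Y \<otimes>\<^sub>m g = Scal C 0 (Zero C X Y \<otimes>\<^sub>m g)"
    using TenM_Scal_left[of "Zero C X Y" g 0] assms by (simp only: z in_Hom Zero_simps)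
  then show "Zero C X Y \<otimes>\<^sub>m g = Zero C (X \<otimes>\<^sub>o X') (Y \<otimes>\<^sub>o Y')"
    using Scal_0[of "Zero C X Y \<otimes>\<^sub>m g"] assms Ob by simp
  have "g \<otimes>\<^sub>m Zero C X Y = Scal C 0 (g \<otimes>\<^sub>m Zero C X Y)"
    using TenM_Scal_right[of g "Zero C X Y" 0] assms by (simp only: z in_Hom Zero_simps)
  then show "g \<otimes>\<^sub>m Zero C X Y = Zero C (X' \<otimes>\<^sub>o X) (Y' \<otimes>\<^sub>o Y)"
    using Scal_0[of "g \<otimes>\<^sub>m Zero C X Y"] assms Ob by simp
qed

lemma tensor_arr_Zero:
  assumes "\<And>i. i \<in> {1..n} \<Longrightarrow> a i \<in> Hom C (c i) (d i)" "j \<in> {1..n}" "a j = Zero C (c j) (d j)"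
  shows "tensor_arr a n = Zero C (tensor_obj c n) (tensor_obj d n)"
  using assms(1,2)
proof (induction n)
  case (Suc n)
  have a: "a (Suc n) \<in> Hom C (c (Suc n)) (d (Suc n))" by (rule Suc.prems) simp
  then have Ob: "c (Suc n) \<in> Ob C" "d (Suc n) \<in> Ob C" by (rule Hom_Ob)+
  have an: "tensor_arr a n \<in> Hom C (tensor_obj c n) (tensor_obj d n)"
    by (rule tensor_arr_Hom, rule Suc.prems) simp
  then have Obn: "tensor_obj c n \<in> Ob C" "tensor_obj d n \<in> Ob C" by (rule Hom_Ob)+
  show ?case
  proof (cases "j = Suc n")
    case True
    then show ?thesis using Zero_TenM(2)[OF Ob an] assms(3) by simp
  next
    case False
    then have "tensor_arr a n = Zero C (tensor_obj c n) (tensor_obj d n)"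
      using Suc.prems by (intro Suc.IH) auto
    then show ?thesis using Zero_TenM(1)[OF Obn a] by simp
  qed
qed simp

text \<open>For the last two positions this is \<open>last_swap_natural\<close>; earlier swaps leave
  the last factor alone. The arrows may vary with the position, which is needed for the individual
  summands of \<open>graded_arrow\<close>.\<close>

lemma adjacent_swap_tensor_arr:
  assumes "\<And>j. j \<in> {1..n} \<Longrightarrow> a j \<in> Hom C X X'" "1 \<le> i" "i < n"
  shows "adjacent_swap C X' n i \<cdot> tensor_arr a n
    = tensor_arr (\<lambda>j. a (adjacent i j)) n \<cdot> adjacent_swap C X n i"
  using assms
proof (induction n)
  case (Suc n)
  have arr: "tensor_arr a' m \<in> Hom C (tensor_power C X m) (tensor_power C X' m)"
    if "\<And>j. j \<in> {1..m} \<Longrightarrow> a' j \<in> Hom C X X'" for a' m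
    using tensor_arr_Hom[of m a' "\<lambda>_. X" "\<lambda>_. X'"] that by simp
  have a: "a (Suc n) \<in> Hom C X X'" by (rule Suc.prems) simp
  then have Ob: "X \<in> Ob C" "X' \<in> Ob C" by auto
  consider "i < n" | m where "n = Suc m" "i = n"
    using Suc.prems(2,3) by (cases n) (auto simp: less_Suc_eq)
  then show ?case
  proof cases
    case 1
    have an: "tensor_arr a n \<in> Hom C (tensor_power C X n) (tensor_power C X' n)"
      by (rule arr, rule Suc.prems) simp
    have an': "tensor_arr (\<lambda>j. a (adjacent i j)) n \<in> Hom C (tensor_power C X n) (tensor_power C X' n)"
      by (rule arr, rule Suc.prems) (use 1 Suc.prems(2) in \<open>auto simp: transpose_def\<close>)
    have IH: "adjacent_swap C X' n i \<cdot> tensor_arr a n = tensor_arr (\<lambda>j. a (adjacent i j)) n \<cdot> adjacent_swap C X n i"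
      by (rule Suc.IH) (use Suc.prems 1 in auto)
    have adj: "adjacent i (Suc n) = Suc n" using 1 by (simp add: transpose_def)
    show ?thesis
      using 1 Suc.prems(2) Ob a an an' IH by (simp add: adjacent_swap_Suc TenM_merge adj)
  next
    case 2
    have am: "tensor_arr a m \<in> Hom C (tensor_power C X m) (tensor_power C X' m)"
      by (rule arr, rule Suc.prems) (use 2 in simp)
    have a': "a n \<in> Hom C X X'" by (rule Suc.prems) (use 2 in simp)
    have eq: "tensor_arr (\<lambda>j. a (adjacent i j)) m = tensor_arr a m"
      using 2 by (intro tensor_arr_cong) (auto simp: transpose_def)
    have adj: "adjacent i n = Suc n" "adjacent i (Suc n) = n" using 2 by simp_all
    show ?thesis
      using last_swap_natural[OF am a' a] adj 2 eq by (simp add: adjacent_swap_last)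
  qed
qed simp

lemma tensor_arr_const_equivariant:
  assumes "a \<in> Hom C X X'"
  shows "swap_equivariant n X X' (tensor_arr (\<lambda>_. a) n)"
  unfolding swap_equivariant_def
proof (intro conjI allI impI)
  show "tensor_arr (\<lambda>_. a) n \<in> Hom C (tensor_power C X n) (tensor_power C X' n)"
    using tensor_arr_Hom[of n "\<lambda>_. a" "\<lambda>_. X" "\<lambda>_. X'"] assms by simp
  fix i assume "1 \<le> i \<and> i < n"
  then show "adjacent_swap C X' n i \<cdot> tensor_arr (\<lambda>_. a) n = tensor_arr (\<lambda>_. a) n \<cdot> adjacent_swap C X n i"
    using adjacent_swap_tensor_arr[of n "\<lambda>_. a" X X' i] assms by blast
qed

subsection \<open>Graded components of tensor powers\<close>

text \<open>
  The coefficient of \<open>t^k\<close> in the \<open>n\<close>th tensor power of \<open>a + t b\<close>.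
\<close>

definition graded_arrow :: "nat \<Rightarrow> nat \<Rightarrow> 'm \<Rightarrow> 'm \<Rightarrow> 'm" where
  "graded_arrow n k a b = hsum (tensor_power C (Dom C a) n) (tensor_power C (Cod C a) n)
     (\<lambda>S. tensor_arr (\<lambda>i. if i \<in> S then b else a) n) {S. S \<subseteq> {1..n} \<and> card S = k}"

lemma graded_arrow_eq:
  "a \<in> Hom C X X' \<Longrightarrow> graded_arrow n k a b = hsum (tensor_power C X n) (tensor_power C X' n)
     (\<lambda>S. tensor_arr (\<lambda>i. if i \<in> S then b else a) n) {S. S \<subseteq> {1..n} \<and> card S = k}"
  by (simp add: graded_arrow_def)

lemma tensor_arr_select_Hom:
  assumes "a \<in> Hom C X X'" "b \<in> Hom C X X'"
  shows "tensor_arr (\<lambda>i. if i \<in> S then b else a) n \<in> Hom C (tensor_power C X n) (tensor_power C X' n)"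
  using tensor_arr_Hom[of n "\<lambda>i. if i \<in> S then b else a" "\<lambda>_. X" "\<lambda>_. X'"] assms by simp

lemma graded_arrow_Hom:
  assumes "a \<in> Hom C X X'" "b \<in> Hom C X X'"
  shows "graded_arrow n k a b \<in> Hom C (tensor_power C X n) (tensor_power C X' n)"
proof -
  have "X \<in> Ob C" "X' \<in> Ob C" using assms by auto
  then show ?thesis
    unfolding graded_arrow_eq[OF assms(1)] by (intro hsum_closed tensor_arr_select_Hom assms) simp_all
qed

lemma graded_arrow_0:
  assumes "a \<in> Hom C X X'" "b \<in> Hom C X X'"
  shows "graded_arrow n 0 a b = tensor_arr (\<lambda>_. a) n"
proof -
  have Ob: "X \<in> Ob C" "X' \<in> Ob C" using assms by auto
  have "{S. S \<subseteq> {1..n} \<and> card S = 0} = {{}}"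
    by (auto dest: finite_subset)
  then have "graded_arrow n 0 a b = hsum (tensor_power C X n) (tensor_power C X' n)
     (\<lambda>S. tensor_arr (\<lambda>i. if i \<in> S then b else a) n) {{}}"
    using graded_arrow_eq[OF assms(1)] by simp
  also have "\<dots> = tensor_arr (\<lambda>i. if i \<in> {} then b else a) n"
    by (rule hsum_single) (use Ob tensor_arr_select_Hom[OF assms, of "{}"] in auto)
  finally show ?thesis by simp
qed

lemma graded_arrow_above:
  assumes "a \<in> Hom C X X'" "n < k"
  shows "graded_arrow n k a b = Zero C (tensor_power C X n) (tensor_power C X' n)"
proof -
  have Ob: "X \<in> Ob C" "X' \<in> Ob C" using assms by auto
  have "card S \<noteq> k" if "S \<subseteq> {1..n}" for S
    using card_mono[OF _ that] assms(2) by simp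
  then have empty: "{S. S \<subseteq> {1..n} \<and> card S = k} = {}" by blast
  show ?thesis unfolding graded_arrow_eq[OF assms(1)] empty using Ob by simp
qed

text \<open>A single summand is not equivariant: the swap sends the summand of \<open>S\<close> to
  that of its image. The sum over all \<open>S\<close> of a fixed size is merely reindexed.\<close>

lemma graded_arrow_equivariant:
  assumes "a \<in> Hom C X X'" "b \<in> Hom C X X'"
  shows "swap_equivariant n X X' (graded_arrow n k a b)"
  unfolding swap_equivariant_def
proof (intro conjI allI impI graded_arrow_Hom assms)
  fix i assume i: "1 \<le> i \<and> i < n"
  let ?T = "tensor_power C X n" and ?T' = "tensor_power C X' n"
  let ?s = "adjacent_swap C X n i" and ?s' = "adjacent_swap C X' n i"
  let ?L = "{S. S \<subseteq> {1..n} \<and> card S = k}" and ?a = "\<lambda>S. tensor_arr (\<lambda>i. if i \<in> S then b else a) n"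
  have Ob: "X \<in> Ob C" "X' \<in> Ob C" using assms by auto
  have aH: "?a S \<in> Hom C ?T ?T'" for S by (rule tensor_arr_select_Hom[OF assms])
  have s: "?s \<in> Hom C ?T ?T" "?s' \<in> Hom C ?T' ?T'" using Ob i by (auto intro: adjacent_swap_Hom)
  have perm: "adjacent i permutes {1..n}" using i by (intro permutes_swap_id) auto
  have "?s' \<cdot> graded_arrow n k a b = hsum ?T ?T' (\<lambda>S. ?s' \<cdot> ?a S) ?L"
    unfolding graded_arrow_eq[OF assms(1)] using Comp_hsum[of ?s' ?T' ?T ?L ?a] s aH Ob by simp
  also have "\<dots> = hsum ?T ?T' (\<lambda>S. ?a (adjacent i ` S) \<cdot> ?s) ?L"
  proof (rule hsum_cong)
    fix S
    have "adjacent i j \<in> S \<longleftrightarrow> j \<in> adjacent i ` S" for j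
      by (metis image_iff transpose_involutory)
    then show "?s' \<cdot> ?a S = ?a (adjacent i ` S) \<cdot> ?s"
      using adjacent_swap_tensor_arr[of n "\<lambda>j. if j \<in> S then b else a" X X' i] assms i by simp
    show "?a (adjacent i ` S) \<cdot> ?s \<in> Hom C ?T ?T'" by (rule Comp_in_Hom[OF s(1) aH])
  qed (use Ob in simp_all)
  also have "\<dots> = hsum ?T ?T' (\<lambda>S. ?a S \<cdot> ?s) ?L"
  proof (rule hsum_reindex)
    have img: "adjacent i ` S \<in> ?L" if "S \<in> ?L" for S
    proof -
      have "adjacent i ` S \<subseteq> adjacent i ` {1..n}" using that by blast
      then show ?thesis
        using that permutes_image[OF perm] card_image[OF inj_on_subset[OF permutes_inj[OF perm]], of S] by auto
    qed
    show "bij_betw ((`) (adjacent i)) ?L ?L"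
      by (rule bij_betw_byWitness[of _ "(`) (adjacent i)"]) (use img in \<open>auto simp: image_image\<close>)
    show "?a S \<cdot> ?s \<in> Hom C ?T ?T'" for S by (rule Comp_in_Hom[OF s(1) aH])
  qed (use Ob in simp_all)
  also have "\<dots> = graded_arrow n k a b \<cdot> ?s"
    unfolding graded_arrow_eq[OF assms(1)] using hsum_Comp[of ?s ?T ?T' ?L ?a] s aH Ob by simp
  finally show "?s' \<cdot> graded_arrow n k a b = graded_arrow n k a b \<cdot> ?s" .
qed

lemma tensor_arr_const_Hom:
  "a \<in> Hom C X X' \<Longrightarrow> tensor_arr (\<lambda>_. a) n \<in> Hom C (tensor_power C X n) (tensor_power C X' n)"
  using tensor_arr_select_Hom[of a X X' a "{}"] by simp

lemma tensor_arr_select_Comp: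
  assumes "a \<in> Hom C X X'" "b \<in> Hom C X X'" "c \<in> Hom C X' X''" "d \<in> Hom C X' X''"
  shows "tensor_arr (\<lambda>i. if i \<in> S then d else c) n \<cdot> tensor_arr (\<lambda>i. if i \<in> S then b else a) n
    = tensor_arr (\<lambda>i. if i \<in> S then d \<cdot> b else c \<cdot> a) n"
proof -
  have "tensor_arr (\<lambda>i. if i \<in> S then d else c) n \<cdot> tensor_arr (\<lambda>i. if i \<in> S then b else a) n
    = tensor_arr (\<lambda>i. (if i \<in> S then d else c) \<cdot> (if i \<in> S then b else a)) n"
    by (rule tensor_arr_Comp[of _ _ "\<lambda>_. X" "\<lambda>_. X'" _ "\<lambda>_. X''"]) (use assms in auto)
  also have "\<dots> = tensor_arr (\<lambda>i. if i \<in> S then d \<cdot> b else c \<cdot> a) n"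
    by (rule tensor_arr_cong) simp
  finally show ?thesis .
qed

lemma tensor_power_graded_Comp:
  assumes "a \<in> Hom C X X'" "b \<in> Hom C X X'" "c \<in> Hom C X' X''"
  shows "tensor_arr (\<lambda>_. c) n \<cdot> graded_arrow n k a b = graded_arrow n k (c \<cdot> a) (c \<cdot> b)"
proof -
  have Ob: "X \<in> Ob C" "X' \<in> Ob C" "X'' \<in> Ob C" using assms by auto
  have ca: "c \<cdot> a \<in> Hom C X X''" "c \<cdot> b \<in> Hom C X X''" using assms by simp_all
  note aH = tensor_arr_select_Hom[OF assms(1,2)]
  have eq: "tensor_arr (\<lambda>_. c) n \<cdot> tensor_arr (\<lambda>i. if i \<in> S then b else a) n
      = tensor_arr (\<lambda>i. if i \<in> S then c \<cdot> b else c \<cdot> a) n" for S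
    using tensor_arr_select_Comp[OF assms assms(3), of S n] by simp
  have "tensor_arr (\<lambda>_. c) n \<cdot> graded_arrow n k a b
      = hsum (tensor_power C X n) (Cod C (tensor_arr (\<lambda>_. c) n))
          (\<lambda>S. tensor_arr (\<lambda>_. c) n \<cdot> tensor_arr (\<lambda>i. if i \<in> S then b else a) n) {S. S \<subseteq> {1..n} \<and> card S = k}"
    unfolding graded_arrow_eq[OF assms(1)]
    by (rule Comp_hsum) (use tensor_arr_const_Hom[OF assms(3), of n] aH Ob in auto)
  then show ?thesis
    using tensor_arr_const_Hom[OF assms(3), of n] by (simp add: eq graded_arrow_eq[OF ca(1)])
qed

lemma graded_tensor_power_Comp:
  assumes "a \<in> Hom C X' X''" "b \<in> Hom C X' X''" "c \<in> Hom C X X'"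
  shows "graded_arrow n k a b \<cdot> tensor_arr (\<lambda>_. c) n = graded_arrow n k (a \<cdot> c) (b \<cdot> c)"
proof -
  have Ob: "X \<in> Ob C" "X' \<in> Ob C" "X'' \<in> Ob C" using assms by auto
  have ac: "a \<cdot> c \<in> Hom C X X''" using assms by simp
  note aH = tensor_arr_select_Hom[OF assms(1,2)]
  have eq: "tensor_arr (\<lambda>i. if i \<in> S then b else a) n \<cdot> tensor_arr (\<lambda>_. c) n
      = tensor_arr (\<lambda>i. if i \<in> S then b \<cdot> c else a \<cdot> c) n" for S
    using tensor_arr_select_Comp[OF assms(3,3,1,2), of S n] by simp
  have "graded_arrow n k a b \<cdot> tensor_arr (\<lambda>_. c) n
      = hsum (Dom C (tensor_arr (\<lambda>_. c) n)) (tensor_power C X'' n)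
          (\<lambda>S. tensor_arr (\<lambda>i. if i \<in> S then b else a) n \<cdot> tensor_arr (\<lambda>_. c) n) {S. S \<subseteq> {1..n} \<and> card S = k}"
    unfolding graded_arrow_eq[OF assms(1)]
    by (rule hsum_Comp) (use tensor_arr_const_Hom[OF assms(3), of n] aH Ob in auto)
  then show ?thesis
    using tensor_arr_const_Hom[OF assms(3), of n] by (simp add: eq graded_arrow_eq[OF ac])
qed

text \<open>
  Since \<open>d a = 0\<close>, only index sets \<open>S' \<supseteq> S\<close> contribute, and these have at least as many elements.
\<close>

lemma tensor_arr_graded_Comp:
  assumes "a \<in> Hom C X X'" "b \<in> Hom C X X'" "c \<in> Hom C X' X''" "d \<in> Hom C X' X''"
    and da: "d \<cdot> a = Zero C X X''" and S: "S \<subseteq> {1..n}" "k \<le> card S"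
  shows "tensor_arr (\<lambda>i. if i \<in> S then d else c) n \<cdot> graded_arrow n k a b
    = (if card S = k then tensor_arr (\<lambda>i. if i \<in> S then d \<cdot> b else c \<cdot> a) n
       else Zero C (tensor_power C X n) (tensor_power C X'' n))"
proof -
  let ?T = "tensor_power C X n" and ?T' = "tensor_power C X' n" and ?T'' = "tensor_power C X'' n"
  let ?L = "{S. S \<subseteq> {1..n} \<and> card S = k}" and ?a = "\<lambda>S. tensor_arr (\<lambda>i. if i \<in> S then b else a) n"
  let ?c = "tensor_arr (\<lambda>i. if i \<in> S then d else c) n"
  have Ob: "X \<in> Ob C" "X' \<in> Ob C" "X'' \<in> Ob C" using assms by auto
  have cH: "?c \<in> Hom C ?T' ?T''" by (rule tensor_arr_select_Hom[OF assms(3,4)])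
  have aH: "?a S' \<in> Hom C ?T ?T'" for S' by (rule tensor_arr_select_Hom[OF assms(1,2)])
  have zero: "?c \<cdot> ?a S' = Zero C ?T ?T''" if S': "S' \<in> ?L" "S' \<noteq> S" for S'
  proof -
    have "finite S'" using S' finite_subset[of S' "{1..n}"] by auto
    then have "\<not> S \<subseteq> S'" using S' S card_seteq[of S' S] by auto
    then obtain j where j: "j \<in> S" "j \<notin> S'" by blast
    have "?c \<cdot> ?a S' = tensor_arr (\<lambda>i. (if i \<in> S then d else c) \<cdot> (if i \<in> S' then b else a)) n"
      by (rule tensor_arr_Comp[of _ _ "\<lambda>_. X" "\<lambda>_. X'" _ "\<lambda>_. X''"]) (use assms(1-4) in auto)
    also have "\<dots> = Zero C (tensor_obj (\<lambda>_. X) n) (tensor_obj (\<lambda>_. X'') n)"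
      by (rule tensor_arr_Zero[where j = j]) (use assms(1-4) S(1) da j in auto)
    finally show ?thesis by simp
  qed
  have sum: "?c \<cdot> graded_arrow n k a b = hsum ?T ?T'' (\<lambda>S'. ?c \<cdot> ?a S') ?L"
    unfolding graded_arrow_eq[OF assms(1)] using Comp_hsum[of ?c ?T' ?T ?L ?a] cH aH Ob by simp
  show ?thesis
  proof (cases "card S = k")
    case True
    have "finite ?L" by simp
    moreover have "?c \<cdot> ?a S \<in> Hom C ?T ?T''" by (rule Comp_in_Hom[OF aH cH])
    ultimately have "?c \<cdot> graded_arrow n k a b = ?c \<cdot> ?a S"
      unfolding sum using True S Ob zero by (intro hsum_single) simp_all
    then show ?thesis using True tensor_arr_select_Comp[OF assms(1-4), of S n] by simp
  next
    case False
    have "?c \<cdot> graded_arrow n k a b = Zero C ?T ?T''"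
      unfolding sum using Ob False by (intro hsum_all_Zero zero) auto
    then show ?thesis using False by simp
  qed
qed

text \<open>Triangularity, from summing the previous lemma over \<open>S\<close>. The case
  \<open>l = k\<close> makes degree \<open>k\<close> projectors idempotent and computes the
  comparison maps; the case \<open>l > k\<close> puts the image of a degree \<open>k\<close> map
  into the kernel of the next one.\<close>

lemma graded_arrow_Comp:
  assumes "a \<in> Hom C X X'" "b \<in> Hom C X X'" "c \<in> Hom C X' X''" "d \<in> Hom C X' X''"
    and da: "d \<cdot> a = Zero C X X''" and kl: "k \<le> l"
  shows "graded_arrow n l c d \<cdot> graded_arrow n k a b
    = (if l = k then graded_arrow n k (c \<cdot> a) (d \<cdot> b)
       else Zero C (tensor_power C X n) (tensor_power C X'' n))"
proof -
  let ?T = "tensor_power C X n" and ?T' = "tensor_power C X' n" and ?T'' = "tensor_power C X'' n"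
  let ?L = "{S. S \<subseteq> {1..n} \<and> card S = l}" and ?c = "\<lambda>S. tensor_arr (\<lambda>i. if i \<in> S then d else c) n"
  have Ob: "X \<in> Ob C" "X' \<in> Ob C" "X'' \<in> Ob C" using assms by auto
  have ca: "c \<cdot> a \<in> Hom C X X''" "d \<cdot> b \<in> Hom C X X''" using assms by simp_all
  have cH: "?c S \<in> Hom C ?T' ?T''" for S by (rule tensor_arr_select_Hom[OF assms(3,4)])
  have gH: "graded_arrow n k a b \<in> Hom C ?T ?T'" by (rule graded_arrow_Hom[OF assms(1,2)])
  have sum: "graded_arrow n l c d \<cdot> graded_arrow n k a b
      = hsum ?T ?T'' (\<lambda>S. ?c S \<cdot> graded_arrow n k a b) ?L"
    unfolding graded_arrow_eq[OF assms(3)] using hsum_Comp[of "graded_arrow n k a b" ?T' ?T'' ?L ?c] gH cH Ob by simp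
  also have "\<dots> = hsum ?T ?T'' (\<lambda>S. if l = k then tensor_arr (\<lambda>i. if i \<in> S then d \<cdot> b else c \<cdot> a) n
       else Zero C ?T ?T'') ?L"
  proof (rule hsum_cong)
    show "?c S \<cdot> graded_arrow n k a b = (if l = k then tensor_arr (\<lambda>i. if i \<in> S then d \<cdot> b else c \<cdot> a) n
       else Zero C ?T ?T'')" if "S \<in> ?L" for S
      using tensor_arr_graded_Comp[OF assms(1-5), of S n k] that kl by simp
    show "(if l = k then tensor_arr (\<lambda>i. if i \<in> S then d \<cdot> b else c \<cdot> a) n else Zero C ?T ?T'') \<in> Hom C ?T ?T''" for S
      using tensor_arr_select_Hom[OF ca, of S n] Ob by simp
  qed (use Ob in simp_all)
  finally show ?thesis
    using Ob by (cases "l = k") (simp_all add: graded_arrow_eq[OF ca(1)] hsum_all_Zero)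
qed

end

section \<open>Exactness of mixed tensor products\<close>

locale biexact_tensor_category = abelian_tensor_category +
  assumes biexact: "biexact C"
begin

lemma short_exact_TenM:
  assumes "short_exact C X f Y g Z" "W \<in> Ob C"
  shows "short_exact C (X \<otimes>\<^sub>o W) (f \<otimes>\<^sub>m Ident C W) (Y \<otimes>\<^sub>o W) (g \<otimes>\<^sub>m Ident C W) (Z \<otimes>\<^sub>o W)"
    and "short_exact C (W \<otimes>\<^sub>o X) (Ident C W \<otimes>\<^sub>m f) (W \<otimes>\<^sub>o Y) (Ident C W \<otimes>\<^sub>m g) (W \<otimes>\<^sub>o Z)"
  using biexact assms unfolding biexact_def by blast+

text \<open>A monomorphism starts a short exact sequence, so tensoring it with a fixed object keeps
  it monic; \<open>f \<otimes>\<^sub>m g\<close> is a composite of two arrows of this kind.\<close>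

lemma mono_TenM:
  assumes f: "mono_arrow C f" "f \<in> Hom C X X'" and g: "mono_arrow C g" "g \<in> Hom C Y Y'"
  shows "mono_arrow C (f \<otimes>\<^sub>m g)"
proof -
  have Ob: "X \<in> Ob C" "X' \<in> Ob C" "Y \<in> Ob C" "Y' \<in> Ob C" using f(2) g(2) by auto
  obtain c d where "is_cokernel C f c" "is_cokernel C g d"
    using ex_cokernel[of f] ex_cokernel[of g] f(2) g(2) by auto
  then have "short_exact C X f X' c (Cod C c)" "short_exact C Y g Y' d (Cod C d)"
    using short_exact_of_mono[of f c] short_exact_of_mono[of g d] f g by auto
  then have "mono_arrow C (f \<otimes>\<^sub>m Ident C Y)" "mono_arrow C (Ident C X' \<otimes>\<^sub>m g)"
    using short_exact_TenM Ob unfolding short_exact_def by (blast intro: is_kernel_mono)+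
  then have "mono_arrow C ((Ident C X' \<otimes>\<^sub>m g) \<cdot> (f \<otimes>\<^sub>m Ident C Y))"
    using f(2) g(2) Ob by (intro mono_arrow_Comp) simp_all
  then show ?thesis using f(2) g(2) Ob by (simp add: TenM_merge)
qed

lemma epi_TenM:
  assumes f: "epi_arrow C f" "f \<in> Hom C X X'" and g: "epi_arrow C g" "g \<in> Hom C Y Y'"
  shows "epi_arrow C (f \<otimes>\<^sub>m g)"
proof -
  have Ob: "X \<in> Ob C" "X' \<in> Ob C" "Y \<in> Ob C" "Y' \<in> Ob C" using f(2) g(2) by auto
  obtain c d where "is_kernel C f c" "is_kernel C g d"
    using ex_kernel[of f] ex_kernel[of g] f(2) g(2) by auto
  then have "short_exact C (Dom C c) c X f X'" "short_exact C (Dom C d) d Y g Y'"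
    using short_exact_of_epi[of f c] short_exact_of_epi[of g d] f g by auto
  then have "epi_arrow C (f \<otimes>\<^sub>m Ident C Y)" "epi_arrow C (Ident C X' \<otimes>\<^sub>m g)"
    using short_exact_TenM Ob unfolding short_exact_def by (blast intro: is_cokernel_epi)+
  then have "epi_arrow C ((Ident C X' \<otimes>\<^sub>m g) \<cdot> (f \<otimes>\<^sub>m Ident C Y))"
    using f(2) g(2) Ob by (intro epi_arrow_Comp) simp_all
  then show ?thesis using f(2) g(2) Ob by (simp add: TenM_merge)
qed

lemma mono_tensor_arr:
  assumes "\<And>i. i \<in> {1..n} \<Longrightarrow> a i \<in> Hom C (c i) (d i)" "\<And>i. i \<in> {1..n} \<Longrightarrow> mono_arrow C (a i)"
  shows "mono_arrow C (tensor_arr a n)"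
  using assms
proof (induction n)
  case 0
  then show ?case by (simp add: mono_arrow_Ident)
next
  case (Suc n)
  have "tensor_arr a n \<in> Hom C (tensor_obj c n) (tensor_obj d n)"
    by (rule tensor_arr_Hom, rule Suc.prems) simp
  moreover have "mono_arrow C (tensor_arr a n)" by (rule Suc.IH; rule Suc.prems; simp)
  moreover have "a (Suc n) \<in> Hom C (c (Suc n)) (d (Suc n))" "mono_arrow C (a (Suc n))"
    by (rule Suc.prems, simp)+
  ultimately show ?case using mono_TenM by simp
qed

lemma epi_tensor_arr:
  assumes "\<And>i. i \<in> {1..n} \<Longrightarrow> a i \<in> Hom C (c i) (d i)" "\<And>i. i \<in> {1..n} \<Longrightarrow> epi_arrow C (a i)"
  shows "epi_arrow C (tensor_arr a n)"
  using assms
proof (induction n)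
  case 0
  then show ?case by (simp add: epi_arrow_Ident)
next
  case (Suc n)
  have "tensor_arr a n \<in> Hom C (tensor_obj c n) (tensor_obj d n)"
    by (rule tensor_arr_Hom, rule Suc.prems) simp
  moreover have "epi_arrow C (tensor_arr a n)" by (rule Suc.IH; rule Suc.prems; simp)
  moreover have "a (Suc n) \<in> Hom C (c (Suc n)) (d (Suc n))" "epi_arrow C (a (Suc n))"
    by (rule Suc.prems, simp)+
  ultimately show ?case using epi_TenM by simp
qed

text \<open>The factors to the left of \<open>j\<close> are tensored on at once, as a single object;
  those to the right are added one at a time.\<close>

lemma tensor_short_exact:
  assumes se: "short_exact C X f Y g Z" and j: "j \<in> {1..n}"
    and c: "\<And>i. i \<in> {1..n} \<Longrightarrow> c i \<in> Ob C"
  shows "short_exact C (tensor_obj (c(j := X)) n) (tensor_arr ((\<lambda>i. Ident C (c i))(j := f)) n)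
    (tensor_obj (c(j := Y)) n) (tensor_arr ((\<lambda>i. Ident C (c i))(j := g)) n) (tensor_obj (c(j := Z)) n)"
  using j c
proof (induction n)
  case (Suc n)
  show ?case
  proof (cases "j = Suc n")
    case True
    have "tensor_obj (c(j := V)) n = tensor_obj c n" for V
      by (rule tensor_obj_cong) (use True in auto)
    moreover have "tensor_arr ((\<lambda>i. Ident C (c i))(j := h)) n = Ident C (tensor_obj c n)" for h
      by (rule tensor_arr_Ident) (use True Suc.prems in auto)
    moreover have "tensor_obj c n \<in> Ob C" by (rule tensor_obj_Ob, rule Suc.prems) simp
    ultimately show ?thesis using short_exact_TenM(2)[OF se, of "tensor_obj c n"] True
      by (simp del: fun_upd_apply add: fun_upd_same)
  next
    case False
    have "c (Suc n) \<in> Ob C" by (rule Suc.prems) simp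
    then show ?thesis using short_exact_TenM(1)[OF Suc.IH, of "c (Suc n)"] Suc.prems False by simp
  qed
qed simp

text \<open>
  The positions outside \<open>S\<close> are moved from \<open>Y\<close> to its subobject \<open>X\<close> one after the other, by exactness
  in a single position; the obstruction vanishes because it does so after embedding the positions
  treated before back into \<open>Y\<close>.
\<close>

lemma factor_through_subobjects:
  assumes se: "short_exact C X f Y g Z" and S: "S \<subseteq> {1..n}" and h: "h \<in> Hom C A (tensor_power C Y n)"
    and vanish: "\<And>j. j \<in> {1..n} - S \<Longrightarrow>
      tensor_arr (\<lambda>i. if i \<in> insert j S then g else Ident C Y) n \<cdot> h
        = Zero C A (tensor_obj (\<lambda>i. if i \<in> insert j S then Z else Y) n)"
  shows "\<exists>\<theta>\<in>Hom C A (tensor_obj (\<lambda>i. if i \<in> S then Z else X) n).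
    tensor_arr (\<lambda>i. if i \<in> S then g else Ident C Y) n \<cdot> h
      = tensor_arr (\<lambda>i. if i \<in> S then Ident C Z else f) n \<cdot> \<theta>"
proof -
  have f: "f \<in> Hom C X Y" and g: "g \<in> Hom C Y Z" and ker: "is_kernel C g f"
    using se by (auto simp: short_exact_def)
  have f_mono: "mono_arrow C f" by (rule is_kernel_mono[OF ker])
  have Ob: "X \<in> Ob C" "Y \<in> Ob C" "Z \<in> Ob C" "A \<in> Ob C" using f g h by auto
  \<comment> \<open>\<open>R\<close> collects the positions already moved to \<open>X\<close>; the
    positions outside \<open>S\<close> and \<open>R\<close> still carry \<open>Y\<close>.\<close>
  have step: "\<exists>\<theta>\<in>Hom C A (tensor_obj (\<lambda>i. if i \<in> S then Z else if i \<in> R then X else Y) n).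
      tensor_arr (\<lambda>i. if i \<in> S then g else Ident C Y) n \<cdot> h
        = tensor_arr (\<lambda>i. if i \<in> S then Ident C Z else if i \<in> R then f else Ident C Y) n \<cdot> \<theta>"
    if "finite R" "R \<subseteq> {1..n} - S" for R
    using that
  proof (induction R)
    case empty
    have "tensor_arr (\<lambda>i. if i \<in> S then Ident C Z else Ident C Y) n
        = Ident C (tensor_obj (\<lambda>i. if i \<in> S then Z else Y) n)"
      by (rule tensor_arr_Ident) (use Ob in auto)
    moreover have "tensor_arr (\<lambda>i. if i \<in> S then g else Ident C Y) n
        \<in> Hom C (tensor_obj (\<lambda>_. Y) n) (tensor_obj (\<lambda>i. if i \<in> S then Z else Y) n)"
      by (rule tensor_arr_Hom) (use g Ob in auto)
    ultimately show ?case
      unfolding empty_iff if_False using h by (intro bexI[of _ "tensor_arr (\<lambda>i. if i \<in> S then g else Ident C Y) n \<cdot> h"]) auto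
  next
    case (insert j R)
    have j: "j \<in> {1..n}" "j \<notin> S" "j \<notin> R" using insert.hyps insert.prems by auto
    \<comment> \<open>The shape \<open>c\<close> is the one reached so far and \<open>d\<close> the
      one with \<open>R\<close> put back to \<open>Y\<close>; \<open>a\<close> embeds
      \<open>c\<close> into \<open>d\<close>, and \<open>b\<close> is the projection from the power
      of \<open>Y\<close> to \<open>d\<close>.\<close>
    define c where "c = (\<lambda>i. if i \<in> S then Z else if i \<in> R then X else Y)"
    define d where "d = (\<lambda>i. if i \<in> S then Z else Y)"
    define a where "a = (\<lambda>i. if i \<in> S then Ident C Z else if i \<in> R then f else Ident C Y)"
    define b where "b = (\<lambda>i. if i \<in> S then g else Ident C Y)"
    have cOb: "c i \<in> Ob C" and dOb: "d i \<in> Ob C" for i using Ob by (auto simp: c_def d_def)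
    have aH: "a i \<in> Hom C (c i) (d i)" for i using f Ob by (auto simp: a_def c_def d_def)
    have bH: "b i \<in> Hom C Y (d i)" for i using g Ob by (auto simp: b_def d_def)
    obtain \<theta> where \<theta>: "\<theta> \<in> Hom C A (tensor_obj c n)" and eq: "tensor_arr b n \<cdot> h = tensor_arr a n \<cdot> \<theta>"
      using insert.IH insert.prems unfolding a_def b_def c_def by auto
    let ?gc = "(\<lambda>i. Ident C (c i))(j := g)" and ?gd = "(\<lambda>i. Ident C (d i))(j := g)"
    let ?fc = "(\<lambda>i. Ident C (c i))(j := f)"
    \<comment> \<open>\<open>\<mu>\<close> does what \<open>a\<close> does after \<open>g\<close>
      has been applied in position \<open>j\<close>. It is monic, so the obstruction
      \<open>?gc\<close> applied to \<open>\<theta>\<close> may be tested after it, where it becomes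
      the component at \<open>insert j S\<close>.\<close>
    define \<mu> where "\<mu> = a(j := Ident C Z)"
    have \<mu>H: "\<mu> i \<in> Hom C ((c(j := Z)) i) ((d(j := Z)) i)" for i
      using aH[of i] Ob j by (auto simp: \<mu>_def)
    have gcH: "?gc i \<in> Hom C (c i) ((c(j := Z)) i)" for i
      using cOb[of i] g j by (auto simp: c_def)
    have gdH: "?gd i \<in> Hom C (d i) ((d(j := Z)) i)" for i
      using dOb[of i] g j by (auto simp: d_def)
    have fcH: "?fc i \<in> Hom C ((c(j := X)) i) (c i)" for i
      using cOb[of i] f j by (auto simp: c_def)
    have AH: "tensor_arr a n \<in> Hom C (tensor_obj c n) (tensor_obj d n)"
      "tensor_arr b n \<in> Hom C (tensor_power C Y n) (tensor_obj d n)"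
      "tensor_arr \<mu> n \<in> Hom C (tensor_obj (c(j := Z)) n) (tensor_obj (d(j := Z)) n)"
      "tensor_arr ?gc n \<in> Hom C (tensor_obj c n) (tensor_obj (c(j := Z)) n)"
      "tensor_arr ?gd n \<in> Hom C (tensor_obj d n) (tensor_obj (d(j := Z)) n)"
      "tensor_arr ?fc n \<in> Hom C (tensor_obj (c(j := X)) n) (tensor_obj c n)"
      using tensor_arr_Hom[of n a, OF aH] tensor_arr_Hom[of n b, OF bH] tensor_arr_Hom[of n \<mu>, OF \<mu>H]
        tensor_arr_Hom[of n ?gc, OF gcH] tensor_arr_Hom[of n ?gd, OF gdH] tensor_arr_Hom[of n ?fc, OF fcH]
      by (simp_all only: tensor_obj_const)
    have "tensor_arr \<mu> n \<cdot> tensor_arr ?gc n = tensor_arr (\<lambda>i. \<mu> i \<cdot> ?gc i) n"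
      by (rule tensor_arr_Comp[OF gcH \<mu>H])
    also have "\<dots> = tensor_arr (\<lambda>i. ?gd i \<cdot> a i) n"
    proof (rule tensor_arr_cong)
      show "\<mu> i \<cdot> ?gc i = ?gd i \<cdot> a i" for i
      proof (cases "i = j")
        case True
        then show ?thesis using g j Ob by (simp add: \<mu>_def a_def)
      next
        case False
        then show ?thesis using aH[of i] by (simp add: \<mu>_def)
      qed
    qed
    also have "\<dots> = tensor_arr ?gd n \<cdot> tensor_arr a n"
      by (rule tensor_arr_Comp[OF aH gdH, symmetric])
    finally have \<mu>g: "tensor_arr \<mu> n \<cdot> tensor_arr ?gc n = tensor_arr ?gd n \<cdot> tensor_arr a n" .
    have "tensor_arr ?gd n \<cdot> tensor_arr b n = tensor_arr (\<lambda>i. ?gd i \<cdot> b i) n"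
      by (rule tensor_arr_Comp[OF bH gdH])
    also have "\<dots> = tensor_arr (\<lambda>i. if i \<in> insert j S then g else Ident C Y) n"
      by (rule tensor_arr_cong) (use g Ob j in \<open>auto simp: b_def d_def\<close>)
    finally have gb: "tensor_arr ?gd n \<cdot> tensor_arr b n = tensor_arr (\<lambda>i. if i \<in> insert j S then g else Ident C Y) n" .
    have dj: "d(j := Z) = (\<lambda>i. if i \<in> insert j S then Z else Y)" by (auto simp: d_def)
    have "tensor_arr \<mu> n \<cdot> tensor_arr ?gc n \<cdot> \<theta> = tensor_arr ?gd n \<cdot> tensor_arr a n \<cdot> \<theta>"
      using Comp_reassoc[OF \<mu>g, of \<theta>] AH \<theta> by simp
    also have "\<dots> = tensor_arr ?gd n \<cdot> tensor_arr b n \<cdot> h" unfolding eq ..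
    also have "\<dots> = Zero C A (tensor_obj (d(j := Z)) n)"
      unfolding dj using Comp_reassoc[OF gb, of h] AH h vanish[of j] j by simp
    finally have zero: "tensor_arr \<mu> n \<cdot> tensor_arr ?gc n \<cdot> \<theta> = Zero C A (tensor_obj (d(j := Z)) n)" .
    have "mono_arrow C (tensor_arr \<mu> n)"
      by (rule mono_tensor_arr[OF \<mu>H]) (use f_mono Ob in \<open>auto simp: \<mu>_def a_def mono_arrow_Ident\<close>)
    then have gc\<theta>: "tensor_arr ?gc n \<cdot> \<theta> = Zero C A (tensor_obj (c(j := Z)) n)"
      by (rule mono_Zero[OF _ AH(3) _ zero]) (rule Comp_in_Hom[OF \<theta> AH(4)])
    have "c(j := Y) = c" using j by (auto simp: c_def)
    then have "is_kernel C (tensor_arr ?gc n) (tensor_arr ?fc n)"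
      using tensor_short_exact[OF se j(1), of c] cOb by (simp add: short_exact_def)
    then obtain \<theta>' where \<theta>': "\<theta>' \<in> Hom C A (tensor_obj (c(j := X)) n)" "tensor_arr ?fc n \<cdot> \<theta>' = \<theta>"
      by (rule kernel_factor[of _ _ \<theta> A]) (use \<theta> gc\<theta> AH in auto)
    have "tensor_arr a n \<cdot> tensor_arr ?fc n = tensor_arr (\<lambda>i. a i \<cdot> ?fc i) n"
      by (rule tensor_arr_Comp[OF fcH aH])
    also have "\<dots> = tensor_arr (\<lambda>i. if i \<in> S then Ident C Z else if i \<in> insert j R then f else Ident C Y) n"
      by (rule tensor_arr_cong) (use f Ob j in \<open>auto simp: a_def c_def\<close>)
    finally have af: "tensor_arr a n \<cdot> tensor_arr ?fc n
      = tensor_arr (\<lambda>i. if i \<in> S then Ident C Z else if i \<in> insert j R then f else Ident C Y) n" .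
    have "c(j := X) = (\<lambda>i. if i \<in> S then Z else if i \<in> insert j R then X else Y)"
      using j by (auto simp: c_def)
    moreover have "tensor_arr b n \<cdot> h
        = tensor_arr (\<lambda>i. if i \<in> S then Ident C Z else if i \<in> insert j R then f else Ident C Y) n \<cdot> \<theta>'"
      using eq Comp_reassoc[OF af, of \<theta>'] AH \<theta>' by simp
    ultimately show ?case using \<theta>'(1) unfolding b_def by auto
  qed
  have "tensor_obj (\<lambda>i. if i \<in> S then Z else if i \<in> {1..n} - S then X else Y) n
      = tensor_obj (\<lambda>i. if i \<in> S then Z else X) n"
    by (rule tensor_obj_cong) auto
  moreover have "tensor_arr (\<lambda>i. if i \<in> S then Ident C Z else if i \<in> {1..n} - S then f else Ident C Y) n
      = tensor_arr (\<lambda>i. if i \<in> S then Ident C Z else f) n"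
    by (rule tensor_arr_cong) auto
  ultimately show ?thesis using step[of "{1..n} - S"] by simp
qed

end

section \<open>The filtration of a tensor power\<close>

context biexact_tensor_category
begin

text \<open>Composing with the projection to \<open>Z\<close> in the positions of \<open>S\<close>
  and to \<open>Y\<close> elsewhere isolates one summand of the graded arrow, as
  \<open>q2 \<cdot> v1\<close> is zero. What remains is the wanted arrow followed by a monomorphism
  into the power of \<open>V\<close>.\<close>

lemma component_vanish:
  assumes ds: "direct_sum C Y Z V v1 v2 q1 q2" and g: "g \<in> Hom C Y Z"
    and h: "h \<in> Hom C A (tensor_power C Y n)"
    and zero: "graded_arrow n k v1 (v2 \<cdot> g) \<cdot> h = Zero C A (tensor_power C V n)"
    and S: "S \<subseteq> {1..n}" "card S = k"
  shows "tensor_arr (\<lambda>i. if i \<in> S then g else Ident C Y) n \<cdot> h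
    = Zero C A (tensor_obj (\<lambda>i. if i \<in> S then Z else Y) n)"
proof -
  note d = direct_sumD[OF ds]
  have Ob: "Y \<in> Ob C" "Z \<in> Ob C" "V \<in> Ob C" "A \<in> Ob C" using d(1,2) h by auto
  let ?v = "tensor_arr (\<lambda>i. if i \<in> S then v2 else v1) n"
  let ?g = "tensor_arr (\<lambda>i. if i \<in> S then g else Ident C Y) n"
  let ?U = "tensor_obj (\<lambda>i. if i \<in> S then Z else Y) n"
  have v2g: "v2 \<cdot> g \<in> Hom C Y V" using d(2) g by simp
  have proj: "v1 \<cdot> q1 \<in> Hom C V V" "v2 \<cdot> q2 \<in> Hom C V V" using d(1-4) by simp_all
  have e: "(v2 \<cdot> q2) \<cdot> v2 \<cdot> g = v2 \<cdot> g" "(v1 \<cdot> q1) \<cdot> v1 = v1" "(v2 \<cdot> q2) \<cdot> v1 = Zero C Y V"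
    using Comp_reassoc[OF d(6), of g] d g Ob by simp_all
  have vH: "?v \<in> Hom C ?U (tensor_power C V n)"
    using tensor_arr_Hom[of n "\<lambda>i. if i \<in> S then v2 else v1" "\<lambda>i. if i \<in> S then Z else Y" "\<lambda>_. V"] d(1,2) by simp
  have gH: "?g \<in> Hom C (tensor_power C Y n) ?U"
    using tensor_arr_Hom[of n "\<lambda>i. if i \<in> S then g else Ident C Y" "\<lambda>_. Y" "\<lambda>i. if i \<in> S then Z else Y"] g Ob by simp
  have \<phi>: "graded_arrow n k v1 (v2 \<cdot> g) \<in> Hom C (tensor_power C Y n) (tensor_power C V n)"
    by (rule graded_arrow_Hom[OF d(1) v2g])
  have "?v \<cdot> ?g = tensor_arr (\<lambda>i. (if i \<in> S then v2 else v1) \<cdot> (if i \<in> S then g else Ident C Y)) n"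
    by (rule tensor_arr_Comp[of _ _ "\<lambda>_. Y" "\<lambda>i. if i \<in> S then Z else Y" _ "\<lambda>_. V"]) (use d g Ob in auto)
  also have "\<dots> = tensor_arr (\<lambda>i. if i \<in> S then v2 \<cdot> g else v1) n"
    by (rule tensor_arr_cong) (use d in auto)
  finally have vg: "?v \<cdot> ?g = tensor_arr (\<lambda>i. if i \<in> S then v2 \<cdot> g else v1) n" .
  have comp: "tensor_arr (\<lambda>i. if i \<in> S then v2 \<cdot> q2 else v1 \<cdot> q1) n \<cdot> graded_arrow n k v1 (v2 \<cdot> g) = ?v \<cdot> ?g"
    using tensor_arr_graded_Comp[OF d(1) v2g proj e(3) S(1), of k] S(2) by (simp only: e vg) simp
  have "?v \<cdot> ?g \<cdot> h = (?v \<cdot> ?g) \<cdot> h" using vH gH h by simp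
  also have "\<dots> = tensor_arr (\<lambda>i. if i \<in> S then v2 \<cdot> q2 else v1 \<cdot> q1) n \<cdot> graded_arrow n k v1 (v2 \<cdot> g) \<cdot> h"
    unfolding comp[symmetric] using tensor_arr_select_Hom[OF proj, of S n] \<phi> h by simp
  also have "\<dots> = Zero C A (tensor_power C V n)"
    unfolding zero using tensor_arr_select_Hom[OF proj, of S n] Ob by simp
  finally have "?v \<cdot> ?g \<cdot> h = Zero C A (tensor_power C V n)" .
  moreover have "mono_arrow C ?v"
    by (rule mono_tensor_arr[of _ _ "\<lambda>i. if i \<in> S then Z else Y" "\<lambda>_. V"]) (use d in auto)
  ultimately show ?thesis
    using mono_Zero[of ?v ?U "tensor_power C V n" "?g \<cdot> h" A] vH gH h by simp
qed

text \<open>Removing one element from an index set of size \<open>k + 1\<close> leaves one of size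
  \<open>k\<close>. The larger summand factors through the smaller component, which vanishes; hence
  the kernels increase with \<open>k\<close>.\<close>

lemma graded_arrow_kernel_mono:
  assumes ds: "direct_sum C Y Z V v1 v2 q1 q2" and g: "g \<in> Hom C Y Z"
    and h: "h \<in> Hom C A (tensor_power C Y n)"
    and zero: "graded_arrow n k v1 (v2 \<cdot> g) \<cdot> h = Zero C A (tensor_power C V n)"
  shows "graded_arrow n (Suc k) v1 (v2 \<cdot> g) \<cdot> h = Zero C A (tensor_power C V n)"
proof -
  note d = direct_sumD[OF ds]
  let ?L = "{S. S \<subseteq> {1..n} \<and> card S = Suc k}"
  have Ob: "Y \<in> Ob C" "Z \<in> Ob C" "V \<in> Ob C" "A \<in> Ob C" using d(1,2) h by auto
  have v2g: "v2 \<cdot> g \<in> Hom C Y V" using d(2) g by simp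
  note vH = tensor_arr_select_Hom[OF d(1) v2g]
  have "graded_arrow n (Suc k) v1 (v2 \<cdot> g) \<cdot> h
      = hsum (Dom C h) (tensor_power C V n) (\<lambda>S. tensor_arr (\<lambda>i. if i \<in> S then v2 \<cdot> g else v1) n \<cdot> h) ?L"
    unfolding graded_arrow_eq[OF d(1)] by (rule hsum_Comp) (use vH h Ob in auto)
  also have "\<dots> = Zero C (Dom C h) (tensor_power C V n)"
  proof (rule hsum_all_Zero)
    fix S assume S: "S \<in> ?L"
    then have fin: "finite S" using finite_subset[of S "{1..n}"] by auto
    obtain j where j: "j \<in> S" using S by fastforce
    define R where "R = S - {j}"
    have R: "R \<subseteq> {1..n}" "card R = k" "S = insert j R" "j \<notin> R"
      using S j fin by (auto simp: R_def)
    let ?gR = "tensor_arr (\<lambda>i. if i \<in> R then g else Ident C Y) n"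
    \<comment> \<open>Position \<open>j\<close> still holds \<open>Y\<close> in the component of
      \<open>R\<close>, so the missing \<open>g\<close> is applied there.\<close>
    let ?w = "\<lambda>i. if i = j then v2 \<cdot> g else if i \<in> R then v2 else v1"
    let ?U = "\<lambda>i. if i \<in> R then Z else Y"
    have wH: "?w i \<in> Hom C (?U i) V" and gH: "(if i \<in> R then g else Ident C Y) \<in> Hom C Y (?U i)" for i
      using d v2g g Ob R(4) by auto
    have "tensor_arr ?w n \<cdot> ?gR = tensor_arr (\<lambda>i. ?w i \<cdot> (if i \<in> R then g else Ident C Y)) n"
      by (rule tensor_arr_Comp[OF gH wH])
    also have "\<dots> = tensor_arr (\<lambda>i. if i \<in> S then v2 \<cdot> g else v1) n"
      by (rule tensor_arr_cong) (use d g R in auto)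
    finally have eq: "tensor_arr ?w n \<cdot> ?gR = tensor_arr (\<lambda>i. if i \<in> S then v2 \<cdot> g else v1) n" .
    have H: "tensor_arr ?w n \<in> Hom C (tensor_obj ?U n) (tensor_power C V n)"
      "?gR \<in> Hom C (tensor_power C Y n) (tensor_obj ?U n)"
      using tensor_arr_Hom[of n, OF wH] tensor_arr_Hom[of n, OF gH] by (simp_all only: tensor_obj_const)
    have "tensor_arr (\<lambda>i. if i \<in> S then v2 \<cdot> g else v1) n \<cdot> h = tensor_arr ?w n \<cdot> ?gR \<cdot> h"
      using Comp_reassoc[OF eq, of h] H h by simp
    also have "?gR \<cdot> h = Zero C A (tensor_obj ?U n)"
      by (rule component_vanish[OF ds g h zero R(1,2)])
    finally show "tensor_arr (\<lambda>i. if i \<in> S then v2 \<cdot> g else v1) n \<cdot> h = Zero C (Dom C h) (tensor_power C V n)"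
      using H h Ob by simp
  qed (use h Ob in auto)
  finally show ?thesis using h by simp
qed

text \<open>For \<open>S\<close> of size \<open>k\<close>, the obstruction to cutting a position
  \<open>j\<close> outside \<open>S\<close> down to \<open>X\<close> is the component at
  \<open>insert j S\<close>, of size \<open>k + 1\<close>, and this vanishes by hypothesis. The
  lifts for the various \<open>S\<close> are added up inside the power of \<open>W\<close>.\<close>

lemma graded_arrow_lift:
  assumes se: "short_exact C X f Y g Z"
    and dsV: "direct_sum C Y Z V v1 v2 q1 q2" and dsW: "direct_sum C X Z W i1 i2 p1 p2"
    and m: "m \<in> Hom C W V" "m \<cdot> i1 = v1 \<cdot> f" "m \<cdot> i2 = v2"
    and h: "h \<in> Hom C A (tensor_power C Y n)"
    and zero: "graded_arrow n (Suc k) v1 (v2 \<cdot> g) \<cdot> h = Zero C A (tensor_power C V n)"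
  shows "\<exists>\<theta>\<in>Hom C A (tensor_power C W n). graded_arrow n k v1 (v2 \<cdot> g) \<cdot> h = tensor_arr (\<lambda>_. m) n \<cdot> \<theta>"
proof -
  note v = direct_sumD[OF dsV] and w = direct_sumD[OF dsW]
  have f: "f \<in> Hom C X Y" and g: "g \<in> Hom C Y Z" using se by (auto simp: short_exact_def)
  have Ob: "X \<in> Ob C" "Y \<in> Ob C" "Z \<in> Ob C" "V \<in> Ob C" "W \<in> Ob C" "A \<in> Ob C" using v w h by auto
  let ?L = "{S. S \<subseteq> {1..n} \<and> card S = k}"
  let ?U = "\<lambda>S i. if i \<in> S then Z else X"
  let ?g = "\<lambda>S. tensor_arr (\<lambda>i. if i \<in> S then g else Ident C Y) n"
  let ?f = "\<lambda>S. tensor_arr (\<lambda>i. if i \<in> S then Ident C Z else f) n"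
  let ?v = "\<lambda>S. tensor_arr (\<lambda>i. if i \<in> S then v2 else v1) n"
  let ?w = "\<lambda>S. tensor_arr (\<lambda>i. if i \<in> S then i2 else i1) n"
  have v2g: "v2 \<cdot> g \<in> Hom C Y V" using v(2) g by simp
  note vH = tensor_arr_select_Hom[OF v(1) v2g]
  have "\<forall>S\<in>?L. \<exists>\<theta>. \<theta> \<in> Hom C A (tensor_obj (?U S) n) \<and> ?g S \<cdot> h = ?f S \<cdot> \<theta>"
  proof (intro ballI factor_through_subobjects[OF se _ h, unfolded Bex_def])
    fix S assume S: "S \<in> ?L"
    show "S \<subseteq> {1..n}" using S by simp
    fix j assume "j \<in> {1..n} - S"
    moreover have "finite S" using S finite_subset[of S "{1..n}"] by auto
    ultimately show "tensor_arr (\<lambda>i. if i \<in> insert j S then g else Ident C Y) n \<cdot> h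
        = Zero C A (tensor_obj (\<lambda>i. if i \<in> insert j S then Z else Y) n)"
      using S by (intro component_vanish[OF dsV g h zero]) auto
  qed
  from bchoice[OF this] obtain \<theta> where \<theta>: "\<And>S. S \<in> ?L \<Longrightarrow> \<theta> S \<in> Hom C A (tensor_obj (?U S) n)"
    "\<And>S. S \<in> ?L \<Longrightarrow> ?g S \<cdot> h = ?f S \<cdot> \<theta> S"
    by blast
  have H: "?g S \<in> Hom C (tensor_power C Y n) (tensor_obj (\<lambda>i. if i \<in> S then Z else Y) n)"
    "?f S \<in> Hom C (tensor_obj (?U S) n) (tensor_obj (\<lambda>i. if i \<in> S then Z else Y) n)"
    "?v S \<in> Hom C (tensor_obj (\<lambda>i. if i \<in> S then Z else Y) n) (tensor_power C V n)"
    "?w S \<in> Hom C (tensor_obj (?U S) n) (tensor_power C W n)" for S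
    using tensor_arr_Hom[of n "\<lambda>i. if i \<in> S then g else Ident C Y" "\<lambda>_. Y" "\<lambda>i. if i \<in> S then Z else Y"]
      tensor_arr_Hom[of n "\<lambda>i. if i \<in> S then Ident C Z else f" "?U S" "\<lambda>i. if i \<in> S then Z else Y"]
      tensor_arr_Hom[of n "\<lambda>i. if i \<in> S then v2 else v1" "\<lambda>i. if i \<in> S then Z else Y" "\<lambda>_. V"]
      tensor_arr_Hom[of n "\<lambda>i. if i \<in> S then i2 else i1" "?U S" "\<lambda>_. W"]
      f g v(1,2) w(1,2) Ob by simp_all
  have mH: "tensor_arr (\<lambda>_. m) n \<in> Hom C (tensor_power C W n) (tensor_power C V n)"
    by (rule tensor_arr_const_Hom[OF m(1)])
  have vg: "?v S \<cdot> ?g S = tensor_arr (\<lambda>i. if i \<in> S then v2 \<cdot> g else v1) n" for S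
  proof -
    have "?v S \<cdot> ?g S = tensor_arr (\<lambda>i. (if i \<in> S then v2 else v1) \<cdot> (if i \<in> S then g else Ident C Y)) n"
      by (rule tensor_arr_Comp[of _ _ "\<lambda>_. Y" "\<lambda>i. if i \<in> S then Z else Y" _ "\<lambda>_. V"]) (use v g Ob in auto)
    also have "\<dots> = tensor_arr (\<lambda>i. if i \<in> S then v2 \<cdot> g else v1) n"
      by (rule tensor_arr_cong) (use v in auto)
    finally show ?thesis .
  qed
  \<comment> \<open>On the summands of \<open>W\<close> the map \<open>m\<close> is \<open>f\<close>
    and the identity of \<open>Z\<close>, so the embeddings for all \<open>S\<close> factor through
    one and the same tensor power of \<open>m\<close>.\<close>
  have vf: "?v S \<cdot> ?f S = tensor_arr (\<lambda>_. m) n \<cdot> ?w S" for S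
  proof -
    have "?v S \<cdot> ?f S = tensor_arr (\<lambda>i. (if i \<in> S then v2 else v1) \<cdot> (if i \<in> S then Ident C Z else f)) n"
      by (rule tensor_arr_Comp[of _ _ "?U S" "\<lambda>i. if i \<in> S then Z else Y" _ "\<lambda>_. V"]) (use v f Ob in auto)
    also have "\<dots> = tensor_arr (\<lambda>i. m \<cdot> (if i \<in> S then i2 else i1)) n"
      by (rule tensor_arr_cong) (use v m in auto)
    also have "\<dots> = tensor_arr (\<lambda>_. m) n \<cdot> ?w S"
      by (rule tensor_arr_Comp[of _ _ "?U S" "\<lambda>_. W" _ "\<lambda>_. V", symmetric]) (use w m in auto)
    finally show ?thesis .
  qed
  have w\<theta>: "?w S \<cdot> \<theta> S \<in> Hom C A (tensor_power C W n)" if "S \<in> ?L" for S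
    by (rule Comp_in_Hom[OF \<theta>(1)[OF that] H(4)])
  have "graded_arrow n k v1 (v2 \<cdot> g) \<cdot> h
      = hsum (Dom C h) (tensor_power C V n) (\<lambda>S. tensor_arr (\<lambda>i. if i \<in> S then v2 \<cdot> g else v1) n \<cdot> h) ?L"
    unfolding graded_arrow_eq[OF v(1)] by (rule hsum_Comp) (use vH h Ob in auto)
  also have "\<dots> = hsum (Dom C h) (tensor_power C V n) (\<lambda>S. tensor_arr (\<lambda>_. m) n \<cdot> ?w S \<cdot> \<theta> S) ?L"
  proof (rule hsum_cong)
    fix S assume S: "S \<in> ?L"
    have "tensor_arr (\<lambda>i. if i \<in> S then v2 \<cdot> g else v1) n \<cdot> h = ?v S \<cdot> ?g S \<cdot> h"
      using Comp_reassoc[OF vg, of h S] H(1,3)[of S] h by simp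
    also have "\<dots> = ?v S \<cdot> ?f S \<cdot> \<theta> S" using \<theta>(2)[OF S] by simp
    also have "\<dots> = tensor_arr (\<lambda>_. m) n \<cdot> ?w S \<cdot> \<theta> S"
      using Comp_reassoc[OF vf, of "\<theta> S" S] H(2-4)[of S] \<theta>(1)[OF S] mH by simp
    finally show "tensor_arr (\<lambda>i. if i \<in> S then v2 \<cdot> g else v1) n \<cdot> h = tensor_arr (\<lambda>_. m) n \<cdot> ?w S \<cdot> \<theta> S" .
    show "tensor_arr (\<lambda>_. m) n \<cdot> ?w S \<cdot> \<theta> S \<in> Hom C (Dom C h) (tensor_power C V n)"
      using Comp_in_Hom[OF w\<theta>[OF S] mH] h by simp
  qed (use h Ob in auto)
  also have "\<dots> = tensor_arr (\<lambda>_. m) n \<cdot> hsum A (tensor_power C W n) (\<lambda>S. ?w S \<cdot> \<theta> S) ?L"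
    using Comp_hsum[of "tensor_arr (\<lambda>_. m) n" "tensor_power C W n" A ?L "\<lambda>S. ?w S \<cdot> \<theta> S"] mH w\<theta> h Ob by simp
  finally show ?thesis
    using hsum_closed[of A "tensor_power C W n" ?L "\<lambda>S. ?w S \<cdot> \<theta> S"] w\<theta> Ob by (intro bexI) auto
qed

end

context biexact_tensor_category
begin

text \<open>The splittings \<open>E k\<close> are parameters rather than produced here, so that two
  extensions with the same \<open>X\<close> and \<open>Z\<close> can be filtered with literally the
  same graded pieces. There are \<open>n + 1\<close> pieces, one for each number of factors
  \<open>Z\<close>, hence the top index \<open>Suc n\<close>.\<close>

theorem ex_tensor_filtration:
  assumes se: "short_exact C X f Y g Z" and ds: "direct_sum C X Z W i1 i2 p1 p2"
    and e: "e \<otimes>\<^bsub>sym_algebra n\<^esub> e = e"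
    and im: "is_image C (algebra_action C Y n e) i"
    and E: "\<And>k. jE k \<in> Hom C (E k) (tensor_power C W n)" "\<And>k. rE k \<in> Hom C (tensor_power C W n) (E k)"
      "\<And>k. rE k \<cdot> jE k = Ident C (E k)"
      "\<And>k. jE k \<cdot> rE k = algebra_action C W n e \<cdot> graded_arrow n k (i1 \<cdot> p1) (i2 \<cdot> p2)"
  shows "\<exists>N. cl C (N 0) = \<one>\<^bsub>K0 C\<^esub> \<and> N (Suc n) = Dom C i \<and>
    (\<forall>k\<le>n. \<exists>a b. short_exact C (N k) a (N (Suc k)) b (E k))"
proof -
  have f: "f \<in> Hom C X Y" and g: "g \<in> Hom C Y Z" and gf: "g \<cdot> f = Zero C X Z"
    and f_mono: "mono_arrow C f" and g_epi: "epi_arrow C g"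
    using se is_kernelD(4)[of g f] is_kernel_mono is_cokernel_epi by (auto simp: short_exact_def)
  have Ob: "X \<in> Ob C" "Y \<in> Ob C" "Z \<in> Ob C" using f g by auto
  obtain V v1 v2 q1 q2 where dsV: "direct_sum C Y Z V v1 v2 q1 q2"
    using ex_direct_sum[OF Ob(2,3)] by blast
  obtain P x1 x2 y1 y2 where dsP: "direct_sum C X Y P x1 x2 y1 y2"
    using ex_direct_sum[OF Ob(1,2)] by blast
  note i = direct_sumD[OF ds] and v = direct_sumD[OF dsV] and x = direct_sumD[OF dsP]
  have Ob': "W \<in> Ob C" "V \<in> Ob C" "P \<in> Ob C" using i(1) v(1) x(1) by auto
  \<comment> \<open>\<open>m\<close> is the sum of \<open>f\<close> and the identity of
    \<open>Z\<close>, and \<open>w\<close> that of the identity of \<open>X\<close> and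
    \<open>g\<close>. The first is monic and the second epic, because \<open>f\<close> and
    \<open>g\<close> are.\<close>
  define m where "m = v1 \<cdot> f \<cdot> p1 \<boxplus> v2 \<cdot> p2"
  define w where "w = i1 \<cdot> y1 \<boxplus> i2 \<cdot> g \<cdot> y2"
  have m: "m \<in> Hom C W V" using v i f by (simp add: m_def)
  have w: "w \<in> Hom C P W" using x i g by (simp add: w_def)
  have mi: "m \<cdot> i1 = v1 \<cdot> f" "m \<cdot> i2 = v2"
  proof -
    have "m \<cdot> i1 = (v1 \<cdot> f \<cdot> p1) \<cdot> i1 \<boxplus> (v2 \<cdot> p2) \<cdot> i1"
      unfolding m_def by (rule Comp_Add_left) (use v i f in auto)
    then show "m \<cdot> i1 = v1 \<cdot> f" using v i f Ob by simp
    have "m \<cdot> i2 = (v1 \<cdot> f \<cdot> p1) \<cdot> i2 \<boxplus> (v2 \<cdot> p2) \<cdot> i2"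
      unfolding m_def by (rule Comp_Add_left) (use v i f in auto)
    then show "m \<cdot> i2 = v2" using v i f Ob by simp
  qed
  have qm: "q1 \<cdot> m = f \<cdot> p1" "q2 \<cdot> m = p2"
  proof -
    have "q1 \<cdot> m = q1 \<cdot> v1 \<cdot> f \<cdot> p1 \<boxplus> q1 \<cdot> v2 \<cdot> p2"
      unfolding m_def by (rule Comp_Add_right) (use v i f in auto)
    then show "q1 \<cdot> m = f \<cdot> p1"
      using Comp_reassoc[OF v(5), of "f \<cdot> p1"] Comp_reassoc[OF v(7), of p2] v i f Ob Ob' by simp
    have "q2 \<cdot> m = q2 \<cdot> v1 \<cdot> f \<cdot> p1 \<boxplus> q2 \<cdot> v2 \<cdot> p2"
      unfolding m_def by (rule Comp_Add_right) (use v i f in auto)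
    then show "q2 \<cdot> m = p2"
      using Comp_reassoc[OF v(8), of "f \<cdot> p1"] Comp_reassoc[OF v(6), of p2] v i f Ob Ob' by simp
  qed
  have pw: "p1 \<cdot> w = y1" "p2 \<cdot> w = g \<cdot> y2"
  proof -
    have "p1 \<cdot> w = p1 \<cdot> i1 \<cdot> y1 \<boxplus> p1 \<cdot> i2 \<cdot> g \<cdot> y2"
      unfolding w_def by (rule Comp_Add_right) (use x i g in auto)
    then show "p1 \<cdot> w = y1"
      using Comp_reassoc[OF i(5), of y1] Comp_reassoc[OF i(7), of "g \<cdot> y2"] x i g Ob Ob' by simp
    have "p2 \<cdot> w = p2 \<cdot> i1 \<cdot> y1 \<boxplus> p2 \<cdot> i2 \<cdot> g \<cdot> y2"
      unfolding w_def by (rule Comp_Add_right) (use x i g in auto)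
    then show "p2 \<cdot> w = g \<cdot> y2"
      using Comp_reassoc[OF i(8), of y1] Comp_reassoc[OF i(6), of "g \<cdot> y2"] x i g Ob Ob' by simp
  qed
  have wx: "w \<cdot> x1 = i1" "w \<cdot> x2 = i2 \<cdot> g"
  proof -
    have "w \<cdot> x1 = (i1 \<cdot> y1) \<cdot> x1 \<boxplus> (i2 \<cdot> g \<cdot> y2) \<cdot> x1"
      unfolding w_def by (rule Comp_Add_left) (use x i g in auto)
    then show "w \<cdot> x1 = i1" using x i g Ob by simp
    have "w \<cdot> x2 = (i1 \<cdot> y1) \<cdot> x2 \<boxplus> (i2 \<cdot> g \<cdot> y2) \<cdot> x2"
      unfolding w_def by (rule Comp_Add_left) (use x i g in auto)
    then show "w \<cdot> x2 = i2 \<cdot> g" using x i g Ob by simp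
  qed
  have m_mono: "mono_arrow C m"
    unfolding mono_arrow_def
  proof (intro conjI allI ballI impI)
    fix A a b assume ab: "a \<in> Hom C A (Dom C m)" "b \<in> Hom C A (Dom C m)" "m \<cdot> a = m \<cdot> b"
    have a: "a \<in> Hom C A W" and b: "b \<in> Hom C A W" using ab m by auto
    have "f \<cdot> p1 \<cdot> a = f \<cdot> p1 \<cdot> b"
    proof -
      have "(q1 \<cdot> m) \<cdot> a = (q1 \<cdot> m) \<cdot> b" using ab(3) a b m v(3) by simp
      then show ?thesis unfolding qm using a b f i(3) by simp
    qed
    then have p1: "p1 \<cdot> a = p1 \<cdot> b"
      by (rule mono_arrowD[OF f_mono]) (use a b f i in auto)
    have p2: "p2 \<cdot> a = p2 \<cdot> b"
    proof -
      have "(q2 \<cdot> m) \<cdot> a = (q2 \<cdot> m) \<cdot> b" using ab(3) a b m v(4) by simp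
      then show ?thesis unfolding qm .
    qed
    have split: "t = i1 \<cdot> p1 \<cdot> t \<boxplus> i2 \<cdot> p2 \<cdot> t" if "t \<in> Hom C A W" for t
    proof -
      have "t = (i1 \<cdot> p1 \<boxplus> i2 \<cdot> p2) \<cdot> t" unfolding i(9) using that by simp
      also have "\<dots> = (i1 \<cdot> p1) \<cdot> t \<boxplus> (i2 \<cdot> p2) \<cdot> t"
        by (rule Comp_Add_left) (use that i in auto)
      finally show ?thesis using that i by simp
    qed
    show "a = b" using split[OF a] split[OF b] unfolding p1 p2 by simp
  qed (use m in simp)
  have w_epi: "epi_arrow C w"
    unfolding epi_arrow_def
  proof (intro conjI allI ballI impI)
    fix A a b assume ab: "a \<in> Hom C (Cod C w) A" "b \<in> Hom C (Cod C w) A" "a \<cdot> w = b \<cdot> w"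
    have a: "a \<in> Hom C W A" and b: "b \<in> Hom C W A" using ab w by auto
    have i1: "a \<cdot> i1 = b \<cdot> i1"
    proof -
      have "(a \<cdot> w) \<cdot> x1 = (b \<cdot> w) \<cdot> x1" using ab(3) by simp
      then show ?thesis using a b w x(1) wx by simp
    qed
    have "(a \<cdot> i2) \<cdot> g = (b \<cdot> i2) \<cdot> g"
    proof -
      have "(a \<cdot> w) \<cdot> x2 = (b \<cdot> w) \<cdot> x2" using ab(3) by simp
      then show ?thesis using a b w x(2) wx i(2) g by simp
    qed
    then have i2: "a \<cdot> i2 = b \<cdot> i2"
      by (rule epi_arrowD[OF g_epi]) (use a b g i in auto)
    have split: "t = (t \<cdot> i1) \<cdot> p1 \<boxplus> (t \<cdot> i2) \<cdot> p2" if "t \<in> Hom C W A" for t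
    proof -
      have "t = t \<cdot> (i1 \<cdot> p1 \<boxplus> i2 \<cdot> p2)" unfolding i(9) using that by simp
      also have "\<dots> = t \<cdot> (i1 \<cdot> p1) \<boxplus> t \<cdot> (i2 \<cdot> p2)"
        by (rule Comp_Add_right) (use that i in auto)
      finally show ?thesis using that i by simp
    qed
    show "a = b" using split[OF a] split[OF b] unfolding i1 i2 by simp
  qed (use w in simp)
  define \<phi> where "\<phi> k = graded_arrow n k v1 (v2 \<cdot> g)" for k
  \<comment> \<open>\<open>u k\<close> keeps \<open>Y\<close> in \<open>k\<close> positions and
    feeds \<open>X\<close> through \<open>f\<close> into the others. It therefore lands in step
    \<open>k + 1\<close> of the filtration and reaches the whole graded piece.\<close>
  define u where "u k = graded_arrow n k (f \<cdot> y1) y2" for k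
  let ?T = "tensor_power C Y n" and ?TV = "tensor_power C V n" and ?TW = "tensor_power C W n"
    and ?TP = "tensor_power C P n"
  let ?\<epsilon> = "\<lambda>X. algebra_action C X n e"
  let ?m = "tensor_arr (\<lambda>_. m) n" and ?w = "tensor_arr (\<lambda>_. w) n"
  have v2g: "v2 \<cdot> g \<in> Hom C Y V" using v(2) g by simp
  have fy1: "f \<cdot> y1 \<in> Hom C P Y" using f x by simp
  have T: "?T \<in> Ob C" "?TV \<in> Ob C" "?TW \<in> Ob C" "?TP \<in> Ob C" using Ob Ob' by simp_all
  have \<phi>: "\<phi> k \<in> Hom C ?T ?TV" for k unfolding \<phi>_def by (rule graded_arrow_Hom[OF v(1) v2g])
  have u: "u k \<in> Hom C ?TP ?T" for k unfolding u_def by (rule graded_arrow_Hom[OF fy1 x(4)])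
  have mH: "?m \<in> Hom C ?TW ?TV" and wH: "?w \<in> Hom C ?TP ?TW"
    by (rule tensor_arr_const_Hom; fact)+
  have \<epsilon>: "?\<epsilon> Y \<in> Hom C ?T ?T" "?\<epsilon> V \<in> Hom C ?TV ?TV" "?\<epsilon> W \<in> Hom C ?TW ?TW" "?\<epsilon> P \<in> Hom C ?TP ?TP"
    by (rule algebra_action_Hom; fact)+
  have \<epsilon>_idem: "?\<epsilon> Y \<cdot> ?\<epsilon> Y = ?\<epsilon> Y" by (simp only: algebra_action_mult[OF Ob(2)] e)
  have \<epsilon>\<phi>: "?\<epsilon> V \<cdot> \<phi> k = \<phi> k \<cdot> ?\<epsilon> Y" for k
    unfolding \<phi>_def by (rule algebra_action_equivariant[OF Ob(2) Ob'(2) graded_arrow_equivariant[OF v(1) v2g]])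
  have \<epsilon>m: "?\<epsilon> V \<cdot> ?m = ?m \<cdot> ?\<epsilon> W"
    by (rule algebra_action_equivariant[OF Ob'(1,2) tensor_arr_const_equivariant[OF m]])
  obtain r where r: "r \<in> Hom C ?T (Dom C i)" and j: "i \<in> Hom C (Dom C i) ?T"
    and jr: "i \<cdot> r = ?\<epsilon> Y" and rj: "r \<cdot> i = Ident C (Dom C i)"
    by (rule image_of_idempotent[OF im \<epsilon>(1) \<epsilon>_idem])
  let ?S = "Dom C i"
  have S: "?S \<in> Ob C" using j by auto
  have proj: "i1 \<cdot> p1 \<in> Hom C W W" "i2 \<cdot> p2 \<in> Hom C W W" "v1 \<cdot> q1 \<in> Hom C V V" "v2 \<cdot> q2 \<in> Hom C V V"
    using i v by simp_all
  define q where "q k = graded_arrow n k (i1 \<cdot> p1) (i2 \<cdot> p2)" for k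
  define qV where "qV k = graded_arrow n k (v1 \<cdot> q1) (v2 \<cdot> q2)" for k
  have q: "q k \<in> Hom C ?TW ?TW" and qV: "qV k \<in> Hom C ?TV ?TV" for k
    unfolding q_def qV_def by (rule graded_arrow_Hom; rule proj)+
  have jrE: "jE k \<cdot> rE k = ?\<epsilon> W \<cdot> q k" for k using E(4) by (simp only: q_def)
  \<comment> \<open>\<open>qV k\<close> projects to the part of the power of \<open>V\<close> with
    exactly \<open>k\<close> factors \<open>Z\<close>, which contains the image of
    \<open>\<phi> k\<close>.\<close>
  have qV\<phi>: "qV k \<cdot> \<phi> k = \<phi> k" for k
  proof -
    have "qV k \<cdot> \<phi> k = graded_arrow n k ((v1 \<cdot> q1) \<cdot> v1) ((v2 \<cdot> q2) \<cdot> v2 \<cdot> g)"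
      unfolding qV_def \<phi>_def using graded_arrow_Comp[OF v(1) v2g proj(3,4), of k k n] v Ob by simp
    also have "(v1 \<cdot> q1) \<cdot> v1 = v1" using v by simp
    also have "(v2 \<cdot> q2) \<cdot> v2 \<cdot> g = v2 \<cdot> g" using Comp_reassoc[OF v(6), of g] v g by simp
    finally show ?thesis by (simp only: \<phi>_def)
  qed
  have qVm: "qV k \<cdot> ?m = ?m \<cdot> q k" for k
  proof -
    have "qV k \<cdot> ?m = graded_arrow n k ((v1 \<cdot> q1) \<cdot> m) ((v2 \<cdot> q2) \<cdot> m)"
      unfolding qV_def by (rule graded_tensor_power_Comp[OF proj(3,4) m])
    also have "(v1 \<cdot> q1) \<cdot> m = m \<cdot> i1 \<cdot> p1"
      using Comp_reassoc[OF mi(1), of p1] qm v m i f by simp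
    also have "(v2 \<cdot> q2) \<cdot> m = m \<cdot> i2 \<cdot> p2"
      using Comp_reassoc[OF mi(2), of p2] qm v m i by simp
    also have "graded_arrow n k (m \<cdot> i1 \<cdot> p1) (m \<cdot> i2 \<cdot> p2) = ?m \<cdot> q k"
      unfolding q_def by (rule tensor_power_graded_Comp[OF proj(1,2) m, symmetric])
    finally show ?thesis .
  qed
  have \<phi>u: "\<phi> k \<cdot> u k = ?m \<cdot> q k \<cdot> ?w" for k
  proof -
    \<comment> \<open>Exactness in the form \<open>g \<cdot> f = 0\<close> is what makes the
      composite with \<open>u k\<close> triangular.\<close>
    have zero: "(v2 \<cdot> g) \<cdot> f \<cdot> y1 = Zero C P V"
      using Comp_reassoc[OF gf, of y1] v g f x Ob Ob' by simp
    have "\<phi> k \<cdot> u k = graded_arrow n k (v1 \<cdot> f \<cdot> y1) ((v2 \<cdot> g) \<cdot> y2)"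
      unfolding \<phi>_def u_def using graded_arrow_Comp[OF fy1 x(4) v(1) v2g zero, of k k n] by simp
    also have "v1 \<cdot> f \<cdot> y1 = m \<cdot> (i1 \<cdot> p1) \<cdot> w"
      using Comp_reassoc[OF mi(1), of y1] pw m i w v f x by simp
    also have "(v2 \<cdot> g) \<cdot> y2 = m \<cdot> (i2 \<cdot> p2) \<cdot> w"
      using Comp_reassoc[OF mi(2), of "g \<cdot> y2"] pw m i w v g x by simp
    also have "graded_arrow n k (m \<cdot> (i1 \<cdot> p1) \<cdot> w) (m \<cdot> (i2 \<cdot> p2) \<cdot> w)
        = ?m \<cdot> graded_arrow n k ((i1 \<cdot> p1) \<cdot> w) ((i2 \<cdot> p2) \<cdot> w)"
      by (rule tensor_power_graded_Comp[symmetric]) (use proj m w in auto)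
    also have "graded_arrow n k ((i1 \<cdot> p1) \<cdot> w) ((i2 \<cdot> p2) \<cdot> w) = q k \<cdot> ?w"
      unfolding q_def by (rule graded_tensor_power_Comp[OF proj(1,2) w, symmetric])
    finally show ?thesis .
  qed
  have \<phi>u': "\<phi> (Suc k) \<cdot> u k = Zero C ?TP ?TV" for k
  proof -
    have zero: "(v2 \<cdot> g) \<cdot> f \<cdot> y1 = Zero C P V"
      using Comp_reassoc[OF gf, of y1] v g f x Ob Ob' by simp
    show ?thesis
      unfolding \<phi>_def u_def using graded_arrow_Comp[OF fy1 x(4) v(1) v2g zero, of k "Suc k" n] by simp
  qed
  \<comment> \<open>A set of \<open>n\<close> positions has no subset of size
    \<open>n + 1\<close>.\<close>
  have top: "\<phi> (Suc n) \<cdot> i = Zero C ?S ?TV"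
    unfolding \<phi>_def using graded_arrow_above[OF v(1), of n "Suc n" "v2 \<cdot> g"] j T by simp
  \<comment> \<open>Kernels are arbitrary choices; the top one is taken to be the identity so that
    the last term of the filtration is \<open>Dom C i\<close> itself and not just isomorphic to
    it.\<close>
  have "\<exists>\<kappa>. is_kernel C (\<phi> k \<cdot> i) \<kappa> \<and> (k = Suc n \<longrightarrow> \<kappa> = Ident C ?S)" for k
  proof (cases "k = Suc n")
    case True
    have "is_kernel C (Zero C ?S ?TV) (Ident C ?S)"
      by (rule is_kernelI) (use S T mono_arrow_Ident in auto)
    then show ?thesis using True top by auto
  next
    case False
    then show ?thesis using ex_kernel[of "\<phi> k \<cdot> i"] j \<phi>[of k] by auto
  qed
  then obtain \<kappa> where \<kappa>: "\<And>k. is_kernel C (\<phi> k \<cdot> i) (\<kappa> k)" "\<kappa> (Suc n) = Ident C ?S" by metis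
  have \<kappa>H: "\<kappa> k \<in> Hom C (Dom C (\<kappa> k)) ?S" for k
    using is_kernelD[OF \<kappa>(1)[of k]] \<phi>[of k] j by simp
  have NOb: "Dom C (\<kappa> k) \<in> Ob C" for k using \<kappa>H[of k] by auto
  \<comment> \<open>Here \<open>\<rho>\<close> is the idempotent \<open>e\<close> times the degree
    \<open>k\<close> projector on the power of \<open>V\<close>. It restricts along \<open>m\<close>
    to the idempotent that splits through \<open>E k\<close>, and it fixes \<open>\<phi> k\<close>
    on the image of \<open>e\<close>.\<close>
  have step: "\<exists>a b. short_exact C (Dom C (\<kappa> k)) a (Dom C (\<kappa> (Suc k))) b (E k)" for k
  proof (rule graded_piece_short_exact[where \<eta>' = "?\<epsilon> V" and \<rho> = "?\<epsilon> V \<cdot> qV k" and w = ?w and u = "u k"])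
    show "\<phi> (Suc k) \<cdot> i \<cdot> r = ?\<epsilon> V \<cdot> \<phi> (Suc k)" by (simp only: jr \<epsilon>\<phi>)
    show "\<phi> (Suc k) \<cdot> h = Zero C A ?TV" if "h \<in> Hom C A ?T" "\<phi> k \<cdot> h = Zero C A ?TV" for A h
      using graded_arrow_kernel_mono[OF dsV g that(1)] that(2) by (simp only: \<phi>_def)
    show "\<exists>\<theta>\<in>Hom C A ?TW. \<phi> k \<cdot> h = ?m \<cdot> \<theta>" if "h \<in> Hom C A ?T" "\<phi> (Suc k) \<cdot> h = Zero C A ?TV" for A h
      using graded_arrow_lift[OF se dsV ds m mi that(1)] that(2) by (simp only: \<phi>_def)
    show "mono_arrow C ?m" by (rule mono_tensor_arr[of _ _ "\<lambda>_. W" "\<lambda>_. V"]) (rule m m_mono)+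
    show "epi_arrow C ?w" by (rule epi_tensor_arr[of _ _ "\<lambda>_. P" "\<lambda>_. W"]) (rule w w_epi)+
    have "?m \<cdot> ?\<epsilon> W \<cdot> q k = ?\<epsilon> V \<cdot> ?m \<cdot> q k"
      using Comp_reassoc[OF \<epsilon>m[symmetric], of "q k"] \<epsilon> mH q[of k] by simp
    also have "\<dots> = (?\<epsilon> V \<cdot> qV k) \<cdot> ?m"
      using \<epsilon> mH qV[of k] by (simp add: qVm)
    finally show "?m \<cdot> jE k \<cdot> rE k = (?\<epsilon> V \<cdot> qV k) \<cdot> ?m" by (simp only: jrE)
    have "(?\<epsilon> V \<cdot> qV k) \<cdot> \<phi> k \<cdot> i = ?\<epsilon> V \<cdot> \<phi> k \<cdot> i"
      using Comp_reassoc[OF qV\<phi>[of k], of i] \<epsilon> qV[of k] \<phi>[of k] j by simp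
    also have "\<dots> = \<phi> k \<cdot> ?\<epsilon> Y \<cdot> i"
      using Comp_reassoc[OF \<epsilon>\<phi>[of k], of i] \<epsilon> \<phi>[of k] j by simp
    also have "?\<epsilon> Y \<cdot> i = i"
      unfolding jr[symmetric] using r j rj by simp
    finally show "(?\<epsilon> V \<cdot> qV k) \<cdot> \<phi> k \<cdot> i = \<phi> k \<cdot> i" .
    have "\<phi> k \<cdot> i \<cdot> r \<cdot> u k = \<phi> k \<cdot> ?\<epsilon> Y \<cdot> u k"
      using Comp_reassoc[OF jr, of "u k"] j r u[of k] by simp
    also have "\<dots> = ?\<epsilon> V \<cdot> \<phi> k \<cdot> u k"
      using Comp_reassoc[OF \<epsilon>\<phi>[of k], of "u k"] \<epsilon> \<phi>[of k] u[of k] by simp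
    also have "\<dots> = ?\<epsilon> V \<cdot> ?m \<cdot> q k \<cdot> ?w" by (simp only: \<phi>u)
    also have "\<dots> = ?m \<cdot> ?\<epsilon> W \<cdot> q k \<cdot> ?w"
      using Comp_reassoc[OF \<epsilon>m, of "q k \<cdot> ?w"] \<epsilon> mH q[of k] wH by simp
    also have "\<dots> = ?m \<cdot> jE k \<cdot> rE k \<cdot> ?w"
      using Comp_reassoc[OF jrE[of k], of ?w] E(1,2)[of k] \<epsilon> q[of k] wH by simp
    finally show "\<phi> k \<cdot> i \<cdot> r \<cdot> u k = ?m \<cdot> jE k \<cdot> rE k \<cdot> ?w" .
    show "?\<epsilon> V \<cdot> qV k \<in> Hom C ?TV ?TV" by (rule Comp_in_Hom[OF qV \<epsilon>(2)])
  qed (rule r j rj \<phi> \<epsilon> \<kappa> mH E wH u \<phi>u')+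
  have "cl C (Dom C (\<kappa> 0)) = \<one>\<^bsub>K0 C\<^esub>"
  proof (rule cl_eq_if_Ident_Zero[OF NOb])
    \<comment> \<open>In degree 0 only the empty index set occurs, so \<open>\<phi> 0\<close> is a
      tensor power of the monomorphism \<open>v1\<close> and its kernel vanishes.\<close>
    have "\<phi> 0 = tensor_arr (\<lambda>_. v1) n" unfolding \<phi>_def by (rule graded_arrow_0[OF v(1) v2g])
    moreover have "mono_arrow C (tensor_arr (\<lambda>_. v1) n)"
      by (rule mono_tensor_arr[of _ _ "\<lambda>_. Y" "\<lambda>_. V"]) (rule v)+
    ultimately have \<phi>0: "mono_arrow C (\<phi> 0)" by simp
    have "mono_arrow C i" by (rule split_mono_arrow[OF rj]) (use r j in auto)
    then have \<phi>i: "mono_arrow C (\<phi> 0 \<cdot> i)"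
      by (rule mono_arrow_Comp[OF _ \<phi>0]) (use j \<phi>[of 0] in auto)
    have zero: "(\<phi> 0 \<cdot> i) \<cdot> \<kappa> 0 = Zero C (Dom C (\<kappa> 0)) ?TV"
      using is_kernelD(4)[OF \<kappa>(1)[of 0]] \<phi>[of 0] j by simp
    have "\<kappa> 0 = Zero C (Dom C (\<kappa> 0)) ?S"
      by (rule mono_Zero[OF \<phi>i _ _ zero]) (use \<phi>[of 0] j \<kappa>H[of 0] in auto)
    then have "\<kappa> 0 \<cdot> Ident C (Dom C (\<kappa> 0)) = Zero C (Dom C (\<kappa> 0)) ?S"
      using \<kappa>H[of 0] by simp
    then show "Ident C (Dom C (\<kappa> 0)) = Zero C (Dom C (\<kappa> 0)) (Dom C (\<kappa> 0))"
      by (rule mono_Zero[OF is_kernel_mono[OF \<kappa>(1)[of 0]] \<kappa>H[of 0] Ident_in_Hom[OF NOb]])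
  qed
  then show ?thesis
    using step \<kappa>(2) S by (intro exI[of _ "\<lambda>k. Dom C (\<kappa> k)"]) simp
qed

end

theorem lemma4p1:
  fixes C :: "('o, 'm, 'z) tensor_cat_scheme"
  assumes "abelian_tensor_category C"
    and "biexact C"
    and "short_exact C X f Y g Z"
    and "direct_sum C X Z W i1 i2 p1 p2"
    and "integer_partition \<pi>"
    and "schur_idempotent \<pi> e"
    and "schur_object C \<pi> e Y SY"
    and "schur_object C \<pi> e W SW"
  shows "cl C SY = cl C SW"
proof -
  interpret abelian_tensor_category C by fact
  interpret biexact_tensor_category C by unfold_locales fact
  define n where "n = sum_list \<pi>"
  note se = assms(3) and ds = assms(4)
  have e: "e \<otimes>\<^bsub>sym_algebra n\<^esub> e = e" using assms(6) by (simp add: schur_idempotent_def n_def)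
  obtain iY iW where iY: "is_image C (algebra_action C Y n e) iY" "Dom C iY = SY"
    and iW: "is_image C (algebra_action C W n e) iW" "Dom C iW = SW"
    using assms(7,8) by (auto simp: schur_object_def n_def)
  note i = direct_sumD[OF ds]
  have Ob: "X \<in> Ob C" "Z \<in> Ob C" "W \<in> Ob C" using i(1,2) by auto
  let ?T = "tensor_power C W n" and ?\<epsilon> = "algebra_action C W n e"
  define q where "q k = graded_arrow n k (i1 \<cdot>\<^bsub>C\<^esub> p1) (i2 \<cdot>\<^bsub>C\<^esub> p2)" for k
  have proj: "i1 \<cdot>\<^bsub>C\<^esub> p1 \<in> Hom C W W" "i2 \<cdot>\<^bsub>C\<^esub> p2 \<in> Hom C W W"
    using i by simp_all
  have q: "q k \<in> Hom C ?T ?T" for k unfolding q_def by (rule graded_arrow_Hom[OF proj])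
  have \<epsilon>: "?\<epsilon> \<in> Hom C ?T ?T" by (rule algebra_action_Hom[OF Ob(3)])
  have \<epsilon>_idem: "?\<epsilon> \<cdot>\<^bsub>C\<^esub> ?\<epsilon> = ?\<epsilon>" by (simp only: algebra_action_mult[OF Ob(3)] e)
  have \<epsilon>q: "?\<epsilon> \<cdot>\<^bsub>C\<^esub> q k = q k \<cdot>\<^bsub>C\<^esub> ?\<epsilon>" for k
    unfolding q_def by (rule algebra_action_equivariant[OF Ob(3,3) graded_arrow_equivariant[OF proj]])
  have q_idem: "q k \<cdot>\<^bsub>C\<^esub> q k = q k" for k
  proof -
    have zero: "(i2 \<cdot>\<^bsub>C\<^esub> p2) \<cdot>\<^bsub>C\<^esub> i1 \<cdot>\<^bsub>C\<^esub> p1 = Zero C W W"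
      using Comp_reassoc[OF i(8), of p1] i Ob by simp
    have "q k \<cdot>\<^bsub>C\<^esub> q k = graded_arrow n k ((i1 \<cdot>\<^bsub>C\<^esub> p1) \<cdot>\<^bsub>C\<^esub> i1 \<cdot>\<^bsub>C\<^esub> p1) ((i2 \<cdot>\<^bsub>C\<^esub> p2) \<cdot>\<^bsub>C\<^esub> i2 \<cdot>\<^bsub>C\<^esub> p2)"
      unfolding q_def using graded_arrow_Comp[OF proj proj zero, of k k n] by simp
    also have "(i1 \<cdot>\<^bsub>C\<^esub> p1) \<cdot>\<^bsub>C\<^esub> i1 \<cdot>\<^bsub>C\<^esub> p1 = i1 \<cdot>\<^bsub>C\<^esub> p1" using Comp_reassoc[OF i(5), of p1] i by simp
    also have "(i2 \<cdot>\<^bsub>C\<^esub> p2) \<cdot>\<^bsub>C\<^esub> i2 \<cdot>\<^bsub>C\<^esub> p2 = i2 \<cdot>\<^bsub>C\<^esub> p2" using Comp_reassoc[OF i(6), of p2] i by simp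
    finally show ?thesis by (simp only: q_def)
  qed
  have \<delta>: "?\<epsilon> \<cdot>\<^bsub>C\<^esub> q k \<in> Hom C ?T ?T" for k by (rule Comp_in_Hom[OF q \<epsilon>])
  \<comment> \<open>The action of \<open>e\<close> and the degree \<open>k\<close> projector are
    idempotents that commute, because the projector is equivariant.\<close>
  have \<delta>_idem: "(?\<epsilon> \<cdot>\<^bsub>C\<^esub> q k) \<cdot>\<^bsub>C\<^esub> ?\<epsilon> \<cdot>\<^bsub>C\<^esub> q k = ?\<epsilon> \<cdot>\<^bsub>C\<^esub> q k" for k
  proof -
    have "(?\<epsilon> \<cdot>\<^bsub>C\<^esub> q k) \<cdot>\<^bsub>C\<^esub> ?\<epsilon> \<cdot>\<^bsub>C\<^esub> q k = ?\<epsilon> \<cdot>\<^bsub>C\<^esub> (q k \<cdot>\<^bsub>C\<^esub> ?\<epsilon>) \<cdot>\<^bsub>C\<^esub> q k"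
      using \<epsilon> q[of k] by simp
    also have "\<dots> = (?\<epsilon> \<cdot>\<^bsub>C\<^esub> ?\<epsilon>) \<cdot>\<^bsub>C\<^esub> q k \<cdot>\<^bsub>C\<^esub> q k"
      unfolding \<epsilon>q[symmetric] using \<epsilon> q[of k] by simp
    finally show ?thesis by (simp only: \<epsilon>_idem q_idem)
  qed
  have "\<exists>E j r. j \<in> Hom C E ?T \<and> r \<in> Hom C ?T E \<and> r \<cdot>\<^bsub>C\<^esub> j = Ident C E \<and> j \<cdot>\<^bsub>C\<^esub> r = ?\<epsilon> \<cdot>\<^bsub>C\<^esub> q k" for k
  proof -
    obtain i' where "is_image C (?\<epsilon> \<cdot>\<^bsub>C\<^esub> q k) i'" using ex_image[of "?\<epsilon> \<cdot>\<^bsub>C\<^esub> q k"] \<delta>[of k] by auto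
    from image_of_idempotent[OF this \<delta> \<delta>_idem] show ?thesis by metis
  qed
  then obtain E jE rE where E: "\<And>k. jE k \<in> Hom C (E k) ?T" "\<And>k. rE k \<in> Hom C ?T (E k)"
      "\<And>k. rE k \<cdot>\<^bsub>C\<^esub> jE k = Ident C (E k)" "\<And>k. jE k \<cdot>\<^bsub>C\<^esub> rE k = ?\<epsilon> \<cdot>\<^bsub>C\<^esub> q k"
    by metis
  \<comment> \<open>Both filtrations use the same family \<open>E\<close>: one is for the given
    sequence, the other for the split sequence, in which \<open>W\<close> takes the place of
    \<open>Y\<close>.\<close>
  obtain N where N: "cl C (N 0) = \<one>\<^bsub>K0 C\<^esub>" "N (Suc n) = SY"
      "\<And>k. k \<le> n \<Longrightarrow> \<exists>a b. short_exact C (N k) a (N (Suc k)) b (E k)"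
    using ex_tensor_filtration[OF se ds e iY(1) E(1-3) E(4)[unfolded q_def]] iY(2) by auto
  obtain M where M: "cl C (M 0) = \<one>\<^bsub>K0 C\<^esub>" "M (Suc n) = SW"
      "\<And>k. k \<le> n \<Longrightarrow> \<exists>a b. short_exact C (M k) a (M (Suc k)) b (E k)"
    using ex_tensor_filtration[OF split_short_exact[OF ds] ds e iW(1) E(1-3) E(4)[unfolded q_def]] iW(2) by auto
  \<comment> \<open>From \<open>k\<close> to \<open>Suc k\<close> both classes change by
    \<open>cl C (E k)\<close>, whatever the connecting arrows are.\<close>
  have "cl C (N k) = cl C (M k)" if "k \<le> Suc n" for k
    using that
  proof (induction k)
    case 0
    then show ?case using N(1) M(1) by simp
  next
    case (Suc k)
    then show ?case using N(3)[of k] M(3)[of k] cl_short_exact by (metis Suc_le_mono le_SucI)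
  qed
  then show ?thesis using N(2) M(2) by auto
qed

end
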